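(* Let $T>1$. (i) For each closed interval $[a,b]\subset(-1,1)$, the Lebesgue function satisfies $$\sup_{x\in[a,b]}\Lambda(x;P_N)=\mathcal{O}(\log N).$$ (ii) Over the whole interval $[-1,1]$, we have $$\sup_{x\in[-1,1]}\Lambda(x;P_N)=\mathcal{O}(N^{\frac12}).$$
   Context: Fix $T>1$. For each odd positive integer $N=2n+1$ let $\mathcal{H}_N=\mathrm{span}\{e^{\frac{i\pi}{T}kx}\}_{k=-n}^{n}\subset L^2(-1,1)$ and let $P_N$ be the orthogonal projection from $L^2(-1,1)$ onto $\mathcal{H}_N$. If $\{e_k\}_{k=1}^N$ is any orthonormal basis of $\mathcal{H}_N$ with respect to the $L^2(-1,1)$ inner product, the kernel of $P_N$ is $K_N(x,y)=\sum_{k=1}^N e_k(x)\overline{e_k(y)}$ (independent of the basis), so that $P_Nf(x)=\int_{-1}^1K_N(x,y)f(y)\,dy$. The Lebesgue function of $P_N$ at $x\in[-1,1]$ is $\Lambda(x;P_N)=\int_{-1}^1|K_N(x,y)|\,dy$. Big $\mathcal{O}$ is understood as $N\to\infty$ through odd integers, with $T$ (and $a,b$ in part (i)) fixed. *)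

theory Defs
  imports "HOL-Analysis.Analysis" "HOL-Library.Landau_Symbols"
begin

definition lincomb_span :: "('i \<Rightarrow> real \<Rightarrow> complex) \<Rightarrow> 'i set \<Rightarrow> (real \<Rightarrow> complex) set" where
  "lincomb_span v I = {f. \<exists>c. f = (\<lambda>x. \<Sum>i\<in>I. c i * v i x)}"

definition L2_inner :: "(real \<Rightarrow> complex) \<Rightarrow> (real \<Rightarrow> complex) \<Rightarrow> complex" where
  "L2_inner f g = (LINT y:{-1..1}|lborel. f y * cnj (g y))"

definition square_integrable :: "(real \<Rightarrow> complex) \<Rightarrow> bool" where
  "square_integrable f \<longleftrightarrow> f \<in> borel_measurable lborel \<and>
     set_integrable lborel {-1..1} (\<lambda>y. (cmod (f y))\<^sup>2)"

definition trig_fun :: "real \<Rightarrow> int \<Rightarrow> real \<Rightarrow> complex" where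
  "trig_fun T k x = exp (\<i> * of_real (pi / T * of_int k * x))"

text \<open>The parameter \<open>n\<close> stands for \<open>N = 2 * n + 1\<close>. Elements of the space are functions on
  the whole real line rather than classes of functions on the interval; since \<open>T > 1\<close>, such a
  function is determined by its values on the interval, and its values at the endpoints are those
  of the continuous representative.\<close>

definition trig_space :: "real \<Rightarrow> nat \<Rightarrow> (real \<Rightarrow> complex) set" where
  "trig_space T n = lincomb_span (trig_fun T) {- int n..int n}"

definition orthonormal_basis ::
    "real \<Rightarrow> nat \<Rightarrow> (nat \<Rightarrow> real \<Rightarrow> complex) \<Rightarrow> bool" where
  "orthonormal_basis T n e \<longleftrightarrow>
     (\<forall>j\<in>{1..2*n+1}. \<forall>k\<in>{1..2*n+1}. L2_inner (e j) (e k) = (if j = k then 1 else 0)) \<and>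
     lincomb_span e {1..2*n+1} = trig_space T n"

text \<open>For \<open>T > 1\<close> the definite descriptions are well-posed: see \<open>orthonormal_basis_exists\<close>,
  \<open>proj_kernel_eq\<close> and \<open>trig_proj_eq\<close> below, the last of which identifies the kernel as
  that of the orthogonal projection. The suprema of \<open>lebesgue_function\<close> are finite by
  \<open>bdd_above_lebesgue_function\<close>.\<close>

definition proj_kernel :: "real \<Rightarrow> nat \<Rightarrow> real \<Rightarrow> real \<Rightarrow> complex" where
  "proj_kernel T n = (THE K. \<exists>e. orthonormal_basis T n e \<and>
     K = (\<lambda>x y. \<Sum>k=1..2*n+1. e k x * cnj (e k y)))"

definition trig_proj :: "real \<Rightarrow> nat \<Rightarrow> (real \<Rightarrow> complex) \<Rightarrow> real \<Rightarrow> complex" where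
  "trig_proj T n f = (THE p. p \<in> trig_space T n \<and>
     (\<forall>g\<in>trig_space T n. L2_inner (\<lambda>y. f y - p y) g = 0))"

definition lebesgue_function :: "real \<Rightarrow> nat \<Rightarrow> real \<Rightarrow> real" where
  "lebesgue_function T n x = (LINT y:{-1..1}|lborel. cmod (proj_kernel T n x y))"

lemma set_integrable_continuous:
  fixes f :: "real \<Rightarrow> 'a::{banach,second_countable_topology}"
  assumes "continuous_on UNIV f"
  shows "set_integrable lborel {-1..1} f"
  by (rule borel_integrable_atLeastAtMost') (rule continuous_on_subset[OF assms subset_UNIV])

lemma lincomb_spanI: "(\<lambda>x. \<Sum>i\<in>I. c i * v i x) \<in> lincomb_span v I"
  unfolding lincomb_span_def by blast

lemma lincomb_span_member:
  assumes "finite I" "i \<in> I"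
  shows "v i \<in> lincomb_span v I"
proof -
  have "v i = (\<lambda>x. \<Sum>j\<in>I. (if j = i then 1 else 0) * v j x)"
    using assms by (simp add: if_distrib[where f="\<lambda>t. t * _"] cong: if_cong)
  then show ?thesis unfolding lincomb_span_def
    by (intro CollectI exI[where x="\<lambda>j. if j = i then 1 else 0"])
qed

lemma lincomb_span_add:
  assumes "f \<in> lincomb_span v I" "g \<in> lincomb_span v I"
  shows "(\<lambda>x. f x + g x) \<in> lincomb_span v I"
proof -
  obtain c d where "f = (\<lambda>x. \<Sum>i\<in>I. c i * v i x)" "g = (\<lambda>x. \<Sum>i\<in>I. d i * v i x)"
    using assms unfolding lincomb_span_def by blast
  then have "(\<lambda>x. f x + g x) = (\<lambda>x. \<Sum>i\<in>I. (c i + d i) * v i x)"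
    by (simp add: sum.distrib distrib_right)
  then show ?thesis unfolding lincomb_span_def by (intro CollectI exI)
qed

lemma lincomb_span_scale:
  assumes "f \<in> lincomb_span v I"
  shows "(\<lambda>x. a * f x) \<in> lincomb_span v I"
proof -
  obtain c where "f = (\<lambda>x. \<Sum>i\<in>I. c i * v i x)"
    using assms unfolding lincomb_span_def by blast
  then have "(\<lambda>x. a * f x) = (\<lambda>x. \<Sum>i\<in>I. (a * c i) * v i x)"
    by (simp add: sum_distrib_left mult.assoc)
  then show ?thesis unfolding lincomb_span_def by (intro CollectI exI)
qed

lemma lincomb_span_sum:
  assumes "\<And>j. j \<in> J \<Longrightarrow> f j \<in> lincomb_span v I"
  shows "(\<lambda>x. \<Sum>j\<in>J. c j * f j x) \<in> lincomb_span v I"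
  using assms
proof (induction J rule: infinite_finite_induct)
  case (insert j J)
  then show ?case
    using lincomb_span_add[OF lincomb_span_scale[of "f j" v I "c j"]] by simp
qed (use lincomb_spanI[of "\<lambda>_. 0" v I] in simp_all)

lemma lincomb_span_mono:
  assumes "\<And>i. i \<in> I \<Longrightarrow> v i \<in> lincomb_span w J"
  shows "lincomb_span v I \<subseteq> lincomb_span w J"
proof
  fix f assume "f \<in> lincomb_span v I"
  then obtain c where "f = (\<lambda>x. \<Sum>i\<in>I. c i * v i x)" unfolding lincomb_span_def by blast
  then show "f \<in> lincomb_span w J" using lincomb_span_sum[of I v w J c] assms by simp
qed

lemma lincomb_span_continuous:
  assumes "\<And>i. i \<in> I \<Longrightarrow> continuous_on UNIV (v i)" "f \<in> lincomb_span v I"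
  shows "continuous_on UNIV f"
proof -
  obtain c where "f = (\<lambda>x. \<Sum>i\<in>I. c i * v i x)" using assms unfolding lincomb_span_def by blast
  then show ?thesis using assms(1) by (auto intro!: continuous_intros)
qed

lemma set_lebesgue_integral_sum:
  fixes f :: "'i \<Rightarrow> real \<Rightarrow> complex"
  assumes "\<And>i. i \<in> I \<Longrightarrow> set_integrable lborel A (f i)"
  shows "(LINT y:A|lborel. (\<Sum>i\<in>I. f i y)) = (\<Sum>i\<in>I. (LINT y:A|lborel. f i y))"
  using assms unfolding set_lebesgue_integral_def set_integrable_def
  by (simp add: scaleR_sum_right Bochner_Integration.integral_sum)

lemma L2_integrable:
  assumes f: "square_integrable f" and g: "continuous_on UNIV g"
  shows "set_integrable lborel {-1..1} (\<lambda>y. f y * cnj (g y))"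
proof -
  have fm: "f \<in> borel_measurable borel" using f by (simp add: square_integrable_def)
  have i: "set_integrable lborel {-1..1} (\<lambda>y. (cmod (f y))\<^sup>2 + (cmod (g y))\<^sup>2)"
  proof (rule set_integral_add)
    show "set_integrable lborel {-1..1} (\<lambda>y. (cmod (f y))\<^sup>2)"
      using f by (simp add: square_integrable_def)
    show "set_integrable lborel {-1..1} (\<lambda>y. (cmod (g y))\<^sup>2)"
      using g by (intro set_integrable_continuous continuous_intros)
  qed
  show ?thesis
  proof (rule set_integrable_bound[OF i])
    have "(\<lambda>y. indicat_real {-1..1} y *\<^sub>R (f y * cnj (g y))) \<in> borel_measurable borel"
      using fm borel_measurable_continuous_onI[OF continuous_on_cnj[OF g]] by measurable
    then show "set_borel_measurable lborel {-1..1} (\<lambda>y. f y * cnj (g y))"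
      by (simp add: set_borel_measurable_def)
    have "cmod (f y * cnj (g y)) \<le> norm ((cmod (f y))\<^sup>2 + (cmod (g y))\<^sup>2)" for y
    proof -
      have "2 * (cmod (f y) * cmod (g y)) \<le> (cmod (f y))\<^sup>2 + (cmod (g y))\<^sup>2"
        using sum_squares_bound[of "cmod (f y)" "cmod (g y)"] by simp
      moreover have "0 \<le> cmod (f y) * cmod (g y)" by simp
      ultimately show ?thesis unfolding norm_mult complex_mod_cnj real_norm_def by linarith
    qed
    then show "AE y in lborel. y \<in> {-1..1} \<longrightarrow>
        cmod (f y * cnj (g y)) \<le> norm ((cmod (f y))\<^sup>2 + (cmod (g y))\<^sup>2)" by simp
  qed
qed

lemma square_integrable_continuous:
  assumes "continuous_on UNIV f" shows "square_integrable f"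
  using assms borel_measurable_continuous_onI[OF assms] unfolding square_integrable_def
  by (auto intro!: set_integrable_continuous continuous_intros)

lemma L2_inner_diff_left:
  assumes "square_integrable f" "square_integrable g" "continuous_on UNIV h"
  shows "L2_inner (\<lambda>x. f x - g x) h = L2_inner f h - L2_inner g h"
  unfolding L2_inner_def using L2_integrable[OF assms(1,3)] L2_integrable[OF assms(2,3)]
  by (simp add: left_diff_distrib)

lemma L2_inner_scale_left: "L2_inner (\<lambda>x. a * f x) h = a * L2_inner f h"
  unfolding L2_inner_def by (simp add: mult.assoc)

lemma L2_inner_sum_left:
  assumes "\<And>i. i \<in> I \<Longrightarrow> square_integrable (f i)" "continuous_on UNIV h"
  shows "L2_inner (\<lambda>x. \<Sum>i\<in>I. c i * f i x) h = (\<Sum>i\<in>I. c i * L2_inner (f i) h)"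
proof -
  have "set_integrable lborel {-1..1} (\<lambda>y. c i * (f i y * cnj (h y)))" if "i \<in> I" for i
    using L2_integrable[OF assms(1)[OF that] assms(2)] by (rule set_integrable_mult_right)
  then show ?thesis unfolding L2_inner_def
    by (simp add: sum_distrib_right mult.assoc set_lebesgue_integral_sum)
qed

lemma L2_inner_cnj: "L2_inner g f = cnj (L2_inner f g)"
proof -
  have "cnj (L2_inner f g) = (LINT y|lborel. cnj (indicat_real {-1..1} y *\<^sub>R (f y * cnj (g y))))"
    unfolding L2_inner_def set_lebesgue_integral_def by (rule Bochner_Integration.integral_cnj[symmetric])
  also have "\<dots> = L2_inner g f"
    unfolding L2_inner_def set_lebesgue_integral_def by (simp add: mult.commute)
  finally show ?thesis by simp
qed

lemma L2_inner_self:
  assumes "continuous_on UNIV f"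
  shows "L2_inner f f = of_real (integral {-1..1} (\<lambda>y. (cmod (f y))\<^sup>2))"
proof -
  have "L2_inner f f = (LINT y:{-1..1}|lborel. complex_of_real ((cmod (f y))\<^sup>2))"
    unfolding L2_inner_def by (simp only: complex_norm_square)
  also have "\<dots> = of_real (LINT y:{-1..1}|lborel. (cmod (f y))\<^sup>2)"
    by (rule set_integral_complex_of_real)
  also have "(LINT y:{-1..1}|lborel. (cmod (f y))\<^sup>2) = integral {-1..1} (\<lambda>y. (cmod (f y))\<^sup>2)"
    using assms by (intro set_borel_integral_eq_integral set_integrable_continuous continuous_intros)
  finally show ?thesis .
qed

lemma L2_inner_self_pos:
  assumes "continuous_on UNIV f" "x \<in> {-1..1}" "f x \<noteq> 0"
  shows "\<exists>r>0. L2_inner f f = of_real r"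
proof -
  let ?I = "integral {-1..1} (\<lambda>y. (cmod (f y))\<^sup>2)"
  have c: "continuous_on ({-1..(1::real)}) (\<lambda>y. (cmod (f y))\<^sup>2)"
    by (rule continuous_on_subset[of UNIV]) (use assms(1) in \<open>auto intro!: continuous_intros\<close>)
  have "?I = 0 \<longleftrightarrow> (\<forall>y\<in>{-1..1}. (cmod (f y))\<^sup>2 = 0)"
    by (rule integral_eq_0_iff[OF c]) auto
  then have "?I \<noteq> 0" using assms(2,3) by auto
  moreover have "?I \<ge> 0" by (rule integral_nonneg) (use integrable_continuous_real[OF c] in auto)
  ultimately show ?thesis using L2_inner_self[OF assms(1)] by (intro exI[of _ ?I]) auto
qed

lemma gram_schmidt:
  fixes v :: "nat \<Rightarrow> real \<Rightarrow> complex"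
  assumes cont: "\<And>k. continuous_on UNIV (v k)"
    and indep: "\<And>c. (\<And>x. x \<in> {-1..1} \<Longrightarrow> (\<Sum>k=1..m. c k * v k x) = 0) \<Longrightarrow>
      (\<And>k. k \<in> {1..m} \<Longrightarrow> c k = 0)"
  shows "\<exists>e. (\<forall>j\<in>{1..m}. \<forall>k\<in>{1..m}. L2_inner (e j) (e k) = (if j = k then 1 else 0)) \<and>
     lincomb_span e {1..m} = lincomb_span v {1..m}"
  using indep
proof (induction m)
  case 0
  show ?case by (simp add: lincomb_span_def)
next
  case (Suc m)
  have "c k = 0" if "\<And>x. x \<in> {-1..1} \<Longrightarrow> (\<Sum>k=1..m. c k * v k x) = 0" "k \<in> {1..m}" for c k
  proof -
    have "(c(Suc m := 0)) k = 0"
    proof (rule Suc.prems[of "c(Suc m := 0)" k])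
      fix x :: real assume "x \<in> {-1..1}"
      then have "(\<Sum>k=1..m. c k * v k x) = 0" by (rule that(1))
      moreover have "(\<Sum>k=1..m. (c(Suc m := 0)) k * v k x) = (\<Sum>k=1..m. c k * v k x)"
        by (rule sum.cong) auto
      ultimately show "(\<Sum>k=1..Suc m. (c(Suc m := 0)) k * v k x) = 0" by simp
    qed (use that in auto)
    then show ?thesis using that(2) by (auto split: if_splits)
  qed
  then obtain e where e: "\<And>j k. j \<in> {1..m} \<Longrightarrow> k \<in> {1..m} \<Longrightarrow>
      L2_inner (e j) (e k) = (if j = k then 1 else 0)"
    and span: "lincomb_span e {1..m} = lincomb_span v {1..m}"
    using Suc.IH by blast
  have ec: "continuous_on UNIV (e k)" if "k \<in> {1..m}" for k
    using lincomb_span_continuous[of "{1..m}" v "e k"] cont lincomb_span_member[of "{1..m}" k e]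
      span that by auto
  define p where "p = (\<lambda>x. \<Sum>j=1..m. L2_inner (v (Suc m)) (e j) * e j x)"
  define w where "w = (\<lambda>x. v (Suc m) x - p x)"
  have p: "p \<in> lincomb_span e {1..m}" unfolding p_def by (rule lincomb_spanI)
  then obtain c where c: "p = (\<lambda>x. \<Sum>k=1..m. c k * v k x)"
    unfolding span unfolding lincomb_span_def by blast
  have pc: "continuous_on UNIV p" by (rule lincomb_span_continuous[OF ec p])
  have wc: "continuous_on UNIV w" unfolding w_def using pc cont by (intro continuous_intros)
  have "\<exists>x\<in>{-1..1}. w x \<noteq> 0"
  proof (rule ccontr)
    assume neg: "\<not> (\<exists>x\<in>{-1..1}. w x \<noteq> 0)"
    let ?d = "(\<lambda>k. - c k)(Suc m := 1)"
    have "?d (Suc m) = 0"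
    proof (rule Suc.prems[of ?d "Suc m"])
      fix x :: real assume "x \<in> {-1..1}"
      then have "w x = 0" using neg by blast
      moreover have "(\<Sum>k=1..m. ?d k * v k x) = (\<Sum>k=1..m. - (c k * v k x))"
        by (rule sum.cong) auto
      ultimately show "(\<Sum>k=1..Suc m. ?d k * v k x) = 0"
        by (simp add: w_def c sum_negf)
    qed simp
    then show False by simp
  qed
  then obtain r where r: "r > 0" "L2_inner w w = of_real r" using L2_inner_self_pos[OF wc] by blast
  define a :: complex where "a = of_real (1 / sqrt r)"
  define u where "u = (\<lambda>x. a * w x)"
  have uc: "continuous_on UNIV u" unfolding u_def using wc by (intro continuous_intros)
  have we: "L2_inner w (e k) = 0" if k: "k \<in> {1..m}" for k
  proof -
    have "L2_inner p (e k) = (\<Sum>j=1..m. L2_inner (v (Suc m)) (e j) * L2_inner (e j) (e k))"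
      unfolding p_def using ec k by (intro L2_inner_sum_left square_integrable_continuous) auto
    also have "\<dots> = (\<Sum>j=1..m. if j = k then L2_inner (v (Suc m)) (e j) else 0)"
      using e k by (intro sum.cong) auto
    also have "\<dots> = L2_inner (v (Suc m)) (e k)" using k by simp
    finally show ?thesis unfolding w_def
      using L2_inner_diff_left[of "v (Suc m)" p "e k"] cont pc ec k
      by (simp add: square_integrable_continuous)
  qed
  have ue: "L2_inner u (e k) = 0" if "k \<in> {1..m}" for k
    using we[OF that] by (simp add: u_def L2_inner_scale_left)
  have eu: "L2_inner (e k) u = 0" if "k \<in> {1..m}" for k
    using ue[OF that] L2_inner_cnj[of "e k" u] by simp
  have uu: "L2_inner u u = 1"
  proof -
    have "L2_inner u u = a * L2_inner w u" unfolding u_def by (rule L2_inner_scale_left)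
    also have "L2_inner w u = cnj (a * L2_inner w w)"
      using L2_inner_cnj[of w u] by (simp add: u_def L2_inner_scale_left)
    finally have "L2_inner u u = of_real ((1 / sqrt r) * ((1 / sqrt r) * r))"
      by (simp only: r a_def complex_cnj_mult complex_cnj_complex_of_real of_real_mult)
    also have "(1 / sqrt r) * ((1 / sqrt r) * r) = 1" using r(1) by (simp add: field_simps)
    finally show ?thesis by simp
  qed
  define e' where "e' = e(Suc m := u)"
  have e'_old: "e' k = e k" if "k \<in> {1..m}" for k using that by (auto simp: e'_def)
  have e'_new: "e' (Suc m) = u" by (simp add: e'_def)
  have cases: "k \<in> {1..m} \<or> k = Suc m" if "k \<in> {1..Suc m}" for k using that by auto
  have old: "lincomb_span v {1..m} \<subseteq> lincomb_span v {1..Suc m}"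
    by (rule lincomb_span_mono) (auto intro: lincomb_span_member)
  have old': "lincomb_span e {1..m} \<subseteq> lincomb_span e' {1..Suc m}"
    by (rule lincomb_span_mono) (metis e'_old lincomb_span_member finite_atLeastAtMost
        atLeastAtMost_iff le_SucI)
  have vS: "v (Suc m) \<in> lincomb_span v {1..Suc m}" by (rule lincomb_span_member) auto
  have uS: "u \<in> lincomb_span e' {1..Suc m}"
    using lincomb_span_member[of "{1..Suc m}" "Suc m" e'] e'_new by simp
  have ortho: "\<forall>j\<in>{1..Suc m}. \<forall>k\<in>{1..Suc m}. L2_inner (e' j) (e' k) = (if j = k then 1 else 0)"
  proof (intro ballI)
    fix j k assume "j \<in> {1..Suc m}" "k \<in> {1..Suc m}"
    then show "L2_inner (e' j) (e' k) = (if j = k then 1 else 0)"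
      using cases[of j] cases[of k] e[of j k] ue eu uu e'_old e'_new by auto
  qed
  have "lincomb_span e' {1..Suc m} = lincomb_span v {1..Suc m}"
  proof
    have pv: "p \<in> lincomb_span v {1..Suc m}" using p span old by blast
    have "(\<lambda>x. v (Suc m) x + (-1) * p x) \<in> lincomb_span v {1..Suc m}"
      by (intro lincomb_span_add lincomb_span_scale vS pv)
    then have "w \<in> lincomb_span v {1..Suc m}" by (simp add: w_def)
    then have uv: "u \<in> lincomb_span v {1..Suc m}" unfolding u_def by (rule lincomb_span_scale)
    show "lincomb_span e' {1..Suc m} \<subseteq> lincomb_span v {1..Suc m}"
    proof (rule lincomb_span_mono)
      fix i assume "i \<in> {1..Suc m}"
      then consider "i \<in> {1..m}" | "i = Suc m" using cases by blast
      then show "e' i \<in> lincomb_span v {1..Suc m}"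
      proof cases
        case 1
        then have "e i \<in> lincomb_span e {1..m}" by (intro lincomb_span_member) auto
        then show ?thesis using e'_old[OF 1] span old by auto
      qed (use uv e'_new in simp)
    qed
    have pe: "p \<in> lincomb_span e' {1..Suc m}" using p old' by blast
    have "(\<lambda>x. p x + of_real (sqrt r) * u x) \<in> lincomb_span e' {1..Suc m}"
      by (intro lincomb_span_add lincomb_span_scale uS pe)
    moreover have "of_real (sqrt r) * a = 1"
      using r(1) by (simp add: a_def flip: of_real_mult)
    then have "v (Suc m) = (\<lambda>x. p x + of_real (sqrt r) * u x)"
      by (simp add: u_def w_def flip: mult.assoc)
    ultimately have ve: "v (Suc m) \<in> lincomb_span e' {1..Suc m}" by simp
    show "lincomb_span v {1..Suc m} \<subseteq> lincomb_span e' {1..Suc m}"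
    proof (rule lincomb_span_mono)
      fix i assume "i \<in> {1..Suc m}"
      then consider "i \<in> {1..m}" | "i = Suc m" using cases by blast
      then show "v i \<in> lincomb_span e' {1..Suc m}"
      proof cases
        case 1
        then have "v i \<in> lincomb_span v {1..m}" by (intro lincomb_span_member) auto
        then show ?thesis using span old' by auto
      qed (use ve in simp)
    qed
  qed
  with ortho show ?case by blast
qed

lemma continuous_trig_fun: "continuous_on UNIV (trig_fun T k)"
  unfolding trig_fun_def by (intro continuous_intros)

lemma trig_fun_independent:
  assumes T: "T > 1"
    and zero: "\<And>x. x \<in> {-1..1} \<Longrightarrow>
      (\<Sum>k=1..2*n+1. c k * trig_fun T (int k - int n - 1) x) = 0"
    and k: "k \<in> {1..2*n+1}"
  shows "c k = 0"
proof (rule ccontr)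
  assume "c k \<noteq> 0"
  define z where "z = trig_fun T 1"
  have pw: "trig_fun T (int i - int n) x * z x ^ n = z x ^ i" for i x
    unfolding trig_fun_def z_def
    by (simp add: exp_of_nat_mult [symmetric] exp_add [symmetric] algebra_simps
        add_divide_distrib diff_divide_distrib)
  have root: "(\<Sum>i\<le>2*n. c (Suc i) * z x ^ i) = 0" if x: "x \<in> {-1..1}" for x
  proof -
    have "(\<Sum>i\<le>2*n. c (Suc i) * z x ^ i)
        = (\<Sum>i=0..2*n. c (Suc i) * trig_fun T (int (Suc i) - int n - 1) x) * z x ^ n"
      unfolding sum_distrib_right atMost_atLeast0 by (rule sum.cong) (simp_all add: mult.assoc pw)
    also have "(\<Sum>i=0..2*n. c (Suc i) * trig_fun T (int (Suc i) - int n - 1) x)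
        = (\<Sum>k=Suc 0..Suc (2*n). c k * trig_fun T (int k - int n - 1) x)"
      by (rule sum.shift_bounds_cl_Suc_ivl[symmetric])
    also have "\<dots> = 0" using zero[OF x] by simp
    finally show ?thesis by simp
  qed
  have inj: "inj_on z {-1..1}"
  proof (rule inj_onI)
    fix x y :: real assume xy: "x \<in> {-1..1}" "y \<in> {-1..1}" "z x = z y"
    have "\<bar>x - y\<bar> < 2 * T" using xy T by auto
    then have "pi / T * \<bar>x - y\<bar> < pi / T * (2 * T)" using T by (intro mult_strict_left_mono) auto
    also have "pi / T * \<bar>x - y\<bar> = \<bar>pi / T * (x - y)\<bar>" using T by (simp only: abs_mult) simp
    also have "pi / T * (x - y) = pi / T * x - pi / T * y" by (rule right_diff_distrib)
    also have "pi / T * (2 * T) = 2 * pi" using T by simp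
    finally have "\<bar>Im (\<i> * of_real (pi / T * x)) - Im (\<i> * of_real (pi / T * y))\<bar> < 2 * pi"
      by (simp only: Im_i_times Re_complex_of_real)
    moreover have "exp (\<i> * of_real (pi / T * x)) = exp (\<i> * complex_of_real (pi / T * y))"
      using xy(3) by (simp only: z_def trig_fun_def of_int_1 mult_1_right)
    ultimately have "\<i> * of_real (pi / T * x) = \<i> * complex_of_real (pi / T * y)"
      by (rule exp_complex_eqI)
    then show "x = y" using T by simp
  qed
  have "infinite (z ` {-1..1})"
    using finite_image_iff[OF inj] infinite_Icc[of "-1" "1::real"] by simp
  moreover have "z ` {-1..1} \<subseteq> {w. (\<Sum>i\<le>2*n. c (Suc i) * w ^ i) = 0}" using root by auto
  ultimately have "\<not> finite {w. (\<Sum>i\<le>2*n. c (Suc i) * w ^ i) = 0}" using finite_subset by blast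
  moreover have "\<exists>i\<le>2*n. c (Suc i) \<noteq> 0"
    using k \<open>c k \<noteq> 0\<close> by (intro exI[of _ "k - 1"]) auto
  ultimately show False using polyfun_finite_roots[of "\<lambda>i. c (Suc i)" "2*n"] by blast
qed

lemma trig_space_alt:
  "trig_space T n = lincomb_span (\<lambda>k. trig_fun T (int k - int n - 1)) {1..2*n+1}"
proof
  show "trig_space T n \<subseteq> lincomb_span (\<lambda>k. trig_fun T (int k - int n - 1)) {1..2*n+1}"
    unfolding trig_space_def
  proof (rule lincomb_span_mono)
    fix i assume "i \<in> {- int n..int n}"
    then show "trig_fun T i \<in> lincomb_span (\<lambda>k. trig_fun T (int k - int n - 1)) {1..2*n+1}"
      using lincomb_span_member[of "{1..2*n+1}" "nat (i + int n + 1)"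
          "\<lambda>k. trig_fun T (int k - int n - 1)"] by (simp add: nat_le_iff le_nat_iff)
  qed
  show "lincomb_span (\<lambda>k. trig_fun T (int k - int n - 1)) {1..2*n+1} \<subseteq> trig_space T n"
    unfolding trig_space_def by (rule lincomb_span_mono) (auto intro!: lincomb_span_member)
qed

lemma orthonormal_basis_exists:
  assumes "T > 1" shows "\<exists>e. orthonormal_basis T n e"
  unfolding orthonormal_basis_def trig_space_alt
proof (rule gram_schmidt)
  fix c and k :: nat
  assume "\<And>x. x \<in> {-1..1} \<Longrightarrow> (\<Sum>k=1..2*n+1. c k * trig_fun T (int k - int n - 1) x) = 0"
    and "k \<in> {1..2*n+1}"
  then show "c k = 0" by (rule trig_fun_independent[OF assms])
qed (rule continuous_trig_fun)

lemma continuous_trig_space: "f \<in> trig_space T n \<Longrightarrow> continuous_on UNIV f"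
  unfolding trig_space_def by (rule lincomb_span_continuous[OF continuous_trig_fun])

lemma orthonormal_basis_member:
  assumes "orthonormal_basis T n e" "k \<in> {1..2*n+1}" shows "e k \<in> trig_space T n"
  using assms lincomb_span_member[of "{1..2*n+1}" k e] by (auto simp: orthonormal_basis_def)

lemma orthonormal_basis_expand:
  assumes e: "orthonormal_basis T n e" and f: "f \<in> trig_space T n"
  shows "f x = (\<Sum>k=1..2*n+1. L2_inner f (e k) * e k x)"
proof -
  obtain c where c: "f = (\<lambda>x. \<Sum>k=1..2*n+1. c k * e k x)"
    using e f unfolding orthonormal_basis_def lincomb_span_def by blast
  have "L2_inner f (e k) = c k" if k: "k \<in> {1..2*n+1}" for k
  proof -
    have "L2_inner f (e k) = (\<Sum>j=1..2*n+1. c j * L2_inner (e j) (e k))"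
      unfolding c using e k
      by (intro L2_inner_sum_left square_integrable_continuous continuous_trig_space
          orthonormal_basis_member) auto
    also have "\<dots> = (\<Sum>j=1..2*n+1. if j = k then c j else 0)"
      using e k unfolding orthonormal_basis_def by (intro sum.cong) auto
    also have "\<dots> = c k" using k by simp
    finally show ?thesis .
  qed
  then show ?thesis by (subst c) (auto intro!: sum.cong)
qed

lemma proj_kernel_unique:
  assumes e: "orthonormal_basis T n e" and f: "orthonormal_basis T n f"
  shows "(\<Sum>k=1..2*n+1. e k x * cnj (e k y)) = (\<Sum>j=1..2*n+1. f j x * cnj (f j y))"
proof -
  have "(\<Sum>j=1..2*n+1. f j x * cnj (f j y))
      = (\<Sum>j=1..2*n+1. (\<Sum>k=1..2*n+1. L2_inner (f j) (e k) * e k x) * cnj (f j y))"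
    using orthonormal_basis_expand[OF e orthonormal_basis_member[OF f], of _ x]
    by (intro sum.cong) auto
  also have "\<dots> = (\<Sum>k=1..2*n+1. \<Sum>j=1..2*n+1. L2_inner (f j) (e k) * e k x * cnj (f j y))"
    unfolding sum_distrib_right by (rule sum.swap)
  also have "\<dots> = (\<Sum>k=1..2*n+1. e k x * cnj (e k y))"
  proof (rule sum.cong)
    fix k assume k: "k \<in> {1..2*n+1}"
    have "cnj (e k y) = (\<Sum>j=1..2*n+1. cnj (L2_inner (e k) (f j)) * cnj (f j y))"
      using orthonormal_basis_expand[OF f orthonormal_basis_member[OF e k], of y] by simp
    also have "\<dots> = (\<Sum>j=1..2*n+1. L2_inner (f j) (e k) * cnj (f j y))"
      by (simp add: L2_inner_cnj[symmetric])
    finally show "(\<Sum>j=1..2*n+1. L2_inner (f j) (e k) * e k x * cnj (f j y)) = e k x * cnj (e k y)"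
      by (simp only: sum_distrib_left mult_ac)
  qed simp
  finally show ?thesis by simp
qed

lemma proj_kernel_eq:
  assumes e: "orthonormal_basis T n e"
  shows "proj_kernel T n x y = (\<Sum>k=1..2*n+1. e k x * cnj (e k y))"
proof -
  have "proj_kernel T n = (\<lambda>x y. \<Sum>k=1..2*n+1. e k x * cnj (e k y))"
    unfolding proj_kernel_def
  proof (rule the_equality)
    fix K assume "\<exists>e. orthonormal_basis T n e \<and> K = (\<lambda>x y. \<Sum>k=1..2*n+1. e k x * cnj (e k y))"
    then obtain f where "orthonormal_basis T n f" "K = (\<lambda>x y. \<Sum>k=1..2*n+1. f k x * cnj (f k y))"
      by blast
    then show "K = (\<lambda>x y. \<Sum>k=1..2*n+1. e k x * cnj (e k y))"
      using proj_kernel_unique[OF e] by simp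
  qed (use e in blast)
  then show ?thesis by simp
qed

lemma trig_proj_eq:
  assumes T: "T > 1" and f: "square_integrable f"
  shows trig_proj_mem: "trig_proj T n f \<in> trig_space T n"
    and trig_proj_orth: "g \<in> trig_space T n \<Longrightarrow> L2_inner (\<lambda>y. f y - trig_proj T n f y) g = 0"
    and trig_proj_kernel: "trig_proj T n f x = (LINT y:{-1..1}|lborel. proj_kernel T n x y * f y)"
proof -
  obtain e where e: "orthonormal_basis T n e" using orthonormal_basis_exists[OF T] by blast
  have ec: "continuous_on UNIV (e k)" if "k \<in> {1..2*n+1}" for k
    using continuous_trig_space orthonormal_basis_member[OF e that] by blast
  define p where "p = (\<lambda>x. \<Sum>k=1..2*n+1. L2_inner f (e k) * e k x)"
  have p: "p \<in> trig_space T n"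
    using e lincomb_spanI[where I="{1..2*n+1}" and c="\<lambda>k. L2_inner f (e k)" and v=e]
    unfolding p_def orthonormal_basis_def by blast
  have orth_iff: "q = p" if q: "q \<in> trig_space T n"
    and o: "\<forall>g\<in>trig_space T n. L2_inner (\<lambda>y. f y - q y) g = 0" for q
  proof
    fix x
    have "L2_inner q (e k) = L2_inner f (e k)" if k: "k \<in> {1..2*n+1}" for k
      using o orthonormal_basis_member[OF e k]
        L2_inner_diff_left[OF f square_integrable_continuous[OF continuous_trig_space[OF q]] ec[OF k]]
      by simp
    then show "q x = p x" unfolding p_def orthonormal_basis_expand[OF e q, of x]
      by (intro sum.cong) auto
  qed
  have pe: "L2_inner p (e k) = L2_inner f (e k)" if k: "k \<in> {1..2*n+1}" for k
  proof -
    have "L2_inner p (e k) = (\<Sum>j=1..2*n+1. L2_inner f (e j) * L2_inner (e j) (e k))"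
      unfolding p_def using ec k
      by (intro L2_inner_sum_left square_integrable_continuous) auto
    also have "\<dots> = (\<Sum>j=1..2*n+1. if j = k then L2_inner f (e j) else 0)"
      using e k unfolding orthonormal_basis_def by (intro sum.cong) auto
    finally show ?thesis using k by simp
  qed
  have po: "L2_inner (\<lambda>y. f y - p y) g = 0" if g: "g \<in> trig_space T n" for g
  proof -
    have pc: "square_integrable p"
      by (rule square_integrable_continuous[OF continuous_trig_space[OF p]])
    have gc: "continuous_on UNIV g" by (rule continuous_trig_space[OF g])
    have "L2_inner h g = (\<Sum>k=1..2*n+1. cnj (L2_inner g (e k)) * L2_inner h (e k))"
      if h: "square_integrable h" for h
    proof -
      have "L2_inner h g = (LINT y:{-1..1}|lborel.
          (\<Sum>k=1..2*n+1. cnj (L2_inner g (e k)) * (h y * cnj (e k y))))"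
        unfolding L2_inner_def[of h g]
        by (subst orthonormal_basis_expand[OF e g]) (simp only: sum_distrib_left cnj_sum complex_cnj_mult mult_ac)
      also have "\<dots> = (\<Sum>k=1..2*n+1. LINT y:{-1..1}|lborel.
          cnj (L2_inner g (e k)) * (h y * cnj (e k y)))"
        by (intro set_lebesgue_integral_sum set_integrable_mult_right L2_integrable h ec)
      finally show ?thesis by (simp add: L2_inner_def[of h])
    qed
    from this[OF f] this[OF pc] have "L2_inner f g = L2_inner p g"
      using pe by simp
    then show ?thesis using L2_inner_diff_left[OF f pc gc] by simp
  qed
  have proj: "trig_proj T n f = p"
    unfolding trig_proj_def by (rule the_equality) (use p po orth_iff in blast)+
  show "trig_proj T n f \<in> trig_space T n" using proj p by simp
  show "L2_inner (\<lambda>y. f y - trig_proj T n f y) g = 0" if "g \<in> trig_space T n"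
    using proj po[OF that] by simp
  have "(LINT y:{-1..1}|lborel. proj_kernel T n x y * f y)
      = (LINT y:{-1..1}|lborel. (\<Sum>k=1..2*n+1. e k x * (f y * cnj (e k y))))"
    by (simp only: proj_kernel_eq[OF e] sum_distrib_left mult_ac)
  also have "\<dots> = (\<Sum>k=1..2*n+1. LINT y:{-1..1}|lborel. e k x * (f y * cnj (e k y)))"
    by (intro set_lebesgue_integral_sum set_integrable_mult_right L2_integrable f ec)
  also have "\<dots> = p x" by (simp add: p_def L2_inner_def mult.commute)
  finally show "trig_proj T n f x = (LINT y:{-1..1}|lborel. proj_kernel T n x y * f y)"
    using proj by simp
qed

lemma bdd_above_lebesgue_function:
  assumes T: "T > 1" and S: "S \<subseteq> {-1..1}"
  shows "bdd_above (lebesgue_function T n ` S)"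
proof -
  obtain e where e: "orthonormal_basis T n e" using orthonormal_basis_exists[OF T] by blast
  have ec: "continuous_on UNIV (e k)" if "k \<in> {1..2*n+1}" for k
    using continuous_trig_space orthonormal_basis_member[OF e that] by blast
  have "\<exists>B. \<forall>x\<in>{-1..1}. cmod (e k x) \<le> B" if "k \<in> {1..2*n+1}" for k
  proof -
    have "compact (e k ` {-1..1})"
      by (intro compact_continuous_image continuous_on_subset[OF ec[OF that]]) auto
    then show ?thesis using compact_imp_bounded bounded_iff by (metis image_eqI)
  qed
  then obtain B where B: "\<And>k x. k \<in> {1..2*n+1} \<Longrightarrow> x \<in> {-1..1} \<Longrightarrow> cmod (e k x) \<le> B k"
    by metis
  have kc: "continuous_on UNIV (\<lambda>y. proj_kernel T n x y)" for x
    unfolding proj_kernel_eq[OF e] using ec by (intro continuous_intros) auto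
  have "lebesgue_function T n x \<le> (LINT y:{-1..1::real}|lborel. (\<Sum>k=1..2*n+1. B k * B k))"
    if x: "x \<in> {-1..1}" for x
    unfolding lebesgue_function_def
  proof (rule set_integral_mono)
    fix y :: real assume y: "y \<in> {-1..1}"
    show "cmod (proj_kernel T n x y) \<le> (\<Sum>k=1..2*n+1. B k * B k)"
      unfolding proj_kernel_eq[OF e]
    proof (rule sum_norm_le)
      fix k assume k: "k \<in> {1..2*n+1}"
      show "cmod (e k x * cnj (e k y)) \<le> B k * B k"
        unfolding norm_mult complex_mod_cnj using B[OF k x] B[OF k y]
        by (intro mult_mono) (auto intro: order_trans[OF norm_ge_zero])
    qed
  qed (use kc in \<open>auto intro!: set_integrable_continuous continuous_intros\<close>)
  then show ?thesis using S by (intro bdd_aboveI2) blast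
qed

end

theory Submission
  imports Defs
begin

text \<open>Write \<open>\<omega> = pi / (2 * T)\<close>, \<open>S = sin \<omega>\<close>, \<open>c y = cos (\<omega> * y)\<close>, \<open>u y = sin (\<omega> * y) / S\<close> and
\<open>g v = sqrt (1 - (S * v)\<^sup>2)\<close>, so that \<open>u\<close> maps \<open>[-1,1]\<close> increasingly onto itself and \<open>g (u y) = c y\<close>.
Even trigonometric polynomials of degree \<open>n\<close> are the even polynomials of degree at most \<open>2 * n\<close> in
\<open>u\<close>; odd ones are \<open>c\<close> times the odd polynomials of degree less than \<open>2 * n\<close> in \<open>u\<close>. Since
\<open>du = \<omega> / S * c dy\<close>, Lebesgue measure on \<open>[-1,1]\<close> becomes the weight \<open>1 / g\<close> for the even part
and \<open>g\<close> for the odd part. Hence the kernel of the projection is built from the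
Christoffel-Darboux kernels of degree \<open>2 * n\<close> for the two algebraic weights \<open>1 / g\<close> and \<open>g\<close> on
\<open>[-1,1]\<close> (\<open>proj_kernel_eq_arc_kern\<close>). As \<open>T > 1\<close>, both weights are smooth and bounded away from
\<open>0\<close>, so they are perturbations of the Legendre weight \<open>1\<close>.

For a weight \<open>h\<close> of this kind, Korous's argument bounds the orthonormal polynomials by those of
Legendre (\<open>abs_p_le_korous\<close>). The same commutator idea, applied to the kernels, shows that
\<open>h y * K\<^sub>h x y\<close> differs from the Legendre kernel \<open>K x y\<close> by at most a constant times the product
of values of two or three consecutive Legendre polynomials at \<open>x\<close> and at \<open>y\<close>
(\<open>kernel_comparison\<close>), which reduces everything to the Legendre case (\<open>lebesgue_comparison\<close>).

For the orthonormal Legendre polynomials \<open>q m\<close> all information comes from orthogonality: it gives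
the differential equation and the value at \<open>1\<close>, and then two monotone energies (those of Sonine
and of Bernstein) give \<open>\<bar>q m x\<bar> \<le> (1 - x\<^sup>2) powr (-1/4)\<close> and the matching bound for the derivative.
On compact subintervals of the interior the \<open>q m\<close> are bounded, so for \<open>x\<close> and \<open>y\<close> there the
Christoffel-Darboux formula bounds the kernel by a constant times \<open>1 / (1 / (m + 1) + \<bar>x - y\<bar>)\<close>,
whose integral is logarithmic; \<open>y\<close> near an endpoint contributes a bounded amount. On all of
\<open>[-1,1]\<close> one may take \<open>x \<ge> 0\<close> by symmetry. The kernel at \<open>x = 1\<close> is a combination of derivatives of
\<open>q m\<close> and \<open>q (m + 1)\<close>, of size \<open>sqrt (m + 1) * (1 - y\<^sup>2) powr (-3/4)\<close> and so with integral
\<open>O(sqrt (m + 1))\<close>. The identity \<open>kernel_via_one\<close> transports this bound to the other \<open>x\<close> as long as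
\<open>y\<close> is not close to \<open>x\<close>, and the remaining \<open>y\<close> are handled by a mean-square estimate
(\<open>kernel_pointwise\<close>).\<close>

section \<open>Weighted inner products of polynomials\<close>

lemma continuous_integrable_Icc [simp]:
  fixes f :: "real \<Rightarrow> real"
  shows "continuous_on {-1..1} f \<Longrightarrow> f integrable_on {-1..1}"
  by (rule integrable_continuous_real)

lemma integral_le_cont:
  fixes f g :: "real \<Rightarrow> real"
  assumes "continuous_on {-1..1} f" "continuous_on {-1..1} g" "\<And>x. x \<in> {-1..1} \<Longrightarrow> f x \<le> g x"
  shows "integral {-1..1} f \<le> integral {-1..1} g"
  using assms by (intro integral_le) simp_all

lemma integral_abs_bound:
  fixes f g :: "real \<Rightarrow> real"
  assumes "continuous_on {-1..1} f" "continuous_on {-1..1} g" "\<And>x. x \<in> {-1..1} \<Longrightarrow> \<bar>f x\<bar> \<le> g x"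
  shows "\<bar>integral {-1..1} f\<bar> \<le> integral {-1..1} g"
  using integral_norm_bound_integral[of f "{-1..1}" g] assms by simp

lemma integral_add_cont:
  fixes f g :: "real \<Rightarrow> real"
  assumes "continuous_on {-1..1} f" "continuous_on {-1..1} g"
  shows "integral {-1..1} (\<lambda>x. f x + g x) = integral {-1..1} f + integral {-1..1} g"
  using assms by (intro integral_add) simp_all

lemma integral_diff_cont:
  fixes f g :: "real \<Rightarrow> real"
  assumes "continuous_on {-1..1} f" "continuous_on {-1..1} g"
  shows "integral {-1..1} (\<lambda>x. f x - g x) = integral {-1..1} f - integral {-1..1} g"
  using assms by (intro integral_diff) simp_all

text \<open>The inner product of two real polynomials on \<open>[-1,1]\<close> with respect to the weight \<open>w\<close>.\<close>
definition wip :: "(real \<Rightarrow> real) \<Rightarrow> real poly \<Rightarrow> real poly \<Rightarrow> real" where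
  "wip w r s = integral {-1..1} (\<lambda>x. poly r x * poly s x * w x)"

lemma wip_commute: "wip w r s = wip w s r"
  by (simp add: wip_def mult.commute)

lemma wip_mult_left: "wip w (t * r) s = wip w r (t * s)"
  by (simp add: wip_def mult.assoc mult.left_commute)

context
  fixes w :: "real \<Rightarrow> real"
  assumes w: "continuous_on {-1..1} w"
begin

lemma wip_add_left: "wip w (r + s) t = wip w r t + wip w s t"
  unfolding wip_def using w
  by (subst integral_add_cont[symmetric]) (auto intro!: continuous_intros simp: algebra_simps)

lemma wip_diff_left: "wip w (r - s) t = wip w r t - wip w s t"
  unfolding wip_def using w
  by (subst integral_diff_cont[symmetric]) (auto intro!: continuous_intros simp: algebra_simps)

lemma wip_smult_left: "wip w (smult c r) t = c * wip w r t"
  unfolding wip_def by (simp add: mult.assoc)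

lemma wip_sum_left: "wip w (\<Sum>i\<in>I. f i) t = (\<Sum>i\<in>I. wip w (f i) t)"
proof (induction I rule: infinite_finite_induct)
  case (insert i I) then show ?case by (simp add: wip_add_left)
qed (simp_all add: wip_def)

lemma wip_self_pos:
  assumes pos: "\<And>x. x \<in> {-1..1} \<Longrightarrow> 0 < w x" and r: "r \<noteq> 0"
  shows "0 < wip w r r"
proof -
  have c: "continuous_on {-1..1} (\<lambda>x. poly r x * poly r x * w x)"
    using w by (auto intro!: continuous_intros)
  have nn: "0 \<le> poly r x * poly r x * w x" if "x \<in> {-1..1}" for x
    using pos[OF that] by simp
  have "wip w r r \<noteq> 0"
  proof
    assume "wip w r r = 0"
    then have "\<forall>x\<in>{-1..1}. poly r x * poly r x * w x = 0"
      using integral_eq_0_iff[OF c] nn by (simp add: wip_def)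
    then have "{-1..1} \<subseteq> {x. poly r x = 0}" using pos by fastforce
    then have "finite {-1..1::real}" by (rule finite_subset) (rule poly_roots_finite[OF r])
    then show False using infinite_Icc[of "-1" "1::real"] by simp
  qed
  moreover have "0 \<le> wip w r r"
    unfolding wip_def using nn c by (intro integral_nonneg) simp_all
  ultimately show ?thesis by simp
qed

end

section \<open>Orthonormal polynomials and their kernels\<close>

text \<open>Orthonormal polynomials for a positive continuous weight. The signs of the leading coefficients
are not normalised.\<close>
locale orthonormal_polys =
  fixes w :: "real \<Rightarrow> real" and p :: "nat \<Rightarrow> real poly"
  assumes w_cont: "continuous_on {-1..1} w"
    and w_pos: "\<And>x. x \<in> {-1..1} \<Longrightarrow> 0 < w x"
    and degree_p: "degree (p k) = k"
    and wip_p: "wip w (p j) (p k) = (if j = k then 1 else 0)"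

text \<open>Gram-Schmidt orthogonalisation of the monomials.\<close>
theorem orthonormal_polys_exist:
  assumes w: "continuous_on {-1..1} w" and pos: "\<And>x. x \<in> {-1..1} \<Longrightarrow> 0 < w x"
  shows "\<exists>p. orthonormal_polys w p"
proof -
  define P where "P f k r \<longleftrightarrow> degree r = k \<and> wip w r r = 1 \<and> (\<forall>j<k. wip w r (f j) = 0)"
    for f :: "nat \<Rightarrow> real poly" and k r
  have "\<exists>f. \<forall>k. P f k (f k)"
  proof (rule dependent_wellorder_choice)
    show "P f k r = P g k r" if "\<And>j. j < k \<Longrightarrow> f j = g j" for f g k r
      using that by (simp add: P_def)
  next
    fix k and f :: "nat \<Rightarrow> real poly" assume IH: "\<And>j. j < k \<Longrightarrow> P f j (f j)"
    have fo: "wip w (f i) (f j) = (if i = j then 1 else 0)" if "i < k" "j < k" for i j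
      using IH[OF that(1)] IH[OF that(2)] wip_commute[of w "f i" "f j"]
      by (cases i j rule: linorder_cases) (auto simp: P_def)
    define t where "t = (\<Sum>i<k. smult (wip w (monom 1 k) (f i)) (f i))"
    define q where "q = monom 1 k - t"
    have "degree (smult (wip w (monom 1 k) (f i)) (f i)) < k" if "i < k" for i
      using IH[OF that] that by (auto simp: P_def)
    then have "coeff t i = 0" if "i \<ge> k" for i
      using that IH unfolding t_def coeff_sum
      by (intro sum.neutral) (auto simp: P_def intro!: coeff_eq_0)
    then have cq: "coeff q i = (if i = k then 1 else 0)" if "i \<ge> k" for i
      using that by (simp add: q_def)
    have dq: "degree q = k"
      by (rule antisym) (auto intro!: degree_le le_degree simp: cq)
    have q0: "q \<noteq> 0" using cq[of k] by auto
    have orth: "wip w q (f j) = 0" if j: "j < k" for j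
      using j fo unfolding q_def t_def
      by (simp add: wip_diff_left[OF w] wip_sum_left[OF w] wip_smult_left[OF w]
          if_distrib[where f="\<lambda>t. _ * t"] cong: if_cong)
    have n: "wip w q q > 0" by (rule wip_self_pos[OF w pos q0])
    define r where "r = smult (1 / sqrt (wip w q q)) q"
    have "wip w r r = 1" using n unfolding r_def
      by (simp add: wip_smult_left[OF w] wip_commute[of w q "smult _ _"])
    moreover have "degree r = k" using n dq by (simp add: r_def)
    moreover have "wip w r (f j) = 0" if "j < k" for j
      using orth[OF that] by (simp add: r_def wip_smult_left[OF w])
    ultimately show "\<exists>r. P f k r" unfolding P_def by blast
  qed
  then obtain f where f: "\<And>k. P f k (f k)" by blast
  have "wip w (f i) (f j) = (if i = j then 1 else 0)" for i j
      using f[of i] f[of j] wip_commute[of w "f i" "f j"]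
      by (cases i j rule: linorder_cases) (auto simp: P_def)
  then show ?thesis using f w pos
    by (intro exI[of _ f] orthonormal_polys.intro) (auto simp: P_def)
qed

text \<open>The Christoffel-Darboux kernel of degree \<open>m\<close>, and its Lebesgue function. The latter is the integral
of the modulus of the kernel against Lebesgue measure, not against the weight; for weights bounded
above and away from \<open>0\<close> the two integrals are comparable.\<close>
definition poly_kernel :: "(nat \<Rightarrow> real poly) \<Rightarrow> nat \<Rightarrow> real \<Rightarrow> real \<Rightarrow> real" where
  "poly_kernel p m x y = (\<Sum>k\<le>m. poly (p k) x * poly (p k) y)"

definition poly_lebesgue :: "(nat \<Rightarrow> real poly) \<Rightarrow> nat \<Rightarrow> real \<Rightarrow> real" where
  "poly_lebesgue p m x = integral {-1..1} (\<lambda>y. \<bar>poly_kernel p m x y\<bar>)"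

lemma poly_kernel_commute: "poly_kernel p m x y = poly_kernel p m y x"
  by (simp add: poly_kernel_def mult.commute)

lemma poly_kernel_Suc:
  "poly_kernel p (Suc m) x y = poly_kernel p m x y + poly (p (Suc m)) x * poly (p (Suc m)) y"
  by (simp add: poly_kernel_def)

lemma continuous_on_poly_kernel [continuous_intros]:
  assumes "continuous_on A f" "continuous_on A g"
  shows "continuous_on A (\<lambda>y. poly_kernel p m (f y) (g y))"
  unfolding poly_kernel_def using assms by (intro continuous_intros)

text \<open>The kernel as a polynomial in its second argument.\<close>
definition kernel_poly :: "(nat \<Rightarrow> real poly) \<Rightarrow> nat \<Rightarrow> real \<Rightarrow> real poly" where
  "kernel_poly p m x = (\<Sum>k\<le>m. smult (poly (p k) x) (p k))"

lemma poly_of_kernel_poly: "poly (kernel_poly p m x) y = poly_kernel p m x y"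
  by (simp add: kernel_poly_def poly_kernel_def poly_sum)

context orthonormal_polys
begin

lemma p_nonzero [simp]: "p k \<noteq> 0"
  using wip_p[of k k] by (auto simp: wip_def)

lemma expand_exists:
  assumes "degree r \<le> m"
  shows "\<exists>c. r = (\<Sum>k\<le>m. smult (c k) (p k))"
  using assms
proof (induction m arbitrary: r)
  case 0
  have l: "coeff (p 0) 0 \<noteq> 0"
    using p_nonzero[of 0] degree_p[of 0] by (metis leading_coeff_0_iff)
  have "coeff r i = coeff (smult (coeff r 0 / coeff (p 0) 0) (p 0)) i" for i
    using l 0 degree_p[of 0] by (cases i) (simp_all add: coeff_eq_0)
  then have "r = smult (coeff r 0 / coeff (p 0) 0) (p 0)" by (rule poly_eqI)
  then show ?case by (intro exI[of _ "\<lambda>_. coeff r 0 / coeff (p 0) 0"]) simp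
next
  case (Suc m)
  define a where "a = coeff r (Suc m) / coeff (p (Suc m)) (Suc m)"
  have l: "coeff (p (Suc m)) (Suc m) \<noteq> 0"
    using p_nonzero[of "Suc m"] degree_p[of "Suc m"] by (metis leading_coeff_0_iff)
  have "coeff (r - smult a (p (Suc m))) i = 0" if "i > m" for i
    using that l Suc.prems degree_p[of "Suc m"]
    by (cases "i = Suc m") (auto simp: a_def coeff_eq_0)
  then have "degree (r - smult a (p (Suc m))) \<le> m" by (intro degree_le) auto
  from Suc.IH[OF this] obtain c where c: "r - smult a (p (Suc m)) = (\<Sum>k\<le>m. smult (c k) (p k))"
    by blast
  have "(\<Sum>k\<le>m. smult ((c(Suc m := a)) k) (p k)) = (\<Sum>k\<le>m. smult (c k) (p k))"
    by (intro sum.cong) auto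
  then have "r = (\<Sum>k\<le>Suc m. smult ((c(Suc m := a)) k) (p k))"
    using c by (simp add: algebra_simps)
  then show ?case by blast
qed

lemma expand:
  assumes "degree r \<le> m"
  shows "r = (\<Sum>k\<le>m. smult (wip w r (p k)) (p k))"
proof -
  obtain c where c: "r = (\<Sum>k\<le>m. smult (c k) (p k))" using expand_exists[OF assms] by blast
  have "wip w r (p k) = c k" if "k \<le> m" for k
    using that unfolding c
    by (simp add: wip_sum_left[OF w_cont] wip_smult_left[OF w_cont] wip_p
        if_distrib[where f="\<lambda>t. _ * t"] cong: if_cong)
  then show ?thesis using c by (metis (no_types, lifting) atMost_iff sum.cong)
qed

lemma orth_lower:
  assumes "degree r < k" shows "wip w r (p k) = 0"
proof -
  have "degree r \<le> k - 1" using assms by simp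
  then have "wip w r (p k) = (\<Sum>j\<le>k-1. wip w r (p j) * wip w (p j) (p k))"
    by (subst expand[of r "k-1"]) (simp_all add: wip_sum_left[OF w_cont] wip_smult_left[OF w_cont])
  also have "\<dots> = 0" using assms by (intro sum.neutral) (auto simp: wip_p)
  finally show ?thesis .
qed

lemma lead_nonzero: "coeff (p k) k \<noteq> 0"
  using p_nonzero[of k] degree_p[of k] by (metis leading_coeff_0_iff)

lemma wip_top:
  assumes "degree r \<le> k"
  shows "wip w r (p k) = coeff r k / coeff (p k) k"
proof -
  have "coeff r k = (\<Sum>j\<le>k. wip w r (p j) * coeff (p j) k)"
    by (subst expand[OF assms]) (simp add: coeff_sum)
  also have "\<dots> = (\<Sum>j\<in>{k}. wip w r (p j) * coeff (p j) k)"
    by (rule sum.mono_neutral_right) (auto simp: degree_p intro!: coeff_eq_0)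
  finally show ?thesis using lead_nonzero[of k] by simp
qed

lemma eq_smult_if_orth:
  assumes "degree r \<le> k" "\<And>j. j < k \<Longrightarrow> wip w r (p j) = 0"
  shows "r = smult (wip w r (p k)) (p k)"
proof -
  have "r = (\<Sum>j\<le>k. smult (wip w r (p j)) (p j))" by (rule expand[OF assms(1)])
  also have "\<dots> = (\<Sum>j\<in>{k}. smult (wip w r (p j)) (p j))"
    using assms(2) by (intro sum.mono_neutral_right) auto
  finally show ?thesis by simp
qed

lemma degree_kernel_poly: "degree (kernel_poly p m x) \<le> m"
  unfolding kernel_poly_def by (intro degree_sum_le) (auto simp: degree_p intro: order_trans[OF degree_smult_le])

lemma reproducing:
  assumes "degree r \<le> m"
  shows "integral {-1..1} (\<lambda>y. poly_kernel p m x y * poly r y * w y) = poly r x"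
proof -
  have "integral {-1..1} (\<lambda>y. poly_kernel p m x y * poly r y * w y) = wip w (kernel_poly p m x) r"
    by (simp add: wip_def poly_of_kernel_poly)
  also have "\<dots> = (\<Sum>k\<le>m. poly (p k) x * wip w r (p k))"
    by (simp add: kernel_poly_def wip_sum_left[OF w_cont] wip_smult_left[OF w_cont]
        wip_commute[of w r])
  also have "\<dots> = poly r x"
    by (subst (2) expand[OF assms]) (simp add: poly_sum mult.commute)
  finally show ?thesis .
qed

text \<open>The off-diagonal entries of the Jacobi matrix, which are the coefficients of the recurrence.\<close>
definition jacobi :: "nat \<Rightarrow> real" where
  "jacobi k = wip w ([:0, 1:] * p k) (p (Suc k))"

lemma three_term:
  "x * poly (p (Suc k)) x = jacobi (Suc k) * poly (p (Suc (Suc k))) x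
     + wip w ([:0, 1:] * p (Suc k)) (p (Suc k)) * poly (p (Suc k)) x + jacobi k * poly (p k) x"
proof -
  let ?r = "[:0, 1:] * p (Suc k)"
  have d: "degree ([:0, 1:] * p j) \<le> Suc j" for j
    using degree_mult_le[of "[:0,1:]" "p j"] degree_p[of j] by simp
  have z: "wip w ([:0, 1:] * p (Suc k)) (p j) = 0" if "j < k" for j
    using orth_lower[of "[:0, 1:] * p j" "Suc k"] d[of j] that
    by (metis wip_mult_left wip_commute Suc_less_eq le_less_trans)
  have "?r = (\<Sum>j\<le>Suc (Suc k). smult (wip w ?r (p j)) (p j))"
    by (rule expand[OF d])
  also have "\<dots> = (\<Sum>j\<in>{k, Suc k, Suc (Suc k)}. smult (wip w ?r (p j)) (p j))"
  proof (rule sum.mono_neutral_right)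
    have "wip w ?r (p j) = 0" if "j \<le> Suc (Suc k)" "j \<notin> {k, Suc k, Suc (Suc k)}" for j
      using that by (intro z) auto
    then show "\<forall>j\<in>{..Suc (Suc k)} - {k, Suc k, Suc (Suc k)}. smult (wip w ?r (p j)) (p j) = 0"
      by auto
  qed auto
  finally have "poly ?r x = poly (\<Sum>j\<in>{k, Suc k, Suc (Suc k)}. smult (wip w ?r (p j)) (p j)) x"
    by simp
  moreover have "wip w ([:0, 1:] * p (Suc k)) (p k) = jacobi k"
    unfolding jacobi_def by (metis wip_mult_left wip_commute)
  ultimately show ?thesis by (simp add: jacobi_def poly_sum algebra_simps)
qed

text \<open>The recurrence at index \<open>0\<close>, where the term with the preceding polynomial is absent.\<close>
lemma three_term_0:
  "x * poly (p 0) x = jacobi 0 * poly (p (Suc 0)) x + wip w ([:0, 1:] * p 0) (p 0) * poly (p 0) x"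
proof -
  have "degree ([:0, 1:] * p 0) \<le> Suc 0"
    using degree_mult_le[of "[:0,1:]" "p 0"] degree_p[of 0] by simp
  from expand[OF this] have "poly ([:0, 1:] * p 0) x
      = poly (\<Sum>j\<le>Suc 0. smult (wip w ([:0, 1:] * p 0) (p j)) (p j)) x" by simp
  then show ?thesis by (simp add: jacobi_def algebra_simps)
qed

theorem christoffel_darboux:
  "(x - y) * poly_kernel p m x y = jacobi m *
     (poly (p (Suc m)) x * poly (p m) y - poly (p m) x * poly (p (Suc m)) y)"
proof (induction m)
  case 0
  have "(x - y) * poly_kernel p 0 x y
      = (x * poly (p 0) x) * poly (p 0) y - poly (p 0) x * (y * poly (p 0) y)"
    by (simp add: poly_kernel_def algebra_simps)
  then show ?case unfolding three_term_0 by (simp add: algebra_simps)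
next
  case (Suc m)
  have "(x - y) * poly_kernel p (Suc m) x y = (x - y) * poly_kernel p m x y
      + ((x * poly (p (Suc m)) x) * poly (p (Suc m)) y - poly (p (Suc m)) x * (y * poly (p (Suc m)) y))"
    by (simp add: poly_kernel_Suc algebra_simps)
  then show ?case unfolding three_term Suc.IH by (simp add: algebra_simps)
qed

lemma abs_wip_le:
  "integral {-1..1} (\<lambda>x. \<bar>poly r x\<bar> * \<bar>poly s x\<bar> * w x) \<le> (wip w r r + wip w s s) / 2"
proof -
  have "integral {-1..1} (\<lambda>x. \<bar>poly r x\<bar> * \<bar>poly s x\<bar> * w x)
      \<le> integral {-1..1} (\<lambda>x. (poly r x * poly r x * w x + poly s x * poly s x * w x) / 2)"
  proof (rule integral_le_cont)
    fix x :: real assume x: "x \<in> {-1..1}"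
    have "2 * (\<bar>poly r x\<bar> * \<bar>poly s x\<bar>) \<le> poly r x * poly r x + poly s x * poly s x"
      using sum_squares_bound[of "\<bar>poly r x\<bar>" "\<bar>poly s x\<bar>"] by (simp add: power2_eq_square)
    from mult_right_mono[OF this less_imp_le[OF w_pos[OF x]]]
    show "\<bar>poly r x\<bar> * \<bar>poly s x\<bar> * w x
        \<le> (poly r x * poly r x * w x + poly s x * poly s x * w x) / 2"
      by (simp add: algebra_simps)
  qed (use w_cont in \<open>auto intro!: continuous_intros\<close>)
  also have "\<dots> = (wip w r r + wip w s s) / 2"
    unfolding wip_def using w_cont
    by (subst integral_add_cont[symmetric]) (auto intro!: continuous_intros)
  finally show ?thesis .
qed

lemma abs_jacobi_le: "\<bar>jacobi k\<bar> \<le> 1"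
proof -
  have "\<bar>jacobi k\<bar> \<le> integral {-1..1} (\<lambda>x. \<bar>poly (p k) x\<bar> * \<bar>poly (p (Suc k)) x\<bar> * w x)"
    unfolding jacobi_def wip_def
  proof (rule integral_abs_bound)
    fix x :: real assume x: "x \<in> {-1..1}"
    then have "\<bar>x\<bar> \<le> 1" by auto
    then have "\<bar>x\<bar> * (\<bar>poly (p k) x\<bar> * \<bar>poly (p (Suc k)) x\<bar> * w x)
        \<le> 1 * (\<bar>poly (p k) x\<bar> * \<bar>poly (p (Suc k)) x\<bar> * w x)"
      using w_pos[OF x] by (intro mult_right_mono) auto
    then show "\<bar>poly ([:0, 1:] * p k) x * poly (p (Suc k)) x * w x\<bar>
        \<le> \<bar>poly (p k) x\<bar> * \<bar>poly (p (Suc k)) x\<bar> * w x"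
      using w_pos[OF x] by (simp add: abs_mult mult.assoc)
  qed (use w_cont in \<open>auto intro!: continuous_intros\<close>)
  also have "\<dots> \<le> 1" using abs_wip_le[of "p k" "p (Suc k)"] by (simp add: wip_p)
  finally show ?thesis .
qed

lemma abs_kernel_diff_le:
  "\<bar>(x - y) * poly_kernel p m x y\<bar>
     \<le> \<bar>poly (p (Suc m)) x\<bar> * \<bar>poly (p m) y\<bar> + \<bar>poly (p m) x\<bar> * \<bar>poly (p (Suc m)) y\<bar>"
proof -
  let ?d = "poly (p (Suc m)) x * poly (p m) y - poly (p m) x * poly (p (Suc m)) y"
  have "\<bar>(x - y) * poly_kernel p m x y\<bar> = \<bar>jacobi m\<bar> * \<bar>?d\<bar>"
    by (simp add: christoffel_darboux abs_mult)
  also have "\<dots> \<le> 1 * \<bar>?d\<bar>" by (intro mult_right_mono abs_jacobi_le) simp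
  also have "\<dots> \<le> \<bar>poly (p (Suc m)) x * poly (p m) y\<bar> + \<bar>poly (p m) x * poly (p (Suc m)) y\<bar>"
    using abs_triangle_ineq4 by simp
  finally show ?thesis by (simp add: abs_mult)
qed

end

section \<open>Legendre polynomials\<close>

text \<open>Orthonormal Legendre polynomials, up to sign.\<close>
locale legendre_polys = orthonormal_polys "\<lambda>_. 1" q for q

lemma integral_poly_pderiv:
  "integral {-1..1} (poly (pderiv r)) = poly r 1 - poly r (-1)" for r :: "real poly"
  by (intro integral_unique fundamental_theorem_of_calculus)
    (auto intro!: derivative_eq_intros simp flip: has_real_derivative_iff_has_vector_derivative)

lemma wip_unit: "wip (\<lambda>_. 1) r s = integral {-1..1} (poly (r * s))"
proof -
  have "(\<lambda>x. poly r x * poly s x * 1) = poly (r * s)" by (simp add: fun_eq_iff)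
  then show ?thesis by (simp only: wip_def)
qed

lemma wip_by_parts:
  "wip (\<lambda>_. 1) (pderiv r) s
     = poly r 1 * poly s 1 - poly r (-1) * poly s (-1) - wip (\<lambda>_. 1) r (pderiv s)"
proof -
  have "wip (\<lambda>_. 1) (pderiv r) s + wip (\<lambda>_. 1) r (pderiv s)
      = integral {-1..1} (\<lambda>x. poly (pderiv r * s) x + poly (r * pderiv s) x)"
    unfolding wip_unit by (rule integral_add_cont[symmetric]) (intro continuous_intros)+
  also have "(\<lambda>x. poly (pderiv r * s) x + poly (r * pderiv s) x) = poly (pderiv (r * s))"
    by (simp add: fun_eq_iff pderiv_mult algebra_simps)
  finally show ?thesis by (simp add: integral_poly_pderiv)
qed

text \<open>The Legendre differential operator \<open>r \<mapsto> ((1 - x\<^sup>2) * r')'\<close>. It is symmetric for the inner product of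
the weight \<open>1\<close> because \<open>1 - x\<^sup>2\<close> vanishes at both endpoints.\<close>
definition legendre_op :: "real poly \<Rightarrow> real poly" where
  "legendre_op r = pderiv ([:1, 0, -1:] * pderiv r)"

lemma wip_legendre_op:
  "wip (\<lambda>_. 1) (legendre_op r) s = - wip (\<lambda>_. 1) ([:1, 0, -1:] * pderiv r) (pderiv s)"
  by (simp add: legendre_op_def wip_by_parts)

lemma wip_legendre_op_commute:
  "wip (\<lambda>_. 1) (legendre_op r) s = wip (\<lambda>_. 1) r (legendre_op s)"
  by (metis wip_legendre_op wip_commute wip_mult_left)

lemma coeff_legendre_op:
  "coeff (legendre_op r) k
     = real (Suc k) * (real (k + 2) * coeff r (k + 2) - real k * coeff r k)"
proof -
  have "[:1, 0, -1:] * pderiv r = pderiv r - monom 1 2 * pderiv r"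
    by (simp add: monom_altdef power2_eq_square)
  then show ?thesis
    by (cases k) (simp_all add: legendre_op_def coeff_pderiv coeff_monom_mult)
qed

lemma degree_legendre_op: "degree (legendre_op r) \<le> degree r"
  by (rule degree_le) (simp add: coeff_legendre_op coeff_eq_0)

text \<open>The form in which the sign of the derivative of an energy is used below; the segment may extend
to either side of \<open>0\<close>.\<close>
lemma mono_from_zero:
  fixes f d :: "real \<Rightarrow> real"
  assumes "\<And>z. z \<in> closed_segment 0 x \<Longrightarrow> (f has_real_derivative z * d z) (at z)"
    and "\<And>z. z \<in> closed_segment 0 x \<Longrightarrow> 0 \<le> d z"
    and "y \<in> closed_segment 0 x"
  shows "f y \<le> f x"
proof (cases "0 \<le> x")
  case True
  then have cs: "closed_segment 0 x = {0..x}" by (simp add: closed_segment_eq_real_ivl)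
  show ?thesis
  proof (rule DERIV_nonneg_imp_nondecreasing[where f = f])
    show "y \<le> x" using assms(3) cs by auto
    fix z assume "y \<le> z" "z \<le> x"
    then have "z \<in> closed_segment 0 x" using assms(3) cs by auto
    then show "\<exists>t. (f has_real_derivative t) (at z) \<and> 0 \<le> t"
      using assms(1,2) cs by (intro exI[of _ "z * d z"]) auto
  qed
next
  case False
  then have cs: "closed_segment 0 x = {x..0}" by (simp add: closed_segment_eq_real_ivl)
  show ?thesis
  proof (rule DERIV_nonpos_imp_nonincreasing[where f = f])
    show "x \<le> y" using assms(3) cs by auto
    fix z assume "x \<le> z" "z \<le> y"
    then have "z \<in> closed_segment 0 x" using assms(3) cs by auto
    then show "\<exists>t. (f has_real_derivative t) (at z) \<and> t \<le> 0"
      using assms(1,2) cs by (intro exI[of _ "z * d z"]) (auto intro: mult_nonpos_nonneg)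
  qed
qed

context legendre_polys
begin

abbreviation dq :: "nat \<Rightarrow> real poly" where "dq m \<equiv> pderiv (q m)"

text \<open>The operator is symmetric and does not raise degrees, so it maps \<open>q m\<close> to a polynomial orthogonal
to all lower degrees; the eigenvalue is read off from the leading coefficients.\<close>
lemma legendre_op_q: "legendre_op (q m) = smult (- (real m * real (m + 1))) (q m)"
proof -
  have d: "degree (legendre_op (q j)) \<le> j" for j
    using degree_legendre_op[of "q j"] by (simp add: degree_p)
  have "wip (\<lambda>_. 1) (legendre_op (q m)) (q j) = 0" if "j < m" for j
    using orth_lower[of "legendre_op (q j)" m] d[of j] that
    by (metis wip_legendre_op_commute wip_commute le_less_trans)
  then have "legendre_op (q m) = smult (wip (\<lambda>_. 1) (legendre_op (q m)) (q m)) (q m)"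
    by (rule eq_smult_if_orth[OF d])
  moreover have "wip (\<lambda>_. 1) (legendre_op (q m)) (q m) = - (real m * real (m + 1))"
    using lead_nonzero[of m] by (simp add: wip_top[OF d] coeff_legendre_op coeff_eq_0 degree_p)
  ultimately show ?thesis by simp
qed

lemma legendre_ode:
  "(1 - x\<^sup>2) * poly (pderiv (dq m)) x
     = 2 * x * poly (dq m) x - real m * real (m + 1) * poly (q m) x"
proof -
  have d: "pderiv [:1, 0, -1::real:] = [:0, -2:]" by (simp add: pderiv_pCons)
  have "poly (legendre_op (q m)) x = - (real m * real (m + 1)) * poly (q m) x"
    by (simp add: legendre_op_q)
  moreover have "poly (legendre_op (q m)) x
      = (1 - x\<^sup>2) * poly (pderiv (dq m)) x - 2 * x * poly (dq m) x"
    unfolding legendre_op_def pderiv_mult d poly_add poly_mult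
    by (simp add: power2_eq_square algebra_simps)
  ultimately show ?thesis by simp
qed

lemma dirichlet_integral:
  "wip (\<lambda>_. 1) ([:1, 0, -1:] * dq m) (dq m) = real m * real (m + 1)"
  using wip_legendre_op[of "q m" "q m"] wip_p[of m m]
  unfolding legendre_op_q wip_smult_left[OF continuous_on_const] by simp

lemma poly_q_minus: "poly (q m) (- x) = (- 1) ^ m * poly (q m) x"
proof -
  define r where "r = pcompose (q m) [:0, -1:]"
  have rx: "poly r y = poly (q m) (- y)" for y by (simp add: r_def poly_pcompose)
  have dr: "degree r \<le> m" by (simp add: r_def degree_p degree_pcompose)
  have refl: "wip (\<lambda>_. 1) r s = wip (\<lambda>_. 1) (q m) (pcompose s [:0, -1:])" for s
  proof -
    have "wip (\<lambda>_. 1) r s = integral {-1..1} (\<lambda>y. (\<lambda>x. poly (q m) x * poly s (- x)) (- y))"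
      by (simp add: wip_def rx)
    also have "\<dots> = integral {-1..1} (\<lambda>x. poly (q m) x * poly s (- x))"
      using Henstock_Kurzweil_Integration.integral_reflect_real[of 1 "-1" "\<lambda>x. poly (q m) x * poly s (- x)"] by simp
    also have "\<dots> = wip (\<lambda>_. 1) (q m) (pcompose s [:0, -1:])"
      by (simp add: wip_def poly_pcompose)
    finally show ?thesis .
  qed
  have "wip (\<lambda>_. 1) r (q j) = 0" if "j < m" for j
    using orth_lower[of "pcompose (q j) [:0, -1:]" m] that
    by (simp add: refl wip_commute[of _ "q m"] degree_p degree_pcompose)
  then have eq: "r = smult (wip (\<lambda>_. 1) r (q m)) (q m)"
    by (rule eq_smult_if_orth[OF dr])
  have "coeff r m = (- 1) ^ m * coeff (q m) m"
    by (simp add: r_def coeff_pcompose_linear)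
  then have "wip (\<lambda>_. 1) r (q m) = (- 1) ^ m"
    using lead_nonzero[of m] by (simp add: wip_top[OF dr])
  with eq have "r = smult ((- 1) ^ m) (q m)" by simp
  then show ?thesis by (metis rx poly_smult)
qed

text \<open>The value at \<open>1\<close> follows from integrating the derivative of \<open>x * (q m)\<^sup>2\<close> and from the symmetry of
\<open>(q m)\<^sup>2\<close>.\<close>
lemma poly_q_one: "(poly (q m) 1)\<^sup>2 = real m + 1 / 2"
proof -
  have d: "degree ([:0, 1:] * dq m) \<le> m"
    using degree_mult_le[of "[:0, 1:]" "dq m"] degree_pderiv[of "q m"] degree_p[of m]
    by (cases m) (auto simp: pderiv_eq_0_iff)
  have "coeff ([:0, 1:] * dq m) m = real m * coeff (q m) m"
    by (cases m) (simp_all add: coeff_pderiv)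
  then have a: "wip (\<lambda>_. 1) ([:0, 1:] * dq m) (q m) = real m"
    using lead_nonzero[of m] by (simp add: wip_top[OF d] del: mult_pCons_left)
  have "wip (\<lambda>_. 1) (pderiv ([:0, 1:] * q m)) (q m)
      = wip (\<lambda>_. 1) (q m + [:0, 1:] * dq m) (q m)"
    by (simp add: pderiv_mult pderiv_pCons algebra_simps)
  also have "\<dots> = 1 + real m"
    by (simp add: wip_add_left[OF continuous_on_const] wip_p a del: mult_pCons_left)
  finally have "1 + real m = (poly (q m) 1)\<^sup>2 + (poly (q m) (-1))\<^sup>2
      - wip (\<lambda>_. 1) ([:0, 1:] * q m) (dq m)"
    by (simp add: wip_by_parts power2_eq_square del: mult_pCons_left)
  moreover have "wip (\<lambda>_. 1) ([:0, 1:] * q m) (dq m) = real m"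
    using a by (metis wip_commute wip_mult_left)
  moreover have "(poly (q m) (-1))\<^sup>2 = (poly (q m) 1)\<^sup>2"
    using poly_q_minus[of m 1] by (simp add: power_mult_distrib flip: power_mult)
  ultimately show ?thesis by simp
qed

lemma poly_q_minus_one: "(poly (q m) (-1))\<^sup>2 = real m + 1 / 2"
  using poly_q_minus[of m 1] poly_q_one[of m] by (simp add: power_mult_distrib flip: power_mult)

text \<open>Sonine's energy. By the differential equation it is least at \<open>0\<close> and largest at the endpoints of
\<open>[-1,1]\<close>, where it equals \<open>m + 1/2\<close>. It is meant for \<open>m > 0\<close>, as it divides by \<open>m * (m + 1)\<close>.\<close>
definition sonine :: "nat \<Rightarrow> real \<Rightarrow> real" where
  "sonine m x = (poly (q m) x)\<^sup>2 + (1 - x\<^sup>2) * (poly (dq m) x)\<^sup>2 / (real m * real (m + 1))"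

lemma DERIV_sonine:
  assumes "m > 0"
  shows "(sonine m has_real_derivative x * (2 * (poly (dq m) x)\<^sup>2 / (real m * real (m + 1)))) (at x)"
proof -
  define N where "N = real m * real (m + 1)"
  have N: "N > 0" using assms by (simp add: N_def)
  let ?a = "poly (q m) x" and ?b = "poly (dq m) x" and ?c = "poly (pderiv (dq m)) x"
  have "(sonine m has_real_derivative
      2 * ?a * ?b + ((- 2 * x) * ?b\<^sup>2 + (1 - x\<^sup>2) * (2 * ?b * ?c)) / N) (at x)"
    unfolding sonine_def N_def[symmetric] using N
    by (auto intro!: derivative_eq_intros simp: power2_eq_square field_simps)
  moreover have "(1 - x\<^sup>2) * (2 * ?b * ?c) = 2 * ?b * (2 * x * ?b - N * ?a)"
    using legendre_ode[of x m] by (simp add: N_def mult_ac)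
  moreover have "2 * ?a * ?b + ((- 2 * x) * ?b\<^sup>2 + 2 * ?b * (2 * x * ?b - N * ?a)) / N
      = x * (2 * ?b\<^sup>2 / N)"
    using N by (simp add: field_simps power2_eq_square)
  ultimately show ?thesis by (simp add: N_def)
qed

lemma sonine_mono:
  assumes "m > 0" "y \<in> closed_segment 0 x"
  shows "sonine m y \<le> sonine m x"
  by (rule mono_from_zero[OF DERIV_sonine[OF assms(1)] _ assms(2)]) simp_all

lemma sonine_le:
  assumes "m > 0" "x \<in> {-1..1}"
  shows "sonine m x \<le> real m + 1 / 2"
proof (cases "0 \<le> x")
  case True
  then have "sonine m x \<le> sonine m 1"
    using assms by (intro sonine_mono) (auto simp: closed_segment_eq_real_ivl)
  then show ?thesis by (simp add: sonine_def poly_q_one)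
next
  case False
  then have "sonine m x \<le> sonine m (-1)"
    using assms by (intro sonine_mono) (auto simp: closed_segment_eq_real_ivl)
  then show ?thesis by (simp add: sonine_def poly_q_minus_one)
qed

text \<open>The minimum at \<open>0\<close> is at most the mean over \<open>[-1,1]\<close>, which is \<open>1\<close> because \<open>q m\<close> has norm \<open>1\<close> and
Dirichlet integral \<open>m * (m + 1)\<close>.\<close>
lemma sonine_zero_le:
  assumes "m > 0"
  shows "sonine m 0 \<le> 1"
proof -
  define N where "N = real m * real (m + 1)"
  have N: "N > 0" using assms by (simp add: N_def)
  have "2 * sonine m 0 = integral {-1..1} (\<lambda>x::real. sonine m 0)" by simp
  also have "\<dots> \<le> integral {-1..1} (sonine m)"
  proof (rule integral_le_cont)
    show "continuous_on {-1..1} (sonine m)"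
      using N unfolding sonine_def N_def by (auto intro!: continuous_intros)
    show "sonine m 0 \<le> sonine m x" for x by (rule sonine_mono[OF assms]) simp
  qed simp
  also have "\<dots> = integral {-1..1} (\<lambda>x. poly (q m) x * poly (q m) x * 1
      + poly ([:1, 0, -1:] * dq m) x * poly (dq m) x * 1 / N)"
    unfolding sonine_def N_def by (simp add: power2_eq_square algebra_simps)
  also have "\<dots> = wip (\<lambda>_. 1) (q m) (q m) + wip (\<lambda>_. 1) ([:1, 0, -1:] * dq m) (dq m) / N"
    unfolding wip_def
    by (subst integral_add_cont) (use assms N in \<open>auto intro!: continuous_intros\<close>)
  also have "\<dots> = 2" using assms N unfolding dirichlet_integral by (simp add: wip_p N_def)
  finally show ?thesis by simp
qed

lemma poly_q_sq_le:
  assumes "x \<in> {-1..1}"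
  shows "(poly (q m) x)\<^sup>2 \<le> real m + 1 / 2"
proof (cases "m = 0")
  case True
  obtain a where "q 0 = [:a:]" using degree_p[of 0] by (rule degree_eq_zeroE)
  then have "poly (q 0) x = poly (q 0) 1" by simp
  then show ?thesis using poly_q_one[of 0] True by simp
next
  case False
  then have "(poly (q m) x)\<^sup>2 \<le> sonine m x"
    using assms by (auto simp: sonine_def abs_square_le_1 abs_le_iff)
  then show ?thesis using sonine_le[of m x] assms False by simp
qed

lemma poly_dq_sq_le:
  assumes "x \<in> {-1..1}"
  shows "(1 - x\<^sup>2) * (poly (dq m) x)\<^sup>2 \<le> real m * real (m + 1) * (real m + 1 / 2)"
proof (cases "m = 0")
  case True
  then show ?thesis using degree_p[of 0] by (simp add: pderiv_eq_0_iff[THEN iffD2])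
next
  case False
  have "(1 - x\<^sup>2) * (poly (dq m) x)\<^sup>2 / (real m * real (m + 1)) \<le> sonine m x"
    by (simp add: sonine_def)
  also have "\<dots> \<le> real m + 1 / 2" using sonine_le[of m x] assms False by simp
  finally show ?thesis using False by (simp add: pos_divide_le_eq mult.commute)
qed

text \<open>Bernstein's energy. With \<open>x = cos \<theta>\<close>, the function \<open>U = sqrt (sin \<theta>) * q m (cos \<theta>)\<close> satisfies
\<open>U'' + \<phi> * U = 0\<close> with \<open>\<phi> = (m + 1/2)\<^sup>2 + 1 / (4 * (sin \<theta>)\<^sup>2)\<close>, and the energy is \<open>U\<^sup>2 + U'\<^sup>2 / \<phi>\<close>,
written in the variable \<open>x\<close>. It is largest at \<open>x = 0\<close> since \<open>\<phi>\<close> is least there.\<close>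
definition bernstein :: "nat \<Rightarrow> real \<Rightarrow> real" where
  "bernstein m x = sqrt (1 - x\<^sup>2) * ((poly (q m) x)\<^sup>2
     + (2 * (1 - x\<^sup>2) * poly (dq m) x - x * poly (q m) x)\<^sup>2 / (1 + (2 * real m + 1)\<^sup>2 * (1 - x\<^sup>2)))"

lemma DERIV_bernstein:
  assumes "\<bar>x\<bar> < 1"
  shows "(bernstein m has_real_derivative - (x * (2 * (2 * (1 - x\<^sup>2) * poly (dq m) x - x * poly (q m) x)\<^sup>2
      / (sqrt (1 - x\<^sup>2) * (1 + (2 * real m + 1)\<^sup>2 * (1 - x\<^sup>2))\<^sup>2)))) (at x)"
proof -
  define N where "N = real m * real (m + 1)"
  define s where "s = sqrt (1 - x\<^sup>2)"
  define \<Phi> where "\<Phi> = 1 + (2 * real m + 1)\<^sup>2 * (1 - x\<^sup>2)"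
  let ?a = "poly (q m) x" and ?b = "poly (dq m) x" and ?c = "poly (pderiv (dq m)) x"
  define g where "g = 2 * (1 - x\<^sup>2) * ?b - x * ?a"
  define g' where "g' = - x * ?b - (2 * N + 1) * ?a"
  have w: "0 < 1 - x\<^sup>2" using assms by (simp add: abs_square_less_1)
  have s: "s > 0" "s * s = 1 - x\<^sup>2" using w by (simp_all add: s_def)
  have \<Phi>: "\<Phi> > 0" using w unfolding \<Phi>_def by (intro add_pos_nonneg) auto
  have nu: "(2 * real m + 1)\<^sup>2 = 4 * N + 1" by (simp add: N_def power2_eq_square algebra_simps)
  have g'_eq: "- 4 * x * ?b + 2 * (1 - x\<^sup>2) * ?c - (?a + x * ?b) = g'"
    using legendre_ode[of x m] by (simp add: g'_def N_def algebra_simps)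
  have dg: "((\<lambda>x. 2 * (1 - x\<^sup>2) * poly (dq m) x - x * poly (q m) x) has_real_derivative g') (at x)"
    unfolding g'_eq[symmetric] by (auto intro!: derivative_eq_intros simp: power2_eq_square algebra_simps)
  have ds: "((\<lambda>x. sqrt (1 - x\<^sup>2)) has_real_derivative - x / s) (at x)"
    using w unfolding s_def by (auto intro!: derivative_eq_intros simp: field_simps)
  have dPhi: "((\<lambda>x. 1 + (2 * real m + 1)\<^sup>2 * (1 - x\<^sup>2)) has_real_derivative - 2 * x * (4 * N + 1)) (at x)"
    unfolding nu by (auto intro!: derivative_eq_intros simp: algebra_simps)
  let ?D = "(- x / s) * (?a\<^sup>2 + g\<^sup>2 / \<Phi>)
      + (2 * ?a * ?b + (2 * g * g' * \<Phi> - g\<^sup>2 * (- 2 * x * (4 * N + 1))) / (\<Phi> * \<Phi>)) * s"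
  have dg2: "((\<lambda>x. (2 * (1 - x\<^sup>2) * poly (dq m) x - x * poly (q m) x)\<^sup>2)
      has_real_derivative 2 * g * g') (at x)"
    by (rule DERIV_cong[OF DERIV_power[OF dg, of 2]]) (simp add: g_def)
  have da: "((\<lambda>x. (poly (q m) x)\<^sup>2) has_real_derivative 2 * ?a * ?b) (at x)"
    by (rule DERIV_cong[OF DERIV_power[OF poly_DERIV, of _ 2]]) simp
  have "1 + (2 * real m + 1)\<^sup>2 * (1 - x\<^sup>2) \<noteq> 0" using \<Phi> by (simp add: \<Phi>_def)
  from DERIV_mult[OF ds DERIV_add[OF da DERIV_divide[OF dg2 dPhi this]]]
  have "(bernstein m has_real_derivative ?D) (at x)"
    by (simp only: bernstein_def[abs_def] g_def s_def \<Phi>_def)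
  moreover have "?D = - (x * (2 * g\<^sup>2 / (s * \<Phi>\<^sup>2)))" (is "?L = ?R")
  proof -
    define v where "v = 1 - x\<^sup>2"
    have sv: "s * s = v" using s(2) by (simp add: v_def)
    have Pv: "\<Phi> = 1 + (4 * N + 1) * v" by (simp add: \<Phi>_def nu v_def)
    have gv: "g = 2 * v * ?b - x * ?a" by (simp add: g_def v_def)
    have xv: "x * x = 1 - v" by (simp add: v_def power2_eq_square)
    have key: "?a * \<Phi> + x * g + 2 * v * g' = 0"
    proof -
      have "?a * \<Phi> + x * g + 2 * v * g' = ?a * (\<Phi> - x * x - 2 * v * (2 * N + 1))"
        unfolding gv g'_def by (simp add: algebra_simps)
      also have "\<dots> = 0" unfolding xv Pv by (simp add: algebra_simps)
      finally show ?thesis .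
    qed
    have "?L * (s * \<Phi>\<^sup>2) = (- x) * (?a\<^sup>2 * \<Phi>\<^sup>2 + g\<^sup>2 * \<Phi>)
        + (s * s) * (2 * ?a * ?b * \<Phi>\<^sup>2 + (2 * g * g' * \<Phi> + g\<^sup>2 * (2 * x * (4 * N + 1))))"
    proof -
      have "(- x / s) * (A + B / \<Phi>) * (s * \<Phi>\<^sup>2) = (- x) * (A * \<Phi>\<^sup>2 + B * \<Phi>)" for A B
        using s(1) \<Phi> by (simp add: field_simps power2_eq_square)
      moreover have "(A + B / (\<Phi> * \<Phi>)) * s * (s * \<Phi>\<^sup>2) = (s * s) * (A * \<Phi>\<^sup>2 + B)" for A B
        using s(1) \<Phi> by (simp add: field_simps power2_eq_square)
      ultimately show ?thesis by (simp only: distrib_right) simp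
    qed
    also have "\<dots> = \<Phi> * (?a * \<Phi> * (2 * v * ?b - x * ?a) - x * g\<^sup>2 + 2 * v * g * g')
        + 2 * x * g\<^sup>2 * ((4 * N + 1) * v)"
      unfolding sv by algebra
    also have "\<dots> = \<Phi> * (?a * \<Phi> * g - x * g\<^sup>2 + 2 * v * g * g') + 2 * x * g\<^sup>2 * (\<Phi> - 1)"
      unfolding gv[symmetric] by (simp add: Pv)
    also have "\<dots> = \<Phi> * g * (?a * \<Phi> + x * g + 2 * v * g') - 2 * x * g\<^sup>2"
      by algebra
    also have "\<dots> = ?R * (s * \<Phi>\<^sup>2)" unfolding key using s(1) \<Phi> by simp
    finally have "?L * (s * \<Phi>\<^sup>2) = ?R * (s * \<Phi>\<^sup>2)" .
    moreover have "s * \<Phi>\<^sup>2 \<noteq> 0" using s(1) \<Phi> by simp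
    ultimately show ?thesis by (simp only: mult_cancel_right) simp
  qed
  ultimately show ?thesis by (simp add: g_def s_def \<Phi>_def)
qed

lemma bernstein_le:
  assumes "m > 0" "\<bar>x\<bar> < 1"
  shows "bernstein m x \<le> 1"
proof -
  have "- bernstein m 0 \<le> - bernstein m x"
  proof (rule mono_from_zero[where f = "\<lambda>x. - bernstein m x" and d = "\<lambda>z. 2 * (2 * (1 - z\<^sup>2) * poly (dq m) z - z * poly (q m) z)\<^sup>2
      / (sqrt (1 - z\<^sup>2) * (1 + (2 * real m + 1)\<^sup>2 * (1 - z\<^sup>2))\<^sup>2)"])
    fix z assume "z \<in> closed_segment 0 x"
    then have z: "\<bar>z\<bar> < 1" using assms(2) by (auto simp: closed_segment_eq_real_ivl split: if_splits)
    show "((\<lambda>x. - bernstein m x) has_real_derivative z *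
      (2 * (2 * (1 - z\<^sup>2) * poly (dq m) z - z * poly (q m) z)\<^sup>2
      / (sqrt (1 - z\<^sup>2) * (1 + (2 * real m + 1)\<^sup>2 * (1 - z\<^sup>2))\<^sup>2))) (at z)"
      using DERIV_minus[OF DERIV_bernstein[OF z, of m]] by simp
    show "0 \<le> 2 * (2 * (1 - z\<^sup>2) * poly (dq m) z - z * poly (q m) z)\<^sup>2
      / (sqrt (1 - z\<^sup>2) * (1 + (2 * real m + 1)\<^sup>2 * (1 - z\<^sup>2))\<^sup>2)"
      using z by (intro divide_nonneg_nonneg mult_nonneg_nonneg) (auto simp: abs_square_le_1)
  qed auto
  then have "bernstein m x \<le> bernstein m 0" by simp
  also have "bernstein m 0 \<le> sonine m 0"
  proof -
    have N: "0 < real m * real (m + 1)" using assms(1) by simp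
    have "(2 * poly (dq m) 0)\<^sup>2 / (1 + (2 * real m + 1)\<^sup>2)
        \<le> (2 * poly (dq m) 0)\<^sup>2 / (4 * (real m * real (m + 1)))"
      using N by (intro divide_left_mono mult_pos_pos add_pos_nonneg)
        (use assms(1) in \<open>auto simp: power2_eq_square algebra_simps\<close>)
    also have "\<dots> = (poly (dq m) 0)\<^sup>2 / (real m * real (m + 1))"
      by (simp add: power_mult_distrib)
    finally show ?thesis by (simp add: bernstein_def sonine_def)
  qed
  also have "\<dots> \<le> 1" by (rule sonine_zero_le[OF assms(1)])
  finally show ?thesis by simp
qed

lemma bernstein_q:
  assumes "\<bar>x\<bar> < 1"
  shows "sqrt (1 - x\<^sup>2) * (poly (q m) x)\<^sup>2 \<le> 1"
proof (cases "m = 0")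
  case True
  have "x \<in> {-1..1}" using assms by auto
  then have "(poly (q 0) x)\<^sup>2 \<le> 1 / 2" using poly_q_sq_le[of x 0] by simp
  moreover have "sqrt (1 - x\<^sup>2) \<le> 1" by simp
  ultimately have "sqrt (1 - x\<^sup>2) * (poly (q 0) x)\<^sup>2 \<le> 1 * (1 / 2)"
    by (intro mult_mono) auto
  then show ?thesis using True by simp
next
  case False
  have w: "0 \<le> 1 - x\<^sup>2" using assms by (simp add: abs_square_le_1)
  have "sqrt (1 - x\<^sup>2) * (poly (q m) x)\<^sup>2 \<le> bernstein m x"
    unfolding bernstein_def using w by (intro mult_left_mono) (auto intro!: divide_nonneg_nonneg add_nonneg_nonneg)
  also have "\<dots> \<le> 1" using bernstein_le[of m x] assms False by simp
  finally show ?thesis .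
qed

text \<open>The two energies complement each other: the one of Bernstein controls the derivative at distance
more than about \<open>1 / m\<^sup>2\<close> from the endpoints, the one of Sonine closer to them.\<close>
lemma bernstein_dq:
  assumes "\<bar>x\<bar> < 1"
  shows "sqrt (1 - x\<^sup>2) * (1 - x\<^sup>2) * (poly (dq m) x)\<^sup>2 \<le> 2 * (2 * real m + 1)\<^sup>2"
proof (cases "m = 0")
  case True
  then show ?thesis using degree_p[of 0] by (simp add: pderiv_eq_0_iff[THEN iffD2])
next
  case False
  let ?w = "1 - x\<^sup>2" and ?a = "poly (q m) x" and ?b = "poly (dq m) x"
  define s where "s = sqrt ?w"
  define \<Phi> where "\<Phi> = 1 + (2 * real m + 1)\<^sup>2 * ?w"
  define g where "g = 2 * ?w * ?b - x * ?a"
  have w: "0 < ?w" using assms by (simp add: abs_square_less_1)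
  have s: "s > 0" "s * s = ?w" using w by (simp_all add: s_def)
  have \<Phi>: "\<Phi> > 0" using w unfolding \<Phi>_def by (intro add_pos_nonneg) auto
  show ?thesis
  proof (cases "(2 * real m + 1)\<^sup>2 * ?w \<ge> 1")
    case True
    have "s * g\<^sup>2 / \<Phi> \<le> bernstein m x"
      using s(1) by (simp add: bernstein_def s_def g_def \<Phi>_def distrib_left)
    also have "\<dots> \<le> 1" using bernstein_le[of m x] assms False by simp
    finally have sg: "s * g\<^sup>2 \<le> \<Phi>" using \<Phi> by (simp add: pos_divide_le_eq)
    have "x\<^sup>2 * ?a\<^sup>2 \<le> 1 * ?a\<^sup>2" using w by (intro mult_right_mono) auto
    then have "s * (x * ?a)\<^sup>2 \<le> s * ?a\<^sup>2"
      using s(1) by (simp add: power_mult_distrib)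
    also have "\<dots> \<le> 1" using bernstein_q[OF assms, of m] by (simp add: s_def)
    finally have sa: "s * (x * ?a)\<^sup>2 \<le> 1" .
    have "(2 * ?w * ?b)\<^sup>2 = (g + x * ?a)\<^sup>2" by (simp add: g_def)
    also have "\<dots> \<le> 2 * g\<^sup>2 + 2 * (x * ?a)\<^sup>2"
      using sum_squares_bound[of g "x * ?a"] unfolding power2_sum by simp
    finally have "s * (2 * ?w * ?b)\<^sup>2 \<le> s * (2 * g\<^sup>2 + 2 * (x * ?a)\<^sup>2)"
      using s(1) by (intro mult_left_mono) auto
    also have "\<dots> = 2 * (s * g\<^sup>2) + 2 * (s * (x * ?a)\<^sup>2)" by (simp add: algebra_simps)
    also have "\<dots> \<le> 2 * \<Phi> + 2" using sg sa by simp
    also have "\<dots> = 4 + 2 * ((2 * real m + 1)\<^sup>2 * ?w)" by (simp add: \<Phi>_def)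
    also have "\<dots> \<le> 8 * ((2 * real m + 1)\<^sup>2 * ?w)" 
    proof -
      have "4 + 2 * Y \<le> 8 * Y" if "1 \<le> Y" for Y :: real using that by simp
      from this[OF True] show ?thesis .
    qed
    finally have "(s * ?w * ?b\<^sup>2) * (4 * ?w) \<le> (2 * (2 * real m + 1)\<^sup>2) * (4 * ?w)"
      by (simp only: power2_eq_square[of "2 * ?w * ?b"] power2_eq_square[of ?b]) (simp only: mult_ac)
    then show ?thesis unfolding s_def[symmetric] by (rule mult_right_le_imp_le) (use w in simp)
  next
    case False
    have "(s * (2 * real m + 1))\<^sup>2 = (2 * real m + 1)\<^sup>2 * (s * s)"
      by (simp only: power2_eq_square mult_ac)
    also have "\<dots> \<le> 1\<^sup>2" using False unfolding s(2) by simp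
    finally have s1: "s * (2 * real m + 1) \<le> 1" by (rule power2_le_imp_le) simp
    have "s * (?w * ?b\<^sup>2) \<le> s * (real m * real (m + 1) * (real m + 1 / 2))"
      using s(1) assms by (intro mult_left_mono poly_dq_sq_le) auto
    also have "\<dots> = (s * (2 * real m + 1)) * (real m * real (m + 1) / 2)" by (simp add: algebra_simps)
    also have "\<dots> \<le> 1 * (real m * real (m + 1) / 2)" using s1 by (intro mult_right_mono) auto
    also have "\<dots> \<le> 2 * (2 * real m + 1)\<^sup>2" by (simp add: power2_eq_square algebra_simps)
    finally show ?thesis by (simp add: s_def mult.assoc)
  qed
qed

end

section \<open>Lebesgue functions of Legendre expansions\<close>

lemma has_integral_powr_end:
  "((\<lambda>y. (1 - y) powr (- 3 / 4) + (1 + y) powr (- 3 / 4)) has_integral 8 * 2 powr (1 / 4)) {-1..1::real}"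
proof -
  have "((\<lambda>y. (1 - y) powr (- 3 / 4) + (1 + y) powr (- 3 / 4)) has_integral
      (4 * (1 + 1) powr (1 / 4) - 4 * (1 - 1) powr (1 / 4))
      - (4 * (1 + - 1) powr (1 / 4) - 4 * (1 - - 1) powr (1 / 4))) {-1..1::real}"
  proof (rule fundamental_theorem_of_calculus_interior)
    show "continuous_on {-1..1} (\<lambda>y::real. 4 * (1 + y) powr (1 / 4) - 4 * (1 - y) powr (1 / 4))"
      by (intro continuous_on_diff continuous_on_mult_left continuous_on_powr' continuous_intros) auto
    fix y :: real assume y: "y \<in> {-1<..<1}"
    have "((\<lambda>y::real. 4 * (1 + y) powr (1 / 4) - 4 * (1 - y) powr (1 / 4))
      has_real_derivative (1 - y) powr (- 3 / 4) + (1 + y) powr (- 3 / 4)) (at y)"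
      using y by (auto intro!: derivative_eq_intros)
    then show "((\<lambda>y::real. 4 * (1 + y) powr (1 / 4) - 4 * (1 - y) powr (1 / 4))
      has_vector_derivative (1 - y) powr (- 3 / 4) + (1 + y) powr (- 3 / 4)) (at y)"
      by (simp add: has_real_derivative_iff_has_vector_derivative)
  qed simp
  then show ?thesis by simp
qed

lemma edge_weight_le:
  fixes y :: real
  assumes "\<bar>y\<bar> < 1"
  shows "(1 - y\<^sup>2) powr (- 3 / 4) \<le> (1 - y) powr (- 3 / 4) + (1 + y) powr (- 3 / 4)"
proof -
  have *: "(1 - y\<^sup>2) powr (- 3 / 4) \<le> t powr (- 3 / 4)" if "0 < t" "t \<le> 1 - y\<^sup>2" for t
    using that by (intro powr_mono2') auto
  show ?thesis
  proof (cases "0 \<le> y")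
    case True
    have "1 - y \<le> 1 - y\<^sup>2" using True assms by (simp add: power2_eq_square mult_left_le)
    then show ?thesis using *[of "1 - y"] assms by (simp add: add_increasing2)
  next
    case False
    have "y * (y + 1) \<le> 0" using False assms by (intro mult_nonpos_nonneg) auto
    then have "1 + y \<le> 1 - y\<^sup>2" by (simp add: power2_eq_square algebra_simps)
    then show ?thesis using *[of "1 + y"] assms by (simp add: add_increasing)
  qed
qed

text \<open>Comparison on the open interval suffices. This matters for majorants that are singular at the
endpoints, as \<open>0 powr a = 0\<close> makes their value there useless.\<close>
lemma integral_le_open:
  fixes f g :: "real \<Rightarrow> real"
  assumes "continuous_on {-1..1} f" "(g has_integral I) {-1..1}"
    and le: "\<And>y. -1 < y \<Longrightarrow> y < 1 \<Longrightarrow> f y \<le> g y"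
  shows "integral {-1..1} f \<le> I"
proof -
  define g' where "g' = (\<lambda>y. if y \<in> {-1<..<1} then g y else f y)"
  have "(g' has_integral I) (cbox (-1) 1)"
  proof (rule has_integral_spike_interior)
    show "(g has_integral I) (cbox (-1) 1)" using assms(2) by (simp only: box_real)
  qed (simp add: g'_def box_real)
  then have g': "(g' has_integral I) {-1..1}" by (simp only: box_real)
  have f: "(f has_integral integral {-1..1} f) {-1..1}"
    using assms(1) by (simp add: integrable_integral)
  show ?thesis
  proof (rule has_integral_le[OF f g'])
    show "f y \<le> g' y" if "y \<in> {-1..1}" for y using le[of y] by (auto simp: g'_def)
  qed
qed

lemma integral_inverse_dist_le:
  fixes x \<epsilon> :: real
  assumes "\<epsilon> > 0" "x \<in> {-1..1}"
  shows "integral {-1..1} (\<lambda>y. 1 / (\<epsilon> + \<bar>x - y\<bar>)) \<le> 2 * ln ((\<epsilon> + 2) / \<epsilon>)"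
proof -
  let ?f = "\<lambda>y. 1 / (\<epsilon> + \<bar>x - y\<bar>)"
  have 1: "(?f has_integral (- ln (\<epsilon> + x - x)) - (- ln (\<epsilon> + x - (-1)))) {-1..x}"
  proof (rule fundamental_theorem_of_calculus)
    fix y assume y: "y \<in> {-1..x}"
    have "((\<lambda>y. - ln (\<epsilon> + x - y)) has_real_derivative ?f y) (at y)"
      using y assms by (auto intro!: derivative_eq_intros simp: algebra_simps)
    then show "((\<lambda>y. - ln (\<epsilon> + x - y)) has_vector_derivative ?f y) (at y within {-1..x})"
      by (auto simp: has_real_derivative_iff_has_vector_derivative intro: has_vector_derivative_at_within)
  qed (use assms in auto)
  have 2: "(?f has_integral (ln (\<epsilon> + 1 - x)) - (ln (\<epsilon> + x - x))) {x..1}"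
  proof (rule fundamental_theorem_of_calculus)
    fix y assume y: "y \<in> {x..1}"
    have "((\<lambda>y. ln (\<epsilon> + y - x)) has_real_derivative ?f y) (at y)"
      using y assms by (auto intro!: derivative_eq_intros simp: algebra_simps)
    then show "((\<lambda>y. ln (\<epsilon> + y - x)) has_vector_derivative ?f y) (at y within {x..1})"
      by (auto simp: has_real_derivative_iff_has_vector_derivative intro: has_vector_derivative_at_within)
  qed (use assms in auto)
  have "integral {-1..1} ?f = (- ln (\<epsilon> + x - x)) - (- ln (\<epsilon> + x - (-1))) + ((ln (\<epsilon> + 1 - x)) - (ln (\<epsilon> + x - x)))"
    using assms by (intro integral_unique has_integral_combine[OF _ _ 1 2]) auto
  also have "\<dots> = ln (\<epsilon> + x + 1) + ln (\<epsilon> + 1 - x) - 2 * ln \<epsilon>" by simp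
  also have "\<dots> \<le> ln (\<epsilon> + 2) + ln (\<epsilon> + 2) - 2 * ln \<epsilon>"
    using assms by (intro diff_mono add_mono) auto
  also have "\<dots> = 2 * ln ((\<epsilon> + 2) / \<epsilon>)" using assms by (simp add: ln_div)
  finally show ?thesis .
qed

lemma (in orthonormal_polys) integral_kernel_sq:
  "integral {-1..1} (\<lambda>y. (poly_kernel p m x y)\<^sup>2 * w y) = poly_kernel p m x x"
  using reproducing[OF degree_kernel_poly[of m x], of x]
  by (simp add: poly_of_kernel_poly power2_eq_square)

context legendre_polys
begin

lemma abs_q_le_at_one:
  assumes "x \<in> {-1..1}"
  shows "\<bar>poly (q m) x\<bar> \<le> \<bar>poly (q m) 1\<bar>"
  using poly_q_sq_le[OF assms, of m] unfolding poly_q_one[symmetric] by (rule abs_le_square_iff[THEN iffD2])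

lemma abs_q_one: "\<bar>poly (q m) 1\<bar> = sqrt (real m + 1 / 2)"
  using poly_q_one[of m] by (metis real_sqrt_abs)

lemma q_one_nonzero: "poly (q m) 1 \<noteq> 0"
  using poly_q_one[of m] by (metis add_nonneg_pos half_gt_zero_iff less_irrefl of_nat_0_le_iff power2_eq_square mult_zero_left zero_less_one)

lemma abs_q_le_powr:
  assumes "\<bar>x\<bar> < 1"
  shows "\<bar>poly (q m) x\<bar> \<le> (1 - x\<^sup>2) powr (- 1 / 4)"
proof (rule power2_le_imp_le)
  have w: "0 < 1 - x\<^sup>2" using assms by (simp add: abs_square_less_1)
  have "((1 - x\<^sup>2) powr (- 1 / 4))\<^sup>2 = (1 - x\<^sup>2) powr (- 1 / 2)"
    using w by (simp add: power2_eq_square flip: powr_add)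
  also have "\<dots> = 1 / sqrt (1 - x\<^sup>2)"
    using w by (simp add: powr_minus_divide powr_half_sqrt)
  finally show "\<bar>poly (q m) x\<bar>\<^sup>2 \<le> ((1 - x\<^sup>2) powr (- 1 / 4))\<^sup>2"
    using bernstein_q[OF assms, of m] w by (simp add: pos_le_divide_eq mult.commute)
qed simp

lemma abs_dq_le_powr:
  assumes "\<bar>x\<bar> < 1"
  shows "\<bar>poly (dq m) x\<bar> \<le> 2 * (2 * real m + 1) * (1 - x\<^sup>2) powr (- 3 / 4)"
proof (rule power2_le_imp_le)
  have w: "0 < 1 - x\<^sup>2" using assms by (simp add: abs_square_less_1)
  have "((1 - x\<^sup>2) powr (- 3 / 4))\<^sup>2 = (1 - x\<^sup>2) powr (- (1 / 2 + 1))"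
    using w by (simp add: power2_eq_square flip: powr_add)
  also have "\<dots> = 1 / (sqrt (1 - x\<^sup>2) * (1 - x\<^sup>2))"
    unfolding powr_minus_divide powr_add using w by (simp add: powr_half_sqrt)
  finally have *: "(2 * (2 * real m + 1) * (1 - x\<^sup>2) powr (- 3 / 4))\<^sup>2
      = 4 * (2 * real m + 1)\<^sup>2 / (sqrt (1 - x\<^sup>2) * (1 - x\<^sup>2))"
    unfolding power_mult_distrib by simp
  have "sqrt (1 - x\<^sup>2) * (1 - x\<^sup>2) * (poly (dq m) x)\<^sup>2 \<le> 4 * (2 * real m + 1)\<^sup>2"
    by (rule order_trans[OF bernstein_dq[OF assms]]) simp
  then have "(poly (dq m) x)\<^sup>2 \<le> 4 * (2 * real m + 1)\<^sup>2 / (sqrt (1 - x\<^sup>2) * (1 - x\<^sup>2))"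
    using w by (subst pos_le_divide_eq) (simp_all add: mult.commute)
  then show "\<bar>poly (dq m) x\<bar>\<^sup>2 \<le> (2 * (2 * real m + 1) * (1 - x\<^sup>2) powr (- 3 / 4))\<^sup>2"
    unfolding * by simp
qed simp

text \<open>With \<open>e = q m / q m 1 + q (m + 1) / q (m + 1) 1\<close> we have \<open>e 1 = 2\<close> and, by parity, \<open>e (-1) = 0\<close>.
Integration by parts then shows that \<open>e'\<close> has the inner product \<open>2 * r 1\<close> with every polynomial \<open>r\<close>
of degree at most \<open>m\<close>, which characterises twice the kernel at \<open>1\<close>.\<close>
lemma kernel_at_one:
  "2 * poly_kernel q m 1 y
     = poly (dq m) y / poly (q m) 1 + poly (dq (Suc m)) y / poly (q (Suc m)) 1"
proof -
  define e where "e = smult (1 / poly (q m) 1) (q m) + smult (1 / poly (q (Suc m)) 1) (q (Suc m))"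
  have e1: "poly e 1 = 2" using q_one_nonzero by (simp add: e_def)
  have e2: "poly e (-1) = 0"
    using q_one_nonzero poly_q_minus[of m 1] poly_q_minus[of "Suc m" 1] by (simp add: e_def)
  have "degree e \<le> Suc m"
    unfolding e_def by (intro degree_add_le order_trans[OF degree_smult_le]) (simp_all add: degree_p)
  then have d: "degree (pderiv e) \<le> m" by (simp add: degree_pderiv)
  have "wip (\<lambda>_. 1) (pderiv e) (q k) = 2 * poly (q k) 1" if "k \<le> m" for k
  proof -
    have "wip (\<lambda>_. 1) (dq k) (q j) = 0" if j: "j \<ge> k" for j
    proof (cases "k = 0")
      case True
      then have "dq k = 0" using degree_p[of k] by (simp add: pderiv_eq_0_iff)
      then show ?thesis by (simp add: wip_def)
    next
      case False
      then show ?thesis using j by (intro orth_lower) (simp add: degree_pderiv degree_p)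
    qed
    then have "wip (\<lambda>_. 1) e (dq k) = 0"
      using that wip_commute[of "\<lambda>_. 1" "dq k"] unfolding e_def
      by (simp add: wip_add_left[OF continuous_on_const] wip_smult_left[OF continuous_on_const])
    then show ?thesis by (simp add: wip_by_parts e1 e2)
  qed
  then have "pderiv e = (\<Sum>k\<le>m. smult (2 * poly (q k) 1) (q k))"
    by (subst expand[OF d]) (rule sum.cong, auto)
  then have "poly (pderiv e) y = 2 * poly_kernel q m 1 y"
    by (simp add: poly_kernel_def poly_sum sum_distrib_left mult.assoc)
  then show ?thesis by (simp add: e_def pderiv_add pderiv_smult)
qed

lemma kernel_at_one_le:
  assumes "\<bar>y\<bar> < 1"
  shows "\<bar>poly_kernel q m 1 y\<bar> \<le> 8 * sqrt (real m + 1) * (1 - y\<^sup>2) powr (- 3 / 4)"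
proof -
  let ?W = "(1 - y\<^sup>2) powr (- 3 / 4)"
  have b: "\<bar>poly (dq j) y / poly (q j) 1\<bar> \<le> 8 * sqrt (real m + 1) * ?W"
    if "j \<le> Suc m" for j
  proof -
    have pos: "0 < \<bar>poly (q j) 1\<bar>" using q_one_nonzero by simp
    have "\<bar>poly (dq j) y\<bar> \<le> 4 * (real j + 1 / 2) * ?W"
      using abs_dq_le_powr[OF assms, of j] by (simp add: algebra_simps)
    also have "real j + 1 / 2 = \<bar>poly (q j) 1\<bar> * sqrt (real j + 1 / 2)"
      unfolding abs_q_one by simp
    finally have "\<bar>poly (dq j) y\<bar> \<le> (4 * sqrt (real j + 1 / 2) * ?W) * \<bar>poly (q j) 1\<bar>"
      by (simp add: mult_ac)
    then have "\<bar>poly (dq j) y / poly (q j) 1\<bar> \<le> 4 * sqrt (real j + 1 / 2) * ?W"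
      using pos by (simp add: pos_divide_le_eq)
    also have "sqrt (real j + 1 / 2) \<le> sqrt (4 * (real m + 1))"
      using that by simp
    also have "4 * sqrt (4 * (real m + 1)) = 8 * sqrt (real m + 1)"
      by (simp only: real_sqrt_mult) simp
    finally show ?thesis by (simp add: mult_right_mono)
  qed
  have "2 * \<bar>poly_kernel q m 1 y\<bar>
      \<le> \<bar>poly (dq m) y / poly (q m) 1\<bar> + \<bar>poly (dq (Suc m)) y / poly (q (Suc m)) 1\<bar>"
    using kernel_at_one[of m y] by linarith
  also have "\<dots> \<le> 8 * sqrt (real m + 1) * ?W + 8 * sqrt (real m + 1) * ?W"
    by (intro add_mono b) auto
  finally show ?thesis by simp
qed

text \<open>The Christoffel-Darboux formula with \<open>q (m + 1)\<close> eliminated in favour of the kernel at \<open>1\<close>. It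
exhibits the cancellation between \<open>q m\<close> and \<open>q (m + 1)\<close> near \<open>1\<close>.\<close>
lemma kernel_via_one:
  "poly (q m) 1 * ((x - y) * poly_kernel q m x y)
     = poly (q m) x * ((1 - y) * poly_kernel q m 1 y) - poly (q m) y * ((1 - x) * poly_kernel q m 1 x)"
  unfolding christoffel_darboux by (simp add: algebra_simps)

lemma kernel_far:
  assumes "0 \<le> x" "x < 1" "\<bar>y\<bar> < 1" and far: "(1 - y) + (1 - x) \<le> 3 * \<bar>x - y\<bar>"
  shows "\<bar>poly_kernel q m x y\<bar>
     \<le> 48 * sqrt (real m + 1) * ((1 - y) powr (- 3 / 4) + (1 + y) powr (- 3 / 4))"
proof -
  define W where "W t = (1 - t\<^sup>2) powr (- 3 / 4)" for t :: real
  define R where "R = sqrt (real m + 1)"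
  define \<sigma> where "\<sigma> = 1 - y"
  define s where "s = 1 - x"
  have pos: "0 < s" "0 < \<sigma>" using assms by (auto simp: s_def \<sigma>_def)
  have R: "0 \<le> R" by (simp add: R_def)
  have K1: "\<bar>(1 - t) * poly_kernel q m 1 t\<bar> \<le> (1 - t) * (8 * R * W t)" if "\<bar>t\<bar> < 1" for t
    using that kernel_at_one_le[OF that, of m]
    by (auto simp: abs_mult R_def W_def intro!: mult_left_mono)
  have Wy: "W y \<le> \<sigma> powr (- 3 / 4) + (1 + y) powr (- 3 / 4)"
    using edge_weight_le[OF assms(3)] by (simp add: W_def \<sigma>_def)
  have sW: "s * W x \<le> s powr (1 / 4)"
  proof -
    have "W x \<le> s powr (- 3 / 4)"
      unfolding W_def using assms pos
      by (intro powr_mono2') (auto simp: s_def power2_eq_square mult_left_le)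
    then have "s * W x \<le> s * s powr (- 3 / 4)" using pos by (intro mult_left_mono) auto
    also have "\<dots> = s powr (1 / 4)" using pos by (simp add: powr_mult_base)
    finally show ?thesis .
  qed
  have "\<bar>poly (q m) 1\<bar> * (\<bar>x - y\<bar> * \<bar>poly_kernel q m x y\<bar>)
      = \<bar>poly (q m) x * ((1 - y) * poly_kernel q m 1 y) - poly (q m) y * ((1 - x) * poly_kernel q m 1 x)\<bar>"
    by (simp flip: kernel_via_one abs_mult)
  also have "\<dots> \<le> \<bar>poly (q m) x * ((1 - y) * poly_kernel q m 1 y)\<bar> + \<bar>poly (q m) y * ((1 - x) * poly_kernel q m 1 x)\<bar>"
    by (rule abs_triangle_ineq4)
  also have "\<dots> \<le> \<bar>poly (q m) 1\<bar> * ((1 - y) * (8 * R * W y)) + \<bar>poly (q m) 1\<bar> * ((1 - x) * (8 * R * W x))"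
    unfolding abs_mult[of "poly (q m) _"] using assms
    by (intro add_mono mult_mono abs_q_le_at_one K1) auto
  also have "\<dots> = \<bar>poly (q m) 1\<bar> * (8 * R * (\<sigma> * W y + s * W x))"
    by (simp add: \<sigma>_def s_def algebra_simps)
  finally have main: "\<bar>x - y\<bar> * \<bar>poly_kernel q m x y\<bar> \<le> 8 * R * (\<sigma> * W y + s * W x)"
    using q_one_nonzero[of m] by simp
  have "(\<sigma> + s) * \<bar>poly_kernel q m x y\<bar> \<le> (3 * \<bar>x - y\<bar>) * \<bar>poly_kernel q m x y\<bar>"
    using far by (intro mult_right_mono) (auto simp: \<sigma>_def s_def)
  also have "\<dots> \<le> 24 * R * (\<sigma> * W y + s * W x)" using main by simp
  also have "\<dots> \<le> 24 * R * ((\<sigma> + s) * W y + (\<sigma> + s) * \<sigma> powr (- 3 / 4))"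
  proof (intro mult_left_mono add_mono)
    have "s powr (1 / 4) \<le> (\<sigma> + s) powr (1 / 4)" using pos by (intro powr_mono2) auto
    also have "\<dots> = (\<sigma> + s) * (\<sigma> + s) powr (- 3 / 4)" using pos by (simp add: powr_mult_base)
    also have "\<dots> \<le> (\<sigma> + s) * \<sigma> powr (- 3 / 4)"
      using pos by (auto intro!: mult_left_mono powr_mono2')
    finally show "s * W x \<le> (\<sigma> + s) * \<sigma> powr (- 3 / 4)" using sW by simp
    show "\<sigma> * W y \<le> (\<sigma> + s) * W y" using pos by (intro mult_right_mono) (auto simp: W_def)
  qed (use R in auto)
  also have "\<dots> = (\<sigma> + s) * (24 * R * (W y + \<sigma> powr (- 3 / 4)))" by (simp add: algebra_simps)
  finally have "\<bar>poly_kernel q m x y\<bar> \<le> 24 * R * (W y + \<sigma> powr (- 3 / 4))"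
    using pos by simp
  also have "\<dots> \<le> 24 * R * (2 * (\<sigma> powr (- 3 / 4) + (1 + y) powr (- 3 / 4)))"
  proof (rule mult_left_mono)
    show "W y + \<sigma> powr (- 3 / 4) \<le> 2 * (\<sigma> powr (- 3 / 4) + (1 + y) powr (- 3 / 4))"
      using Wy powr_ge_zero[of "1 + y" "- 3 / 4"] powr_ge_zero[of \<sigma> "- 3 / 4"]
      unfolding distrib_left by linarith
  qed (use R in simp)
  also have "\<dots> = 48 * R * (\<sigma> powr (- 3 / 4) + (1 + y) powr (- 3 / 4))" by simp
  finally show ?thesis by (simp only: R_def \<sigma>_def)
qed

text \<open>If \<open>y\<close> is too close to \<open>x\<close> for \<open>kernel_far\<close>, the kernel is estimated by the inequality between
arithmetic and geometric means; the quadratic term will be integrated exactly.\<close>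
lemma kernel_pointwise:
  assumes "0 \<le> x" "x < 1" "\<bar>y\<bar> < 1"
  shows "\<bar>poly_kernel q m x y\<bar>
     \<le> 48 * sqrt (real m + 1) * ((1 - y) powr (- 3 / 4) + (1 + y) powr (- 3 / 4))
       + sqrt (1 - x) / sqrt (real m + 1) * (poly_kernel q m x y)\<^sup>2"
proof (cases "(1 - y) + (1 - x) \<le> 3 * \<bar>x - y\<bar>")
  case True
  show ?thesis by (rule order_trans[OF kernel_far[OF assms True]]) (use assms in simp)
next
  case False
  define R where "R = sqrt (real m + 1)"
  define \<sigma> where "\<sigma> = 1 - y"
  define s where "s = 1 - x"
  let ?K = "\<bar>poly_kernel q m x y\<bar>"
  have pos: "0 < s" "0 < \<sigma>" "0 < R" using assms by (auto simp: s_def \<sigma>_def R_def)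
  have near: "\<sigma> < 2 * s" "\<sigma> \<le> 2" using False assms by (auto simp: s_def \<sigma>_def abs_if split: if_splits)
  \<comment> \<open>As \<open>K x x\<close> is at most \<open>R\<^sup>2 / sqrt s\<close>, this choice makes the integral of \<open>?l * ?K\<^sup>2\<close> at most \<open>R\<close>.\<close>
  let ?l = "sqrt s / R"
  have l: "0 < ?l" using pos by simp
  have "?K \<le> 1 / ?l + ?l * ?K\<^sup>2"
  proof -
    have "0 \<le> (?l * ?K - 1)\<^sup>2" by simp
    also have "\<dots> = ?l * (?l * ?K\<^sup>2) - 2 * (?l * ?K) + 1"
      by (simp add: power2_eq_square algebra_simps)
    finally have "?l * ?K \<le> 1 + ?l * (?l * ?K\<^sup>2)"
      using l by (smt (verit) mult_nonneg_nonneg abs_ge_zero)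
    also have "\<dots> = ?l * (1 / ?l + ?l * ?K\<^sup>2)" using pos by (simp only: distrib_left) simp
    finally show ?thesis using l by (rule mult_left_le_imp_le)
  qed
  also have "1 / ?l \<le> 48 * R * \<sigma> powr (- 3 / 4)"
  proof -
    have "1 / sqrt s = s powr (- 1 / 2)" using pos by (simp add: powr_minus_divide powr_half_sqrt)
    also have "\<dots> \<le> (\<sigma> / 2) powr (- 1 / 2)" using near pos by (intro powr_mono2') auto
    also have "\<dots> = 2 powr (1 / 2) * \<sigma> powr (- 1 / 2)"
      using pos by (simp add: powr_divide powr_minus_divide)
    also have "\<sigma> powr (- 1 / 2) = \<sigma> powr (- 3 / 4) * \<sigma> powr (1 / 4)"
      by (simp flip: powr_add)
    also have "2 powr (1 / 2) * (\<sigma> powr (- 3 / 4) * \<sigma> powr (1 / 4))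
        = 2 powr (1 / 2) * \<sigma> powr (- 3 / 4) * \<sigma> powr (1 / 4)" by simp
    also have "\<dots> \<le> 2 powr (1 / 2) * \<sigma> powr (- 3 / 4) * 2 powr (1 / 4)"
      using near pos by (intro mult_left_mono powr_mono2) auto
    also have "\<dots> = 2 powr (3 / 4) * \<sigma> powr (- 3 / 4)" by (simp flip: powr_add)
    also have "\<dots> \<le> 2 powr 1 * \<sigma> powr (- 3 / 4)" by (intro mult_right_mono powr_mono) auto
    also have "\<dots> \<le> 48 * \<sigma> powr (- 3 / 4)" by simp
    finally have "R * (1 / sqrt s) \<le> R * (48 * \<sigma> powr (- 3 / 4))"
      using pos by (intro mult_left_mono) auto
    then show ?thesis by (simp add: mult_ac)
  qed
  also have "48 * R * \<sigma> powr (- 3 / 4) \<le> 48 * R * (\<sigma> powr (- 3 / 4) + (1 + y) powr (- 3 / 4))"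
    using pos by (intro mult_left_mono) auto
  finally show ?thesis by (simp add: R_def \<sigma>_def s_def)
qed

lemma sqrt_mult_kernel_diag_le:
  assumes "0 \<le> x" "x < 1"
  shows "sqrt (1 - x) * poly_kernel q m x x \<le> real m + 1"
proof -
  have "sqrt (1 - x) * (poly (q k) x)\<^sup>2 \<le> 1" for k
  proof -
    have "sqrt (1 - x) * (poly (q k) x)\<^sup>2 \<le> sqrt (1 - x\<^sup>2) * (poly (q k) x)\<^sup>2"
      using assms by (intro mult_right_mono) (auto simp: power2_eq_square mult_left_le)
    also have "\<dots> \<le> 1" using assms by (intro bernstein_q) auto
    finally show ?thesis .
  qed
  then have "(\<Sum>k\<le>m. sqrt (1 - x) * (poly (q k) x)\<^sup>2) \<le> (\<Sum>k\<le>m. 1)" by (intro sum_mono)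
  then show ?thesis by (simp add: poly_kernel_def sum_distrib_left power2_eq_square)
qed

lemma legendre_lebesgue_right:
  assumes "0 \<le> x" "x \<le> 1"
  shows "poly_lebesgue q m x \<le> 1000 * sqrt (real m + 1)"
proof -
  define R where "R = sqrt (real m + 1)"
  define V :: "real \<Rightarrow> real" where "V y = (1 - y) powr (- 3 / 4) + (1 + y) powr (- 3 / 4)" for y
  have R: "0 < R" by (simp add: R_def)
  have V: "(V has_integral 8 * 2 powr (1 / 4)) {-1..1}"
    unfolding V_def by (rule has_integral_powr_end)
  have two: "2 powr (1 / 4) \<le> (2 :: real)" using powr_mono[of "1/4" 1 "2::real"] by simp
  have c: "continuous_on {-1..1} (\<lambda>y. \<bar>poly_kernel q m x y\<bar>)" by (intro continuous_intros)
  show ?thesis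
  proof (cases "x = 1")
    case True
    have "poly_lebesgue q m x \<le> 8 * R * (8 * 2 powr (1 / 4))"
      unfolding poly_lebesgue_def
    proof (rule integral_le_open[OF c has_integral_mult_right[OF V]])
      fix y :: real assume y: "-1 < y" "y < 1"
      then have "\<bar>y\<bar> < 1" by auto
      have "8 * R * (1 - y\<^sup>2) powr (- 3 / 4) \<le> 8 * R * V y"
        using edge_weight_le[OF \<open>\<bar>y\<bar> < 1\<close>] R by (intro mult_left_mono) (auto simp: V_def)
      with kernel_at_one_le[OF \<open>\<bar>y\<bar> < 1\<close>, of m]
      show "\<bar>poly_kernel q m x y\<bar> \<le> 8 * R * V y"
        unfolding True R_def[symmetric] by (rule order_trans)
    qed
    also have "\<dots> \<le> 8 * R * (8 * 2)" using two R by (intro mult_left_mono) auto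
    also have "\<dots> \<le> 1000 * R" using R by simp
    finally show ?thesis by (simp only: R_def)
  next
    case False
    then have x: "0 \<le> x" "x < 1" using assms by auto
    have K: "((\<lambda>y. (poly_kernel q m x y)\<^sup>2) has_integral poly_kernel q m x x) {-1..1}"
      using integral_kernel_sq[of m x]
      by (simp add: has_integral_iff continuous_intros)
    have "poly_lebesgue q m x \<le> 48 * R * (8 * 2 powr (1 / 4)) + sqrt (1 - x) / R * poly_kernel q m x x"
      unfolding poly_lebesgue_def
    proof (rule integral_le_open[OF c has_integral_add[OF has_integral_mult_right[OF V] has_integral_mult_right[OF K]]])
      fix y :: real assume "-1 < y" "y < 1"
      then show "\<bar>poly_kernel q m x y\<bar> \<le> 48 * R * V y + sqrt (1 - x) / R * (poly_kernel q m x y)\<^sup>2"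
        using kernel_pointwise[OF x, of y m] by (simp add: R_def V_def)
    qed
    also have "\<dots> \<le> 48 * R * (8 * 2) + R"
    proof (intro add_mono mult_left_mono)
      have "sqrt (1 - x) / R * poly_kernel q m x x \<le> (real m + 1) / R"
        using sqrt_mult_kernel_diag_le[OF x, of m] R by (simp add: divide_right_mono)
      then show "sqrt (1 - x) / R * poly_kernel q m x x \<le> R" by (simp add: R_def real_div_sqrt)
    qed (use two R in auto)
    also have "\<dots> \<le> 1000 * R" using R by simp
    finally show ?thesis by (simp only: R_def)
  qed
qed

lemma poly_lebesgue_minus: "poly_lebesgue q m (- x) = poly_lebesgue q m x"
proof -
  have K: "poly_kernel q m (- x) y = poly_kernel q m x (- y)" for y
    by (simp add: poly_kernel_def poly_q_minus mult.assoc mult.left_commute)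
  show ?thesis unfolding poly_lebesgue_def K
    using Henstock_Kurzweil_Integration.integral_reflect_real[of 1 "-1" "\<lambda>y. \<bar>poly_kernel q m x y\<bar>"]
    by simp
qed

theorem legendre_lebesgue_le:
  assumes "x \<in> {-1..1}"
  shows "poly_lebesgue q m x \<le> 1000 * sqrt (real m + 1)"
  using legendre_lebesgue_right[of x m] legendre_lebesgue_right[of "- x" m] assms
  by (cases "0 \<le> x") (auto simp: poly_lebesgue_minus)

lemma q_bounded_inside:
  assumes "b < 1"
  shows "\<exists>B\<ge>1. \<forall>k x. \<bar>x\<bar> \<le> b \<longrightarrow> \<bar>poly (q k) x\<bar> \<le> B"
proof (intro exI conjI allI impI)
  let ?B = "max 1 ((1 - b\<^sup>2) powr (- 1 / 4))"
  show "1 \<le> ?B" by simp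
  fix k x assume x: "\<bar>x\<bar> \<le> b"
  have "x\<^sup>2 \<le> b\<^sup>2" using x by (simp add: abs_le_square_iff[symmetric])
  moreover have "b\<^sup>2 < 1" using x assms by (simp add: abs_square_less_1)
  ultimately have "(1 - x\<^sup>2) powr (- 1 / 4) \<le> (1 - b\<^sup>2) powr (- 1 / 4)"
    by (intro powr_mono2') auto
  then show "\<bar>poly (q k) x\<bar> \<le> ?B" using abs_q_le_powr[of x k] x assms by simp
qed

theorem legendre_lebesgue_inside:
  assumes b: "b < 1"
  shows "\<exists>C. \<forall>m x. \<bar>x\<bar> \<le> b \<longrightarrow> poly_lebesgue q m x \<le> C * (1 + ln (2 * real m + 3))"
proof (cases "0 \<le> b")
  case False
  then show ?thesis by auto
next
  case b0: True
  define b' where "b' = (1 + b) / 2"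
  define \<delta> where "\<delta> = (1 - b) / 2"
  have \<delta>: "\<delta> > 0" using b by (simp add: \<delta>_def)
  have b': "b \<le> b'" "b' < 1" using b by (simp_all add: b'_def)
  obtain B where B: "B \<ge> 1" "\<And>k x. \<bar>x\<bar> \<le> b' \<Longrightarrow> \<bar>poly (q k) x\<bar> \<le> B"
    using q_bounded_inside[OF b'(2)] by blast
  have BB: "0 \<le> B * B" by simp
  have "poly_lebesgue q m x \<le> (6 * (B * B) + 3 * (B / \<delta>)) * (1 + ln (2 * real m + 3))"
    if x: "\<bar>x\<bar> \<le> b" for m x
  proof -
    define \<epsilon> where "\<epsilon> = 1 / (real m + 1)"
    have \<epsilon>: "\<epsilon> > 0" by (simp add: \<epsilon>_def)
    define Q where "Q y = 1 + (poly (q m) y)\<^sup>2 / 2 + (poly (q (Suc m)) y)\<^sup>2 / 2" for y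
    have bx: "\<bar>poly (q k) x\<bar> \<le> B" for k using B(2) x b' by simp
    \<comment> \<open>The first term bounds the kernel for \<open>\<bar>y\<bar> \<le> b'\<close>, the second one for the other \<open>y\<close>.\<close>
    have pw: "\<bar>poly_kernel q m x y\<bar> \<le> 3 * (B * B) * (1 / (\<epsilon> + \<bar>x - y\<bar>)) + B / \<delta> * Q y" for y
    proof (cases "\<bar>y\<bar> \<le> b'")
      case True
      have by': "\<bar>poly (q k) y\<bar> \<le> B" for k using B(2) True by simp
      have bb: "\<bar>poly (q j) x\<bar> * \<bar>poly (q k) y\<bar> \<le> B * B" for j k
        using bx by' B(1) by (intro mult_mono) auto
      have "\<bar>poly_kernel q m x y\<bar> \<le> (\<Sum>k\<le>m. B * B)"
        unfolding poly_kernel_def by (intro order_trans[OF sum_abs] sum_mono) (simp add: abs_mult bb)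
      also have "\<dots> = B * B * (real m + 1)" by simp
      finally have k1: "\<epsilon> * \<bar>poly_kernel q m x y\<bar> \<le> B * B"
        by (simp add: \<epsilon>_def pos_divide_le_eq)
      have k2: "\<bar>x - y\<bar> * \<bar>poly_kernel q m x y\<bar> \<le> B * B + B * B"
        using abs_kernel_diff_le[of x y m] bb[of "Suc m" m] bb[of m "Suc m"] by (simp add: abs_mult)
      have "(\<epsilon> + \<bar>x - y\<bar>) * \<bar>poly_kernel q m x y\<bar> \<le> 3 * (B * B)"
        using k1 k2 by (simp add: distrib_right)
      then have "\<bar>poly_kernel q m x y\<bar> \<le> 3 * (B * B) / (\<epsilon> + \<bar>x - y\<bar>)"
        using \<epsilon> by (simp add: pos_le_divide_eq mult.commute add_pos_nonneg)
      moreover have "0 \<le> B / \<delta> * Q y" using B(1) \<delta> by (simp add: Q_def)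
      ultimately show ?thesis by simp
    next
      case False
      have d: "\<delta> \<le> \<bar>x - y\<bar>" using False x abs_triangle_ineq2_sym[of y x] by (simp add: \<delta>_def b'_def field_simps)
      have half: "\<bar>t\<bar> \<le> 1 / 2 + t\<^sup>2 / 2" for t :: real
        using sum_squares_bound[of 1 "\<bar>t\<bar>"] by simp
      have "\<delta> * \<bar>poly_kernel q m x y\<bar> \<le> \<bar>(x - y) * poly_kernel q m x y\<bar>"
        using d by (simp add: abs_mult mult_right_mono)
      also have "\<dots> \<le> B * \<bar>poly (q m) y\<bar> + B * \<bar>poly (q (Suc m)) y\<bar>"
        using bx by (intro order_trans[OF abs_kernel_diff_le] add_mono mult_right_mono) auto
      also have "\<dots> \<le> B * Q y"
        using half[of "poly (q m) y"] half[of "poly (q (Suc m)) y"] B(1)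
        unfolding distrib_left[symmetric] by (intro mult_left_mono) (auto simp: Q_def)
      finally have "\<bar>poly_kernel q m x y\<bar> \<le> B / \<delta> * Q y"
        using \<delta> by (simp add: pos_le_divide_eq mult.commute)
      moreover have "0 \<le> 3 * (B * B) * (1 / (\<epsilon> + \<bar>x - y\<bar>))" using BB \<epsilon> by simp
      ultimately show ?thesis by simp
    qed
    have ne: "\<epsilon> + \<bar>x - y\<bar> \<noteq> 0" for y using \<epsilon> abs_ge_zero[of "x - y"] by linarith
    have cf: "continuous_on {-1..1} (\<lambda>y. 1 / (\<epsilon> + \<bar>x - y\<bar>))"
      by (intro continuous_intros) (simp add: ne)
    have cQ: "continuous_on {-1..1} Q" unfolding Q_def by (intro continuous_intros) auto
    have "integral {-1..1} Q = integral {-1..1} (\<lambda>y::real. 1)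
        + integral {-1..1} (\<lambda>y. (poly (q m) y)\<^sup>2 / 2 + (poly (q (Suc m)) y)\<^sup>2 / 2)"
      unfolding Q_def add.assoc by (rule integral_add_cont) (auto intro!: continuous_intros)
    also have "\<dots> = 3"
      using wip_p[of m m] wip_p[of "Suc m" "Suc m"]
      by (subst integral_add_cont) (auto intro!: continuous_intros simp: wip_def power2_eq_square)
    finally have Q: "integral {-1..1} Q = 3" .
    have "poly_lebesgue q m x
        \<le> integral {-1..1} (\<lambda>y. 3 * (B * B) * (1 / (\<epsilon> + \<bar>x - y\<bar>)) + B / \<delta> * Q y)"
      unfolding poly_lebesgue_def
      by (intro integral_le_cont pw continuous_on_add continuous_on_mult_left cf cQ continuous_intros)
    also have "\<dots> = 3 * (B * B) * integral {-1..1} (\<lambda>y. 1 / (\<epsilon> + \<bar>x - y\<bar>)) + B / \<delta> * 3"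
      unfolding integral_add_cont[OF continuous_on_mult_left[OF cf] continuous_on_mult_left[OF cQ]]
      by (simp only: integral_mult_right Q)
    also have "\<dots> \<le> 3 * (B * B) * (2 * ln ((\<epsilon> + 2) / \<epsilon>)) + B / \<delta> * 3"
      using x b B(1) \<delta> by (intro add_mono mult_left_mono integral_inverse_dist_le \<epsilon>) (auto simp: BB)
    also have "(\<epsilon> + 2) / \<epsilon> = 2 * real m + 3" by (simp add: \<epsilon>_def field_simps)
    also have "3 * (B * B) * (2 * ln (2 * real m + 3)) + B / \<delta> * 3
        \<le> (6 * (B * B) + 3 * (B / \<delta>)) * (1 + ln (2 * real m + 3))"
    proof -
      have "u * (2 * l) * 3 + v * 3 \<le> (6 * u + 3 * v) * (1 + l)" if "0 \<le> u" "0 \<le> v" "0 \<le> l" for u v l :: real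
        using that by (simp add: algebra_simps)
      from this[of "B * B" "B / \<delta>" "ln (2 * real m + 3)"] show ?thesis
        using BB B(1) \<delta> by (simp add: mult_ac)
    qed
    finally show ?thesis .
  qed
  then show ?thesis by blast
qed

end

section \<open>Comparison of a smooth weight with the Legendre weight\<close>

text \<open>The weight \<open>h\<close> lies between \<open>h0 > 0\<close> and \<open>h1\<close>, and its difference quotient, divided by \<open>h t\<close>, is the
function \<open>F\<close>, which is bounded and Lipschitz in its second argument. The polynomials \<open>p\<close> belong
to \<open>h\<close>, the polynomials \<open>q\<close> are those of Legendre. The constants \<open>korous_const\<close> and
\<open>comparison_const\<close> below depend on \<open>h0\<close>, \<open>h1\<close> and \<open>M\<close> only, not on the degree.\<close>
locale legendre_comparison =
  L: legendre_polys q + H: orthonormal_polys h p for q p h +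
  fixes F :: "real \<Rightarrow> real \<Rightarrow> real" and h0 h1 M :: real
  assumes h0: "0 < h0" and h_bounds: "\<And>t. t \<in> {-1..1} \<Longrightarrow> h0 \<le> h t \<and> h t \<le> h1"
    and h_diff: "\<And>x t. x \<in> {-1..1} \<Longrightarrow> t \<in> {-1..1} \<Longrightarrow> h x - h t = (x - t) * F x t * h t"
    and F_bound: "\<And>x t. x \<in> {-1..1} \<Longrightarrow> t \<in> {-1..1} \<Longrightarrow> \<bar>F x t\<bar> \<le> M"
    and F_Lipschitz: "\<And>x t t'. x \<in> {-1..1} \<Longrightarrow> t \<in> {-1..1} \<Longrightarrow> t' \<in> {-1..1} \<Longrightarrow>
      \<bar>F x t - F x t'\<bar> \<le> M * \<bar>t - t'\<bar>"
begin

lemma M_nonneg: "0 \<le> M"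
  using F_bound[of 0 0] abs_ge_zero[of "F 0 0"] by (meson order_trans atLeastAtMost_iff zero_le_one neg_le_0_iff_le)

lemma h1_pos: "0 < h1"
  using h0 h_bounds[of 0] by auto

lemma F_continuous: "x \<in> {-1..1} \<Longrightarrow> continuous_on {-1..1} (F x)"
  using F_Lipschitz M_nonneg
  by (intro lipschitz_on_continuous_on[of M] lipschitz_onI) (auto simp: dist_real_def)

lemma wip_h_q_le: "wip h (q k) (q k) \<le> h1"
proof -
  have "wip h (q k) (q k) \<le> integral {-1..1} (\<lambda>x. h1 * (poly (q k) x * poly (q k) x * 1))"
    unfolding wip_def
  proof (rule integral_le_cont)
    fix x :: real assume "x \<in> {-1..1}"
    then show "poly (q k) x * poly (q k) x * h x \<le> h1 * (poly (q k) x * poly (q k) x * 1)"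
      using h_bounds[of x] by (simp add: mult.commute[of _ "h x"] mult_right_mono)
  qed (auto intro!: continuous_intros H.w_cont)
  also have "\<dots> = h1" using L.wip_p[of k k] by (simp add: wip_def)
  finally show ?thesis .
qed

lemma integral_abs_mult_le:
  "integral {-1..1} (\<lambda>t. \<bar>poly (p j) t\<bar> * \<bar>poly (q k) t\<bar> * h t) \<le> 1 + h1"
proof -
  have "integral {-1..1} (\<lambda>t. \<bar>poly (p j) t\<bar> * \<bar>poly (q k) t\<bar> * h t)
      \<le> (wip h (p j) (p j) + wip h (q k) (q k)) / 2" by (rule H.abs_wip_le)
  also have "\<dots> \<le> (1 + h1) / 2" using wip_h_q_le[of k] by (simp add: H.wip_p)
  also have "\<dots> \<le> 1 + h1" using h1_pos by simp
  finally show ?thesis .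
qed

lemma abs_wip_h_le: "\<bar>wip h (p j) (q k)\<bar> \<le> 1 + h1"
proof -
  have "\<bar>wip h (p j) (q k)\<bar> \<le> integral {-1..1} (\<lambda>t. \<bar>poly (p j) t\<bar> * \<bar>poly (q k) t\<bar> * h t)"
    unfolding wip_def using H.w_pos
    by (intro integral_abs_bound) (auto intro!: continuous_intros H.w_cont simp: abs_mult less_imp_le)
  then show ?thesis using integral_abs_mult_le[of j k] by simp
qed

lemma integral_weighted_le:
  assumes c: "continuous_on {-1..1} g" and A: "0 \<le> A" and B: "0 \<le> B"
    and le: "\<And>t. t \<in> {-1..1} \<Longrightarrow>
      \<bar>g t\<bar> \<le> A * (\<bar>poly (p i) t\<bar> * \<bar>poly (q j) t\<bar> * h t) + B * (\<bar>poly (p k) t\<bar> * \<bar>poly (q l) t\<bar> * h t)"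
  shows "\<bar>integral {-1..1} g\<bar> \<le> (1 + h1) * (A + B)"
proof -
  have ci: "continuous_on {-1..1} (\<lambda>t. C * (\<bar>poly (p i) t\<bar> * \<bar>poly (q j) t\<bar> * h t))" for C i j
    by (intro continuous_intros H.w_cont)
  have "\<bar>integral {-1..1} g\<bar> \<le> integral {-1..1} (\<lambda>t. A * (\<bar>poly (p i) t\<bar> * \<bar>poly (q j) t\<bar> * h t)
      + B * (\<bar>poly (p k) t\<bar> * \<bar>poly (q l) t\<bar> * h t))"
    by (rule integral_abs_bound[OF c continuous_on_add[OF ci ci] le])
  also have "\<dots> = A * integral {-1..1} (\<lambda>t. \<bar>poly (p i) t\<bar> * \<bar>poly (q j) t\<bar> * h t)
      + B * integral {-1..1} (\<lambda>t. \<bar>poly (p k) t\<bar> * \<bar>poly (q l) t\<bar> * h t)"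
    unfolding integral_add_cont[OF ci ci] by simp
  also have "\<dots> \<le> A * (1 + h1) + B * (1 + h1)"
    using A B by (intro add_mono mult_left_mono integral_abs_mult_le)
  finally show ?thesis by (simp add: algebra_simps)
qed

text \<open>All estimates at the point \<open>x\<close> are in terms of the size of three consecutive Legendre polynomials.\<close>
definition majorant :: "nat \<Rightarrow> real \<Rightarrow> real" where
  "majorant m x = \<bar>poly (q m) x\<bar> + \<bar>poly (q (Suc m)) x\<bar> + \<bar>poly (q (Suc (Suc m))) x\<bar>"

lemma majorant_nonneg: "0 \<le> majorant m x" by (simp add: majorant_def)

text \<open>The constant in Korous's bound of \<open>p j\<close> by Legendre polynomials.\<close>
definition korous_const :: real where "korous_const = (1 + h1) * (M + 1) / h0"

lemma korous_const_nonneg: "0 \<le> korous_const"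
  using M_nonneg h1_pos h0 by (simp add: korous_const_def)

text \<open>Korous's bound. Reproduce \<open>p j\<close> at \<open>x\<close> by the Legendre kernel and split \<open>h x = (h x - h t) + h t\<close>.
The first part contains \<open>(x - t) * K x t\<close>, which the Christoffel-Darboux formula turns into products
of Legendre polynomials; in the second part only the top term of the kernel survives, by
orthogonality of \<open>p j\<close> with respect to \<open>h\<close>.\<close>
lemma abs_p_le_korous:
  assumes x: "x \<in> {-1..1}"
  shows "\<bar>poly (p j) x\<bar> \<le> korous_const * (\<bar>poly (q j) x\<bar> + \<bar>poly (q (Suc j)) x\<bar>)"
proof -

  let ?K = "\<lambda>t. poly_kernel q j x t"
  have r: "integral {-1..1} (\<lambda>t. ?K t * poly (p j) t) = poly (p j) x"
    using L.reproducing[of "p j" j x] by (simp add: H.degree_p)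
  have top: "integral {-1..1} (\<lambda>t. ?K t * poly (p j) t * h t) = poly (q j) x * wip h (p j) (q j)"
  proof -
    have "integral {-1..1} (\<lambda>t. ?K t * poly (p j) t * h t) = wip h (kernel_poly q j x) (p j)"
      by (simp add: wip_def poly_of_kernel_poly)
    also have "\<dots> = (\<Sum>k\<le>j. poly (q k) x * wip h (q k) (p j))"
      by (simp add: kernel_poly_def wip_sum_left[OF H.w_cont] wip_smult_left[OF H.w_cont])
    also have "\<dots> = (\<Sum>k\<in>{j}. poly (q k) x * wip h (q k) (p j))"
      by (rule sum.mono_neutral_right) (auto intro!: H.orth_lower simp: L.degree_p)
    finally show ?thesis by (simp add: wip_commute)
  qed
  have rest: "\<bar>integral {-1..1} (\<lambda>t. ?K t * poly (p j) t * (h x - h t))\<bar>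
      \<le> (1 + h1) * (M * \<bar>poly (q (Suc j)) x\<bar> + M * \<bar>poly (q j) x\<bar>)"
  proof (rule integral_weighted_le)
    fix t :: real assume t: "t \<in> {-1..1}"
    have "\<bar>?K t * poly (p j) t * (h x - h t)\<bar>
        = \<bar>F x t\<bar> * (\<bar>(x - t) * ?K t\<bar> * (\<bar>poly (p j) t\<bar> * h t))"
      using H.w_pos[OF t] by (simp add: h_diff[OF x t] abs_mult)
    also have "\<dots> \<le> M * ((\<bar>poly (q (Suc j)) x\<bar> * \<bar>poly (q j) t\<bar>
        + \<bar>poly (q j) x\<bar> * \<bar>poly (q (Suc j)) t\<bar>) * (\<bar>poly (p j) t\<bar> * h t))"
      using H.w_pos[OF t] M_nonneg
      by (intro mult_mono mult_right_mono F_bound x t L.abs_kernel_diff_le) auto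
    finally show "\<bar>?K t * poly (p j) t * (h x - h t)\<bar>
        \<le> M * \<bar>poly (q (Suc j)) x\<bar> * (\<bar>poly (p j) t\<bar> * \<bar>poly (q j) t\<bar> * h t)
          + M * \<bar>poly (q j) x\<bar> * (\<bar>poly (p j) t\<bar> * \<bar>poly (q (Suc j)) t\<bar> * h t)"
      by (simp add: algebra_simps)
  qed (use M_nonneg in \<open>auto intro!: continuous_intros H.w_cont\<close>)
  have "h x * poly (p j) x = integral {-1..1} (\<lambda>t. h x * (?K t * poly (p j) t))"
    by (simp add: r)
  also have "\<dots> = integral {-1..1} (\<lambda>t. ?K t * poly (p j) t * (h x - h t) + ?K t * poly (p j) t * h t)"
    by (simp add: algebra_simps)
  also have "\<dots> = integral {-1..1} (\<lambda>t. ?K t * poly (p j) t * (h x - h t))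
      + poly (q j) x * wip h (p j) (q j)"
    unfolding top[symmetric] by (rule integral_add_cont) (intro continuous_intros H.w_cont)+
  finally have "\<bar>h x * poly (p j) x\<bar> \<le> (1 + h1) * (M * \<bar>poly (q (Suc j)) x\<bar> + M * \<bar>poly (q j) x\<bar>)
      + \<bar>poly (q j) x * wip h (p j) (q j)\<bar>"
    using rest by linarith
  also have "\<bar>poly (q j) x * wip h (p j) (q j)\<bar> \<le> \<bar>poly (q j) x\<bar> * (1 + h1)"
    unfolding abs_mult by (intro mult_left_mono abs_wip_h_le) simp
  also have "(1 + h1) * (M * \<bar>poly (q (Suc j)) x\<bar> + M * \<bar>poly (q j) x\<bar>) + \<bar>poly (q j) x\<bar> * (1 + h1)
      \<le> (1 + h1) * (M + 1) * (\<bar>poly (q j) x\<bar> + \<bar>poly (q (Suc j)) x\<bar>)"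
    using h1_pos by (simp add: algebra_simps)
  finally have a: "\<bar>h x * poly (p j) x\<bar> \<le> (1 + h1) * (M + 1) * (\<bar>poly (q j) x\<bar> + \<bar>poly (q (Suc j)) x\<bar>)"
    by simp
  have "h0 * \<bar>poly (p j) x\<bar> \<le> \<bar>h x * poly (p j) x\<bar>"
    using h_bounds[OF x] h0 by (simp add: abs_mult mult_right_mono)
  with a have "h0 * \<bar>poly (p j) x\<bar> \<le> (1 + h1) * (M + 1) * (\<bar>poly (q j) x\<bar> + \<bar>poly (q (Suc j)) x\<bar>)"
    by (rule order_trans[rotated])
  then show ?thesis using h0 by (simp add: korous_const_def pos_le_divide_eq mult.commute)
qed

lemma abs_p_le_majorant:
  assumes x: "x \<in> {-1..1}" and j: "j = m \<or> j = Suc m"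
  shows "\<bar>poly (p j) x\<bar> \<le> korous_const * majorant m x"
proof -
  have "korous_const * (\<bar>poly (q j) x\<bar> + \<bar>poly (q (Suc j)) x\<bar>) \<le> korous_const * majorant m x"
    using j by (intro mult_left_mono korous_const_nonneg) (auto simp: majorant_def)
  then show ?thesis using abs_p_le_korous[OF x, of j] by simp
qed

lemma abs_integral_kernel_q_le:
  assumes x: "x \<in> {-1..1}" and j: "j = m \<or> j = Suc m"
  shows "\<bar>integral {-1..1} (\<lambda>t. poly_kernel p m x t * poly (q j) t * h t)\<bar>
    \<le> (1 + (1 + h1) * korous_const) * majorant m x"
proof (cases "j = m")
  case True
  have "integral {-1..1} (\<lambda>t. poly_kernel p m x t * poly (q j) t * h t) = poly (q j) x"
    using True by (intro H.reproducing) (simp add: L.degree_p)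
  moreover have "\<bar>poly (q j) x\<bar> \<le> majorant m x" using True by (simp add: majorant_def)
  moreover have "0 \<le> (1 + h1) * korous_const * majorant m x"
    using h1_pos korous_const_nonneg majorant_nonneg by simp
  ultimately show ?thesis by (simp add: distrib_right)
next
  case False
  then have j: "j = Suc m" using j by simp
  have "poly (q j) x = integral {-1..1} (\<lambda>t. poly_kernel p (Suc m) x t * poly (q j) t * h t)"
    by (rule H.reproducing[symmetric]) (simp add: L.degree_p j)
  also have "\<dots> = integral {-1..1} (\<lambda>t. poly_kernel p m x t * poly (q j) t * h t
      + poly (p j) x * (poly (p j) t * poly (q j) t * h t))"
    by (simp add: poly_kernel_Suc j algebra_simps)
  also have "\<dots> = integral {-1..1} (\<lambda>t. poly_kernel p m x t * poly (q j) t * h t)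
      + poly (p j) x * wip h (p j) (q j)"
    unfolding wip_def integral_mult_right[symmetric]
    by (rule integral_add_cont) (intro continuous_intros H.w_cont)+
  finally have "\<bar>integral {-1..1} (\<lambda>t. poly_kernel p m x t * poly (q j) t * h t)\<bar>
      \<le> \<bar>poly (q j) x\<bar> + \<bar>poly (p j) x * wip h (p j) (q j)\<bar>" by linarith
  also have "\<dots> \<le> majorant m x + (korous_const * majorant m x) * (1 + h1)"
    unfolding abs_mult using korous_const_nonneg majorant_nonneg
    by (intro add_mono mult_mono abs_wip_h_le abs_p_le_majorant x) (auto simp: j majorant_def)
  finally show ?thesis by (simp add: algebra_simps)
qed

text \<open>The constant in the estimate of the difference of the two kernels.\<close>
definition comparison_const :: real where "comparison_const = M * (1 + (1 + h1) * korous_const) + 2 * (1 + h1) * M * korous_const"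

lemma comparison_const_nonneg: "0 \<le> comparison_const"
  using M_nonneg h1_pos korous_const_nonneg by (simp add: comparison_const_def)

text \<open>Replacing \<open>F y t\<close> by \<open>F y x\<close> leaves an integral that the reproducing property controls, and
the error carries a factor \<open>t - x\<close> that the Christoffel-Darboux formula for \<open>p\<close> absorbs.\<close>
lemma abs_integral_kernel_F_q_le:
  assumes x: "x \<in> {-1..1}" and y: "y \<in> {-1..1}" and j: "j = m \<or> j = Suc m"
  shows "\<bar>integral {-1..1} (\<lambda>t. poly_kernel p m x t * F y t * poly (q j) t * h t)\<bar> \<le> comparison_const * majorant m x"
proof -
  let ?K = "\<lambda>t. poly_kernel p m x t"
  note cF = F_continuous[OF y]
  have rest: "\<bar>integral {-1..1} (\<lambda>t. ?K t * (F y t - F y x) * poly (q j) t * h t)\<bar>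
      \<le> (1 + h1) * (M * \<bar>poly (p (Suc m)) x\<bar> + M * \<bar>poly (p m) x\<bar>)"
  proof (rule integral_weighted_le)
    fix t :: real assume t: "t \<in> {-1..1}"
    have "\<bar>?K t * (F y t - F y x) * poly (q j) t * h t\<bar>
        = \<bar>F y t - F y x\<bar> * (\<bar>?K t\<bar> * (\<bar>poly (q j) t\<bar> * h t))"
      using H.w_pos[OF t] by (simp add: abs_mult)
    also have "\<dots> \<le> (M * \<bar>t - x\<bar>) * (\<bar>?K t\<bar> * (\<bar>poly (q j) t\<bar> * h t))"
      using H.w_pos[OF t] by (intro mult_right_mono F_Lipschitz x y t) auto
    also have "\<dots> = M * (\<bar>(x - t) * ?K t\<bar> * (\<bar>poly (q j) t\<bar> * h t))"
      by (simp add: abs_mult abs_minus_commute)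
    also have "\<dots> \<le> M * ((\<bar>poly (p (Suc m)) x\<bar> * \<bar>poly (p m) t\<bar>
        + \<bar>poly (p m) x\<bar> * \<bar>poly (p (Suc m)) t\<bar>) * (\<bar>poly (q j) t\<bar> * h t))"
      using H.w_pos[OF t] M_nonneg
      by (intro mult_left_mono mult_right_mono H.abs_kernel_diff_le) auto
    finally show "\<bar>?K t * (F y t - F y x) * poly (q j) t * h t\<bar>
        \<le> M * \<bar>poly (p (Suc m)) x\<bar> * (\<bar>poly (p m) t\<bar> * \<bar>poly (q j) t\<bar> * h t)
          + M * \<bar>poly (p m) x\<bar> * (\<bar>poly (p (Suc m)) t\<bar> * \<bar>poly (q j) t\<bar> * h t)"
      by (simp add: algebra_simps)
  qed (use M_nonneg in \<open>auto intro!: continuous_intros H.w_cont cF\<close>)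
  have "(1 + h1) * (M * \<bar>poly (p (Suc m)) x\<bar> + M * \<bar>poly (p m) x\<bar>)
      \<le> (1 + h1) * (M * (korous_const * majorant m x) + M * (korous_const * majorant m x))"
    using h1_pos M_nonneg by (intro mult_left_mono add_mono abs_p_le_majorant x) auto
  then have r: "\<bar>integral {-1..1} (\<lambda>t. ?K t * (F y t - F y x) * poly (q j) t * h t)\<bar>
      \<le> 2 * (1 + h1) * M * korous_const * majorant m x"
    using rest by (simp add: algebra_simps)
  have "\<bar>F y x * integral {-1..1} (\<lambda>t. ?K t * poly (q j) t * h t)\<bar>
      \<le> M * ((1 + (1 + h1) * korous_const) * majorant m x)"
    unfolding abs_mult using M_nonneg by (intro mult_mono F_bound abs_integral_kernel_q_le x y j) auto
  moreover have "integral {-1..1} (\<lambda>t. ?K t * F y t * poly (q j) t * h t)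
      = integral {-1..1} (\<lambda>t. F y x * (?K t * poly (q j) t * h t) + ?K t * (F y t - F y x) * poly (q j) t * h t)"
    by (simp add: algebra_simps)
  moreover have "\<dots> = F y x * integral {-1..1} (\<lambda>t. ?K t * poly (q j) t * h t)
      + integral {-1..1} (\<lambda>t. ?K t * (F y t - F y x) * poly (q j) t * h t)"
    unfolding integral_mult_right[symmetric]
    by (rule integral_add_cont) (intro continuous_intros H.w_cont cF)+
  ultimately show ?thesis using r by (simp add: comparison_const_def distrib_right mult.assoc)
qed

text \<open>Both kernels reproduce each other, so \<open>h y * K\<^sub>h x y - K x y\<close> is the integral of
\<open>K\<^sub>h x t * (h y - h t) * K t y\<close> over \<open>t\<close>, where \<open>K\<^sub>h\<close> and \<open>K\<close> are the kernels of \<open>p\<close> and \<open>q\<close>. The factor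
\<open>h y - h t\<close> contains \<open>y - t\<close>, so that the Christoffel-Darboux formula for \<open>q\<close> separates \<open>y\<close> from \<open>t\<close>.\<close>
lemma kernel_comparison:
  assumes x: "x \<in> {-1..1}" and y: "y \<in> {-1..1}"
  shows "\<bar>h y * poly_kernel p m x y - poly_kernel q m x y\<bar>
    \<le> comparison_const * majorant m x * (\<bar>poly (q m) y\<bar> + \<bar>poly (q (Suc m)) y\<bar>)"
proof -
  let ?K = "\<lambda>t. poly_kernel p m x t" and ?L = "\<lambda>t. poly_kernel q m y t"
  let ?A = "\<lambda>j. integral {-1..1} (\<lambda>t. ?K t * F y t * poly (q j) t * h t)"
  note cF = F_continuous[OF y]
  have 1: "integral {-1..1} (\<lambda>t. ?K t * ?L t) = ?K y"
    using L.reproducing[OF H.degree_kernel_poly[of m x], of y]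
    by (simp add: poly_of_kernel_poly mult.commute)
  have 2: "integral {-1..1} (\<lambda>t. ?K t * ?L t * h t) = ?L x"
    using H.reproducing[OF L.degree_kernel_poly[of m y], of x] by (simp add: poly_of_kernel_poly)
  have "h y * ?K y - ?L x = integral {-1..1} (\<lambda>t. h y * (?K t * ?L t) - ?K t * ?L t * h t)"
    by (subst integral_diff_cont) (auto intro!: continuous_intros H.w_cont simp: 1 2)
  also have "\<dots> = integral {-1..1} (\<lambda>t. (L.jacobi m * poly (q (Suc m)) y) * (?K t * F y t * poly (q m) t * h t)
      - (L.jacobi m * poly (q m) y) * (?K t * F y t * poly (q (Suc m)) t * h t))"
  proof (rule integral_cong)
    fix t :: real assume t: "t \<in> {-1..1}"
    have "h y * (?K t * ?L t) - ?K t * ?L t * h t = ?K t * (h y - h t) * ?L t"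
      by (simp add: algebra_simps)
    also have "\<dots> = ?K t * F y t * h t * ((y - t) * ?L t)" unfolding h_diff[OF y t] by simp
    finally show "h y * (?K t * ?L t) - ?K t * ?L t * h t
      = (L.jacobi m * poly (q (Suc m)) y) * (?K t * F y t * poly (q m) t * h t)
      - (L.jacobi m * poly (q m) y) * (?K t * F y t * poly (q (Suc m)) t * h t)"
      unfolding L.christoffel_darboux by (simp add: algebra_simps)
  qed
  also have "\<dots> = L.jacobi m * (poly (q (Suc m)) y * ?A m - poly (q m) y * ?A (Suc m))"
    by (subst integral_diff_cont, (intro continuous_intros H.w_cont cF)+,
        simp only: integral_mult_right right_diff_distrib mult.assoc)
  finally have "\<bar>h y * ?K y - ?L x\<bar> = \<bar>L.jacobi m\<bar> * \<bar>poly (q (Suc m)) y * ?A m - poly (q m) y * ?A (Suc m)\<bar>"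
    by (simp add: abs_mult)
  also have "\<dots> \<le> 1 * (\<bar>poly (q (Suc m)) y\<bar> * \<bar>?A m\<bar> + \<bar>poly (q m) y\<bar> * \<bar>?A (Suc m)\<bar>)"
    by (intro mult_mono L.abs_jacobi_le order_trans[OF abs_triangle_ineq4]) (simp_all add: abs_mult)
  also have "\<dots> \<le> 1 * (\<bar>poly (q (Suc m)) y\<bar> * (comparison_const * majorant m x) + \<bar>poly (q m) y\<bar> * (comparison_const * majorant m x))"
    by (intro mult_left_mono add_mono abs_integral_kernel_F_q_le x y) auto
  finally show ?thesis by (simp add: poly_kernel_commute[of q m y x] algebra_simps)
qed

theorem lebesgue_comparison:
  assumes x: "x \<in> {-1..1}"
  shows "poly_lebesgue p m x \<le> (poly_lebesgue q m x + 3 * comparison_const * majorant m x) / h0"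
proof -
  let ?C = "comparison_const * majorant m x"
  have C: "0 \<le> ?C" using comparison_const_nonneg majorant_nonneg by simp
  have half: "\<bar>t\<bar> \<le> (1 + t * t) / 2" for t :: real
    using sum_squares_bound[of 1 "\<bar>t\<bar>"] by (simp add: power2_eq_square)
  have q1: "integral {-1..1} (\<lambda>y. \<bar>poly (q k) y\<bar>) \<le> 3 / 2" for k
  proof -
    have "integral {-1..1} (\<lambda>y. \<bar>poly (q k) y\<bar>) \<le> integral {-1..1} (\<lambda>y. (1 + poly (q k) y * poly (q k) y) / 2)"
      by (intro integral_le_cont half) (auto intro!: continuous_intros)
    also have "\<dots> = (integral {-1..1} (\<lambda>y::real. 1) + wip (\<lambda>_. 1) (q k) (q k)) / 2"
      unfolding wip_def by (subst integral_add_cont[symmetric]) (auto intro!: continuous_intros)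
    also have "\<dots> = 3 / 2" by (simp add: L.wip_p)
    finally show ?thesis .
  qed
  have "h0 * poly_lebesgue p m x = integral {-1..1} (\<lambda>y. h0 * \<bar>poly_kernel p m x y\<bar>)"
    by (simp add: poly_lebesgue_def)
  also have "\<dots> \<le> integral {-1..1} (\<lambda>y. \<bar>poly_kernel q m x y\<bar>
      + ?C * (\<bar>poly (q m) y\<bar> + \<bar>poly (q (Suc m)) y\<bar>))"
  proof (rule integral_le_cont)
    fix y :: real assume y: "y \<in> {-1..1}"
    have "h0 * \<bar>poly_kernel p m x y\<bar> \<le> \<bar>h y * poly_kernel p m x y\<bar>"
      using h_bounds[OF y] h0 by (simp add: abs_mult mult_right_mono)
    then show "h0 * \<bar>poly_kernel p m x y\<bar> \<le> \<bar>poly_kernel q m x y\<bar>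
        + ?C * (\<bar>poly (q m) y\<bar> + \<bar>poly (q (Suc m)) y\<bar>)"
      using kernel_comparison[OF x y, of m] by linarith
  qed (intro continuous_intros)+
  also have "\<dots> = poly_lebesgue q m x + ?C * (integral {-1..1} (\<lambda>y. \<bar>poly (q m) y\<bar>)
      + integral {-1..1} (\<lambda>y. \<bar>poly (q (Suc m)) y\<bar>))"
    unfolding poly_lebesgue_def
    by (subst integral_add_cont, (intro continuous_intros)+,
        simp only: integral_mult_right, subst integral_add_cont, (intro continuous_intros)+, rule refl)
  also have "\<dots> \<le> poly_lebesgue q m x + ?C * (3 / 2 + 3 / 2)"
    using C by (intro add_left_mono mult_left_mono add_mono q1)
  finally have "h0 * poly_lebesgue p m x \<le> poly_lebesgue q m x + 3 * comparison_const * majorant m x"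
    by (simp add: mult.assoc)
  then show ?thesis using h0 by (simp add: pos_le_divide_eq mult.commute[of h0])
qed

theorem lebesgue_le_sqrt:
  "\<exists>C. \<forall>m. \<forall>x\<in>{-1..1}. poly_lebesgue p m x \<le> C * sqrt (real m + 1)"
proof (intro exI allI ballI)
  fix m and x :: real assume x: "x \<in> {-1..1}"
  let ?R = "sqrt (real m + 1)"
  have q: "\<bar>poly (q k) x\<bar> \<le> 2 * ?R" if "k \<le> m + 2" for k
  proof -
    have "\<bar>poly (q k) x\<bar> \<le> sqrt (real k + 1 / 2)"
      using L.abs_q_le_at_one[OF x, of k] by (simp add: L.abs_q_one)
    also have "\<dots> \<le> sqrt (4 * (real m + 1))" using that by simp
    also have "\<dots> = 2 * ?R" by (simp only: real_sqrt_mult) simp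
    finally show ?thesis .
  qed
  have maj: "majorant m x \<le> 6 * ?R"
    unfolding majorant_def using q[of m] q[of "Suc m"] q[of "Suc (Suc m)"] by simp
  have "poly_lebesgue q m x + 3 * comparison_const * majorant m x \<le> 1000 * ?R + 3 * comparison_const * (6 * ?R)"
    using comparison_const_nonneg by (intro add_mono mult_left_mono maj L.legendre_lebesgue_le x) auto
  from order_trans[OF lebesgue_comparison[OF x] divide_right_mono[OF this]] h0
  show "poly_lebesgue p m x \<le> ((1000 + 18 * comparison_const) / h0) * ?R"
    by (simp add: algebra_simps add_divide_distrib)
qed

theorem lebesgue_le_ln_inside:
  assumes b: "b < 1"
  shows "\<exists>C. \<forall>m x. \<bar>x\<bar> \<le> b \<longrightarrow> poly_lebesgue p m x \<le> C * (1 + ln (2 * real m + 3))"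
proof -
  obtain C where C: "\<And>m x. \<bar>x\<bar> \<le> b \<Longrightarrow> poly_lebesgue q m x \<le> C * (1 + ln (2 * real m + 3))"
    using L.legendre_lebesgue_inside[OF b] by blast
  obtain B where B: "B \<ge> 1" "\<And>k x. \<bar>x\<bar> \<le> b \<Longrightarrow> \<bar>poly (q k) x\<bar> \<le> B"
    using L.q_bounded_inside[OF b] by blast
  have "poly_lebesgue p m x \<le> ((C + 9 * comparison_const * B) / h0) * (1 + ln (2 * real m + 3))"
    if x: "\<bar>x\<bar> \<le> b" for m x
  proof -
    let ?l = "1 + ln (2 * real m + 3)"
    have x1: "x \<in> {-1..1}" using x b by auto
    have l: "1 \<le> ?l" by (simp add: ln_ge_zero)
    have "majorant m x \<le> 3 * B * 1"
      unfolding majorant_def using B(2)[OF x, of m] B(2)[OF x, of "Suc m"] B(2)[OF x, of "Suc (Suc m)"] by simp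
    also have "\<dots> \<le> 3 * B * ?l" using l B(1) by (intro mult_left_mono) auto
    finally have maj: "majorant m x \<le> 3 * B * ?l" .
    have "poly_lebesgue q m x + 3 * comparison_const * majorant m x \<le> C * ?l + 3 * comparison_const * (3 * B * ?l)"
      using comparison_const_nonneg by (intro add_mono mult_left_mono maj C x) auto
    also have "\<dots> = (C + 9 * comparison_const * B) * ?l" by (simp add: algebra_simps)
    finally have "(poly_lebesgue q m x + 3 * comparison_const * majorant m x) / h0 \<le> (C + 9 * comparison_const * B) * ?l / h0"
      using h0 by (intro divide_right_mono) auto
    then show ?thesis using lebesgue_comparison[OF x1, of m] by simp
  qed
  then show ?thesis by blast
qed

end

section \<open>Functions that are bounded and Lipschitz in the second variable\<close>

text \<open>Boundedness and a Lipschitz condition in the second variable on \<open>[-1,1]\<close>, uniformly in the first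
one. A single constant serves for both.\<close>
definition bounded_lipschitz :: "(real \<Rightarrow> real \<Rightarrow> real) \<Rightarrow> bool" where
  "bounded_lipschitz F \<longleftrightarrow> (\<exists>M. \<forall>x\<in>{-1..1}. \<forall>t\<in>{-1..1}. \<forall>t'\<in>{-1..1}.
     \<bar>F x t\<bar> \<le> M \<and> \<bar>F x t - F x t'\<bar> \<le> M * \<bar>t - t'\<bar>)"

lemma bounded_lipschitzE:
  assumes "bounded_lipschitz F"
  obtains M where "M \<ge> 0" "\<And>x t. x \<in> {-1..1} \<Longrightarrow> t \<in> {-1..1} \<Longrightarrow> \<bar>F x t\<bar> \<le> M"
    "\<And>x t t'. x \<in> {-1..1} \<Longrightarrow> t \<in> {-1..1} \<Longrightarrow> t' \<in> {-1..1} \<Longrightarrow> \<bar>F x t - F x t'\<bar> \<le> M * \<bar>t - t'\<bar>"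
proof -
  obtain M where M: "\<And>x t t'. x \<in> {-1..1} \<Longrightarrow> t \<in> {-1..1} \<Longrightarrow> t' \<in> {-1..1} \<Longrightarrow>
      \<bar>F x t\<bar> \<le> M \<and> \<bar>F x t - F x t'\<bar> \<le> M * \<bar>t - t'\<bar>"
    using assms unfolding bounded_lipschitz_def by blast
  have "0 \<le> M" using M[of 0 0 0] by auto
  then show ?thesis using M by (intro that[of M]) blast+
qed

lemma bounded_lipschitzI:
  assumes "\<And>x t. x \<in> {-1..1} \<Longrightarrow> t \<in> {-1..1} \<Longrightarrow> \<bar>F x t\<bar> \<le> M"
    "\<And>x t t'. x \<in> {-1..1} \<Longrightarrow> t \<in> {-1..1} \<Longrightarrow> t' \<in> {-1..1} \<Longrightarrow> \<bar>F x t - F x t'\<bar> \<le> N * \<bar>t - t'\<bar>"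
  shows "bounded_lipschitz F"
  unfolding bounded_lipschitz_def
proof (intro exI ballI conjI)
  fix x t t' :: real assume *: "x \<in> {-1..1}" "t \<in> {-1..1}" "t' \<in> {-1..1}"
  show "\<bar>F x t\<bar> \<le> max M N" using assms(1)[of x t] * by simp
  have "\<bar>F x t - F x t'\<bar> \<le> N * \<bar>t - t'\<bar>" by (rule assms(2)[OF *])
  also have "\<dots> \<le> max M N * \<bar>t - t'\<bar>" by (intro mult_right_mono) auto
  finally show "\<bar>F x t - F x t'\<bar> \<le> max M N * \<bar>t - t'\<bar>" .
qed

lemma bounded_lipschitz_fst:
  assumes "\<And>x. x \<in> {-1..1} \<Longrightarrow> \<bar>f x\<bar> \<le> M"
  shows "bounded_lipschitz (\<lambda>x t. f x)"
  using assms by (intro bounded_lipschitzI[of _ M 0]) auto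

lemma bounded_lipschitz_snd: "bounded_lipschitz (\<lambda>x t. t)"
  by (intro bounded_lipschitzI[of _ 1 1]) auto

lemma bounded_lipschitz_add:
  assumes "bounded_lipschitz F" "bounded_lipschitz G"
  shows "bounded_lipschitz (\<lambda>x t. F x t + G x t)"
proof -
  obtain M where M: "M \<ge> 0" "\<And>x t. x \<in> {-1..1} \<Longrightarrow> t \<in> {-1..1} \<Longrightarrow> \<bar>F x t\<bar> \<le> M"
    "\<And>x t t'. x \<in> {-1..1} \<Longrightarrow> t \<in> {-1..1} \<Longrightarrow> t' \<in> {-1..1} \<Longrightarrow> \<bar>F x t - F x t'\<bar> \<le> M * \<bar>t - t'\<bar>"
    using bounded_lipschitzE[OF assms(1)] by metis
  obtain N where N: "N \<ge> 0" "\<And>x t. x \<in> {-1..1} \<Longrightarrow> t \<in> {-1..1} \<Longrightarrow> \<bar>G x t\<bar> \<le> N"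
    "\<And>x t t'. x \<in> {-1..1} \<Longrightarrow> t \<in> {-1..1} \<Longrightarrow> t' \<in> {-1..1} \<Longrightarrow> \<bar>G x t - G x t'\<bar> \<le> N * \<bar>t - t'\<bar>"
    using bounded_lipschitzE[OF assms(2)] by metis
  show ?thesis
  proof (rule bounded_lipschitzI[of _ "M + N" "M + N"])
    fix x t :: real assume *: "x \<in> {-1..1}" "t \<in> {-1..1}"
    show "\<bar>F x t + G x t\<bar> \<le> M + N" using M(2)[OF *] N(2)[OF *] by linarith
    fix t' :: real assume t': "t' \<in> {-1..1}"
    show "\<bar>F x t + G x t - (F x t' + G x t')\<bar> \<le> (M + N) * \<bar>t - t'\<bar>"
      using M(3)[OF * t'] N(3)[OF * t'] unfolding distrib_right by linarith
  qed
qed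

lemma bounded_lipschitz_mult:
  assumes "bounded_lipschitz F" "bounded_lipschitz G"
  shows "bounded_lipschitz (\<lambda>x t. F x t * G x t)"
proof -
  obtain M where M: "M \<ge> 0" "\<And>x t. x \<in> {-1..1} \<Longrightarrow> t \<in> {-1..1} \<Longrightarrow> \<bar>F x t\<bar> \<le> M"
    "\<And>x t t'. x \<in> {-1..1} \<Longrightarrow> t \<in> {-1..1} \<Longrightarrow> t' \<in> {-1..1} \<Longrightarrow> \<bar>F x t - F x t'\<bar> \<le> M * \<bar>t - t'\<bar>"
    using bounded_lipschitzE[OF assms(1)] by metis
  obtain N where N: "N \<ge> 0" "\<And>x t. x \<in> {-1..1} \<Longrightarrow> t \<in> {-1..1} \<Longrightarrow> \<bar>G x t\<bar> \<le> N"
    "\<And>x t t'. x \<in> {-1..1} \<Longrightarrow> t \<in> {-1..1} \<Longrightarrow> t' \<in> {-1..1} \<Longrightarrow> \<bar>G x t - G x t'\<bar> \<le> N * \<bar>t - t'\<bar>"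
    using bounded_lipschitzE[OF assms(2)] by metis
  show ?thesis
  proof (rule bounded_lipschitzI[of _ "M * N" "2 * M * N"])
    fix x t :: real assume *: "x \<in> {-1..1}" "t \<in> {-1..1}"
    show "\<bar>F x t * G x t\<bar> \<le> M * N"
      unfolding abs_mult using M(1) by (intro mult_mono M(2) N(2) *) auto
    fix t' :: real assume t': "t' \<in> {-1..1}"
    have "F x t * G x t - F x t' * G x t' = F x t * (G x t - G x t') + (F x t - F x t') * G x t'"
      by (simp add: algebra_simps)
    also have "\<bar>\<dots>\<bar> \<le> \<bar>F x t\<bar> * \<bar>G x t - G x t'\<bar> + \<bar>F x t - F x t'\<bar> * \<bar>G x t'\<bar>"
      using abs_triangle_ineq by (simp flip: abs_mult)
    also have "\<dots> \<le> M * (N * \<bar>t - t'\<bar>) + (M * \<bar>t - t'\<bar>) * N"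
      using M(1) by (intro add_mono mult_mono M N * t') auto
    finally show "\<bar>F x t * G x t - F x t' * G x t'\<bar> \<le> 2 * M * N * \<bar>t - t'\<bar>"
      by (simp add: algebra_simps)
  qed
qed

lemma bounded_lipschitz_inverse:
  assumes "bounded_lipschitz F" and d: "0 < d"
    and le: "\<And>x t. x \<in> {-1..1} \<Longrightarrow> t \<in> {-1..1} \<Longrightarrow> d \<le> F x t"
  shows "bounded_lipschitz (\<lambda>x t. 1 / F x t)"
proof -
  obtain M where M: "M \<ge> 0" "\<And>x t. x \<in> {-1..1} \<Longrightarrow> t \<in> {-1..1} \<Longrightarrow> \<bar>F x t\<bar> \<le> M"
    "\<And>x t t'. x \<in> {-1..1} \<Longrightarrow> t \<in> {-1..1} \<Longrightarrow> t' \<in> {-1..1} \<Longrightarrow> \<bar>F x t - F x t'\<bar> \<le> M * \<bar>t - t'\<bar>"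
    using bounded_lipschitzE[OF assms(1)] by metis
  show ?thesis
  proof (rule bounded_lipschitzI[of _ "1 / d" "M / (d * d)"])
    fix x t :: real assume *: "x \<in> {-1..1}" "t \<in> {-1..1}"
    have p: "0 < F x t" using le[OF *] d by simp
    show "\<bar>1 / F x t\<bar> \<le> 1 / d" using le[OF *] d p by (simp add: frac_le)
    fix t' :: real assume t': "t' \<in> {-1..1}"
    have p': "0 < F x t'" using le[OF *(1) t'] d by simp
    have "1 / F x t - 1 / F x t' = - (F x t - F x t') / (F x t * F x t')"
      using p p' by (simp add: field_simps)
    also have "\<bar>\<dots>\<bar> = \<bar>F x t - F x t'\<bar> / (F x t * F x t')" using p p' by (simp add: abs_mult)
    also have "\<dots> \<le> (M * \<bar>t - t'\<bar>) / (d * d)"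
      using M(3)[OF * t'] le[OF *] le[OF *(1) t'] d M(1) p p'
      by (intro frac_le mult_mono) auto
    finally show "\<bar>1 / F x t - 1 / F x t'\<bar> \<le> M / (d * d) * \<bar>t - t'\<bar>" by simp
  qed
qed

section \<open>The change of variables\<close>

text \<open>The points \<open>exp (i * pi * y / T)\<close> with \<open>y\<close> in \<open>[-1,1]\<close> form a proper arc of the unit circle, of half
opening angle \<open>2 * \<omega> < pi\<close>. The function \<open>u\<close> is the algebraic variable, \<open>g\<close> is \<open>c\<close> expressed in that
variable, and \<open>c 1 = cos \<omega> > 0\<close> is the lower bound of both \<open>c\<close> and \<open>g\<close>.\<close>
locale arc =
  fixes T :: real
  assumes T: "T > 1"
begin

definition \<omega> :: real where "\<omega> = pi / (2 * T)"
definition S :: real where "S = sin \<omega>"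
definition c :: "real \<Rightarrow> real" where "c y = cos (\<omega> * y)"
definition u :: "real \<Rightarrow> real" where "u y = sin (\<omega> * y) / S"
definition g :: "real \<Rightarrow> real" where "g v = sqrt (1 - (S * v)\<^sup>2)"

lemma omega: "0 < \<omega>" "\<omega> < pi / 2"
  using T by (simp_all add: \<omega>_def field_simps)

lemma S_pos: "0 < S"
  unfolding S_def using omega by (intro sin_gt_zero) auto

lemma c_pos: "y \<in> {-1..1} \<Longrightarrow> 0 < c y" and c_ge: "y \<in> {-1..1} \<Longrightarrow> c 1 \<le> c y"
proof -
  assume y: "y \<in> {-1..1}"
  have b: "\<bar>\<omega> * y\<bar> \<le> \<omega>" using y omega by (auto simp: abs_mult mult_left_le)
  then have "\<bar>\<omega> * y\<bar> < pi / 2" using omega by linarith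
  then show "0 < c y" unfolding c_def by (intro cos_gt_zero_pi) (simp_all only: abs_less_iff, simp_all)
  have "cos \<omega> \<le> cos \<bar>\<omega> * y\<bar>" using b omega by (intro cos_monotone_0_pi_le) auto
  then show "c 1 \<le> c y" by (simp add: c_def)
qed

lemma c_le: "c y \<le> 1"
  by (simp add: c_def)

lemma u_mono: "\<bar>y\<bar> \<le> b \<Longrightarrow> b \<le> 1 \<Longrightarrow> \<bar>u y\<bar> \<le> u b"
proof -
  assume y: "\<bar>y\<bar> \<le> b" "b \<le> 1"
  have b: "0 \<le> b" using y by simp
  have *: "sin (\<omega> * z) \<le> sin (\<omega> * b)" if "\<bar>z\<bar> \<le> b" for z
  proof (rule sin_monotone_2pi_le)
    have "\<omega> * b \<le> \<omega> * 1" using y omega by (intro mult_left_mono) auto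
    moreover have "\<bar>\<omega> * z\<bar> \<le> \<omega> * b" using that omega by (simp add: abs_mult)
    ultimately show "- (pi / 2) \<le> \<omega> * z" "\<omega> * b \<le> pi / 2" using omega by linarith+
    show "\<omega> * z \<le> \<omega> * b" using that omega by simp
  qed
  have "\<bar>sin (\<omega> * y)\<bar> \<le> sin (\<omega> * b)" using *[of y] *[of "- y"] y by (auto simp: abs_le_iff)
  then show ?thesis using S_pos by (simp add: u_def divide_right_mono)
qed

lemma u_1: "u 1 = 1" and u_minus: "u (- y) = - u y"
  using S_pos by (simp_all add: u_def S_def)

lemma u_range: "y \<in> {-1..1} \<Longrightarrow> u y \<in> {-1..1}"
  using u_mono[of y 1] by (simp add: u_1 abs_le_iff)

lemma u_less_1: "0 \<le> b \<Longrightarrow> b < 1 \<Longrightarrow> u b < 1"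
proof -
  assume b: "0 \<le> b" "b < 1"
  have "0 \<le> \<omega> * b" using b omega by simp
  moreover have "\<omega> * b < \<omega>" using b omega by simp
  ultimately have "sin (\<omega> * b) < sin \<omega>" using omega by (intro sin_monotone_2pi) auto
  then show ?thesis using S_pos by (simp add: u_def S_def)
qed

lemma scaled_square_le: "v \<in> {-1..1} \<Longrightarrow> (S * v)\<^sup>2 \<le> S\<^sup>2"
  unfolding power_mult_distrib by (rule mult_left_le) (auto simp: abs_square_le_1 abs_le_iff)

lemma g_bounds: "v \<in> {-1..1} \<Longrightarrow> c 1 \<le> g v \<and> g v \<le> 1"
proof
  assume v: "v \<in> {-1..1}"
  have "(c 1)\<^sup>2 = 1 - S\<^sup>2" by (simp add: c_def S_def cos_squared_eq)
  then have "(c 1)\<^sup>2 \<le> 1 - (S * v)\<^sup>2" using scaled_square_le[OF v] by simp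
  then show "c 1 \<le> g v" unfolding g_def by (rule real_le_rsqrt)
  show "g v \<le> 1" by (simp add: g_def)
qed

lemma g_pos: "v \<in> {-1..1} \<Longrightarrow> 0 < g v"
  using g_bounds[of v] c_pos[of 1] by auto

lemma g_u: "y \<in> {-1..1} \<Longrightarrow> g (u y) = c y"
  using c_pos[of y] S_pos by (simp add: g_def u_def c_def cos_squared_eq[symmetric])

lemma g_minus: "g (- v) = g v" by (simp add: g_def)

lemma g_square: "v \<in> {-1..1} \<Longrightarrow> g v * g v = 1 - S\<^sup>2 * v\<^sup>2"
  using g_pos[of v] by (simp add: g_def power_mult_distrib flip: power2_eq_square)

lemma continuous_g: "continuous_on A g"
  unfolding g_def by (intro continuous_intros)

lemma g_diff:
  assumes "x \<in> {-1..1}" "t \<in> {-1..1}"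
  shows "g x - g t = (x - t) * (- (S\<^sup>2) * (x + t) * (1 / (g x + g t)))"
proof -
  have p: "0 < g x + g t" using g_pos assms by (simp add: add_pos_pos)
  have "(g x - g t) * (g x + g t) = (x - t) * (- (S\<^sup>2) * (x + t))"
    using g_square assms by (simp add: algebra_simps power2_eq_square)
  then show ?thesis using p by (simp add: field_simps)
qed

lemma bounded_lipschitz_g: "bounded_lipschitz (\<lambda>x t. g t)"
proof (rule bounded_lipschitzI[of _ 1 "S\<^sup>2 * 2 * (1 / c 1)"])
  fix x t :: real assume *: "x \<in> {-1..1}" "t \<in> {-1..1}"
  show "\<bar>g t\<bar> \<le> 1" using g_bounds[OF *(2)] g_pos[OF *(2)] by simp
  fix t' :: real assume t': "t' \<in> {-1..1}"
  have c1: "0 < c 1" using c_pos by simp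
  have "\<bar>g t - g t'\<bar> = \<bar>t - t'\<bar> * (S\<^sup>2 * \<bar>t + t'\<bar> * (1 / (g t + g t')))"
    using g_pos[OF *(2)] g_pos[OF t'] by (simp add: g_diff[OF *(2) t'] abs_mult)
  also have "\<dots> \<le> \<bar>t - t'\<bar> * (S\<^sup>2 * 2 * (1 / c 1))"
  proof (intro mult_left_mono mult_mono)
    show "1 / (g t + g t') \<le> 1 / c 1"
      using g_bounds[OF *(2)] g_pos[OF t'] c1 by (intro divide_left_mono) (auto intro: add_pos_pos)
    show "0 \<le> 1 / (g t + g t')" using g_pos[OF *(2)] g_pos[OF t'] by simp
  qed (use * t' in auto)
  finally show "\<bar>g t - g t'\<bar> \<le> S\<^sup>2 * 2 * (1 / c 1) * \<bar>t - t'\<bar>" by (simp add: mult.commute)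
qed

lemma bounded_lipschitz_g_fst: "bounded_lipschitz (\<lambda>x t. g x)"
  by (rule bounded_lipschitz_fst[of _ 1]) (use g_bounds g_pos in \<open>auto simp: abs_le_iff less_imp_le intro: order_trans[of _ 0]\<close>)

lemma bounded_lipschitz_quotient:
  "bounded_lipschitz (\<lambda>x t. k * (x + t) * (1 / (g x + g t)))"
proof -
  have "bounded_lipschitz (\<lambda>x t. 1 / (g x + g t))"
    using c_pos[of 1] g_bounds g_pos
    by (intro bounded_lipschitz_inverse[where d = "c 1"] bounded_lipschitz_add
        bounded_lipschitz_g bounded_lipschitz_g_fst) (auto intro: add_increasing2 less_imp_le)
  moreover have "bounded_lipschitz (\<lambda>x t. k * (x + t))"
    by (intro bounded_lipschitz_mult bounded_lipschitz_add bounded_lipschitz_snd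
        bounded_lipschitz_fst[of "\<lambda>_. k" "\<bar>k\<bar>"] bounded_lipschitz_fst[of "\<lambda>x. x" 1]) auto
  ultimately show ?thesis by (rule bounded_lipschitz_mult[rotated])
qed

lemma comparison_g:
  assumes q: "legendre_polys q" and p: "orthonormal_polys g p"
  shows "\<exists>F M. legendre_comparison q p g F (c 1) 1 M"
proof -
  let ?F = "\<lambda>x t. (- (S\<^sup>2)) * (x + t) * (1 / (g x + g t)) * (1 / g t)"
  have "bounded_lipschitz (\<lambda>x t. 1 / g t)"
    using c_pos[of 1] g_bounds by (intro bounded_lipschitz_inverse[where d = "c 1"] bounded_lipschitz_g) auto
  from bounded_lipschitz_mult[OF bounded_lipschitz_quotient this]
  have "bounded_lipschitz ?F" .
  then obtain M where M: "M \<ge> 0" "\<And>x t. x \<in> {-1..1} \<Longrightarrow> t \<in> {-1..1} \<Longrightarrow> \<bar>?F x t\<bar> \<le> M"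
    "\<And>x t t'. x \<in> {-1..1} \<Longrightarrow> t \<in> {-1..1} \<Longrightarrow> t' \<in> {-1..1} \<Longrightarrow> \<bar>?F x t - ?F x t'\<bar> \<le> M * \<bar>t - t'\<bar>"
    by (rule bounded_lipschitzE) blast
  have "legendre_comparison_axioms g ?F (c 1) 1 M"
  proof
    fix x t :: real assume *: "x \<in> {-1..1}" "t \<in> {-1..1}"
    have e: "(x - t) * (X * (1 / g t)) * g t = (x - t) * X" for X
      using g_pos[OF *(2)] by simp
    show "g x - g t = (x - t) * ?F x t * g t" unfolding e g_diff[OF *] ..
  qed (use M c_pos g_bounds in auto)
  then show ?thesis using q p by (blast intro: legendre_comparison.intro)
qed

lemma comparison_inverse_g:
  assumes q: "legendre_polys q" and p: "orthonormal_polys (\<lambda>v. 1 / g v) p"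
  shows "\<exists>F M. legendre_comparison q p (\<lambda>v. 1 / g v) F 1 (1 / c 1) M"
proof -
  let ?F = "\<lambda>x t. S\<^sup>2 * (x + t) * (1 / (g x + g t)) * (1 / g x)"
  have "bounded_lipschitz (\<lambda>x t. 1 / g x)"
    using c_pos[of 1] g_bounds by (intro bounded_lipschitz_inverse[where d = "c 1"] bounded_lipschitz_g_fst) auto
  from bounded_lipschitz_mult[OF bounded_lipschitz_quotient this]
  have "bounded_lipschitz ?F" .
  then obtain M where M: "M \<ge> 0" "\<And>x t. x \<in> {-1..1} \<Longrightarrow> t \<in> {-1..1} \<Longrightarrow> \<bar>?F x t\<bar> \<le> M"
    "\<And>x t t'. x \<in> {-1..1} \<Longrightarrow> t \<in> {-1..1} \<Longrightarrow> t' \<in> {-1..1} \<Longrightarrow> \<bar>?F x t - ?F x t'\<bar> \<le> M * \<bar>t - t'\<bar>"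
    by (rule bounded_lipschitzE) blast
  have "legendre_comparison_axioms (\<lambda>v. 1 / g v) ?F 1 (1 / c 1) M"
  proof
    fix x t :: real assume *: "x \<in> {-1..1}" "t \<in> {-1..1}"
    have "1 / g x - 1 / g t = - (g x - g t) * (1 / g x) * (1 / g t)"
      using g_pos[OF *(1)] g_pos[OF *(2)] by (simp add: field_simps)
    also have "\<dots> = (x - t) * ?F x t * (1 / g t)" unfolding g_diff[OF *] by simp
    finally show "1 / g x - 1 / g t = (x - t) * ?F x t * (1 / g t)" .
  next
    fix t :: real assume t: "t \<in> {-1..1}"
    show "1 \<le> 1 / g t \<and> 1 / g t \<le> 1 / c 1"
      using g_bounds[OF t] g_pos[OF t] c_pos[of 1] by (auto intro: divide_left_mono)
  qed (use M in auto)
  then show ?thesis using q p by (blast intro: legendre_comparison.intro)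
qed

lemma integral_substitution_u:
  assumes "continuous_on {-1..1} f"
  shows "integral {-1..1} (\<lambda>y. \<omega> / S * c y * f (u y)) = integral {-1..1} f"
proof -
  have "((\<lambda>y. (\<omega> / S * c y) *\<^sub>R f (u y)) has_integral (integral {u (-1)..u 1} f)) {-1..1}"
  proof (rule has_integral_substitution)
    show "u ` {-1..1} \<subseteq> {-1..1}" using u_range by blast
    show "u (-1) \<le> u 1" by (simp add: u_minus u_1)
    show "(u has_field_derivative \<omega> / S * c y) (at y within {-1..1})" for y
      unfolding u_def[abs_def] c_def using S_pos by (auto intro!: derivative_eq_intros)
  qed (use assms in auto)
  then show ?thesis by (intro integral_unique) (simp add: u_minus u_1)
qed

lemma continuous_u: "continuous_on A u" and continuous_c: "continuous_on A c"
  unfolding u_def[abs_def] c_def[abs_def] using S_pos by (auto intro!: continuous_intros)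

end

section \<open>Trigonometric polynomials in the algebraic variable\<close>

lemma trig_fun_in_trig_space: "\<bar>i\<bar> \<le> int n \<Longrightarrow> trig_fun T i \<in> trig_space T n"
  unfolding trig_space_def by (intro lincomb_span_member) auto

lemma trig_space_mono: "m \<le> n \<Longrightarrow> trig_space T m \<subseteq> trig_space T n"
  unfolding trig_space_def by (intro lincomb_span_mono lincomb_span_member) auto

lemma trig_fun_add: "trig_fun T (i + j) x = trig_fun T i x * trig_fun T j x"
  by (simp add: trig_fun_def flip: exp_add) (simp add: algebra_simps add_divide_distrib)

lemma trig_space_mult:
  assumes "f \<in> trig_space T m" "g \<in> trig_space T n"
  shows "(\<lambda>x. f x * g x) \<in> trig_space T (m + n)"
proof -
  obtain a b where f: "f = (\<lambda>x. \<Sum>i\<in>{- int m..int m}. a i * trig_fun T i x)"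
    and g: "g = (\<lambda>x. \<Sum>j\<in>{- int n..int n}. b j * trig_fun T j x)"
    using assms unfolding trig_space_def lincomb_span_def by blast
  have "(\<lambda>x. \<Sum>i\<in>{- int m..int m}. a i * (\<Sum>j\<in>{- int n..int n}. b j * trig_fun T (i + j) x))
      \<in> trig_space T (m + n)"
    unfolding trig_space_def
    by (intro lincomb_span_sum[where f = "\<lambda>i x. \<Sum>j\<in>{- int n..int n}. b j * trig_fun T (i + j) x"]
        lincomb_span_sum lincomb_span_member) auto
  moreover have "(\<lambda>x. f x * g x) = (\<lambda>x. \<Sum>i\<in>{- int m..int m}. a i * (\<Sum>j\<in>{- int n..int n}. b j * trig_fun T (i + j) x))"
    unfolding f g trig_fun_add sum_product by (simp only: sum_distrib_left mult_ac)
  ultimately show ?thesis by simp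
qed

lemma trig_space_add: "f \<in> trig_space T n \<Longrightarrow> g \<in> trig_space T n \<Longrightarrow> (\<lambda>x. f x + g x) \<in> trig_space T n"
  and trig_space_scale: "f \<in> trig_space T n \<Longrightarrow> (\<lambda>x. a * f x) \<in> trig_space T n"
  unfolding trig_space_def by (rule lincomb_span_add lincomb_span_scale; assumption)+

lemma trig_space_sum:
  "(\<And>j. j \<in> J \<Longrightarrow> f j \<in> trig_space T n) \<Longrightarrow> (\<lambda>x. \<Sum>j\<in>J. a j * f j x) \<in> trig_space T n"
  unfolding trig_space_def by (rule lincomb_span_sum)

lemma LINT_eq_integral:
  fixes f :: "real \<Rightarrow> real"
  assumes "continuous_on UNIV f"
  shows "(LINT y:{-1..1}|lborel. f y) = integral {-1..1} f"
  by (rule set_borel_integral_eq_integral(2)[OF set_integrable_continuous[OF assms]])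

lemma integral_odd:
  fixes f :: "real \<Rightarrow> real"
  assumes "\<And>v. f (- v) = - f v"
  shows "integral {-1..1} f = 0"
  using Henstock_Kurzweil_Integration.integral_reflect_real[of 1 "-1" f] by (simp add: assms)

lemma integral_reflect_unit:
  fixes f :: "real \<Rightarrow> real"
  shows "integral {-1..1} (\<lambda>v. f (- v)) = integral {-1..1} f"
  using Henstock_Kurzweil_Integration.integral_reflect_real[of 1 "-1" f] by simp

context arc
begin

lemma trig_fun_eq: "trig_fun T j y = of_real (cos (2 * \<omega> * of_int j * y)) + \<i> * of_real (sin (2 * \<omega> * of_int j * y))"
proof -
  have "pi / T * of_int j * y = 2 * \<omega> * of_int j * y" by (simp add: \<omega>_def)
  then show ?thesis by (simp only: trig_fun_def exp_Euler cos_of_real sin_of_real)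
qed

lemma cos_double_u: "cos (2 * \<omega> * y) = 1 - 2 * S\<^sup>2 * (u y)\<^sup>2"
  using S_pos cos_double_sin[of "\<omega> * y"] by (simp add: u_def power_divide mult.assoc)

lemma sin_double_u: "sin (2 * \<omega> * y) = c y * (2 * S * u y)"
  using S_pos sin_double[of "\<omega> * y"] by (simp add: u_def c_def mult.assoc)

text \<open>Cosines and sines of \<open>k\<close> times the basic angle both satisfy Chebyshev's recurrence, whose
coefficient \<open>2 * cos (2 * \<omega> * y)\<close> is an even quadratic polynomial in \<open>u y\<close>.\<close>
lemma cos_sin_as_poly:
  "\<exists>A B. degree A \<le> 2 * k \<and> degree B \<le> 2 * k \<and> (\<forall>v. poly A (- v) = poly A v) \<and> (\<forall>v. poly B (- v) = - poly B v)
    \<and> (\<forall>y. cos (2 * \<omega> * real k * y) = poly A (u y)) \<and> (\<forall>y. sin (2 * \<omega> * real k * y) = c y * poly B (u y))"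
proof (induction k rule: induct_nat_012)
  case 0
  show ?case by (rule exI[of _ 1], rule exI[of _ 0]) simp
next
  case 1
  show ?case
    by (rule exI[of _ "[:1, 0, - 2 * S\<^sup>2:]"], rule exI[of _ "[:0, 2 * S:]"])
      (auto simp: cos_double_u sin_double_u power2_eq_square)
next
  case (ge2 k)
  obtain A B where AB: "degree A \<le> 2 * k" "degree B \<le> 2 * k" "\<And>v. poly A (- v) = poly A v" "\<And>v. poly B (- v) = - poly B v"
    "\<And>y. cos (2 * \<omega> * real k * y) = poly A (u y)" "\<And>y. sin (2 * \<omega> * real k * y) = c y * poly B (u y)"
    using ge2(1) by blast
  obtain A' B' where AB': "degree A' \<le> 2 * Suc k" "degree B' \<le> 2 * Suc k"
    "\<And>v. poly A' (- v) = poly A' v" "\<And>v. poly B' (- v) = - poly B' v"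
    "\<And>y. cos (2 * \<omega> * real (Suc k) * y) = poly A' (u y)" "\<And>y. sin (2 * \<omega> * real (Suc k) * y) = c y * poly B' (u y)"
    using ge2(2) by blast
  define X where "X = [:2, 0, - 4 * S\<^sup>2:]"
  have X: "poly X (u y) = 2 * cos (2 * \<omega> * y)" for y
    by (simp add: X_def cos_double_u power2_eq_square)
  have Xe: "poly X (- v) = poly X v" for v by (simp add: X_def)
  have dX: "degree X \<le> 2" by (simp add: X_def)
  have d: "degree (X * Q' - Q) \<le> 2 * Suc (Suc k)" if "degree Q' \<le> 2 * Suc k" "degree Q \<le> 2 * k" for Q Q'
    using that dX degree_mult_le[of X Q'] by (intro degree_diff_le) simp_all
  have arg: "2 * \<omega> * real (Suc (Suc k)) * y = 2 * \<omega> * real (Suc k) * y + 2 * \<omega> * y"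
    "2 * \<omega> * real k * y = 2 * \<omega> * real (Suc k) * y - 2 * \<omega> * y" for y
    by (simp_all add: algebra_simps)
  have C: "cos (2 * \<omega> * real (Suc (Suc k)) * y)
      = 2 * cos (2 * \<omega> * y) * cos (2 * \<omega> * real (Suc k) * y) - cos (2 * \<omega> * real k * y)" for y
    unfolding arg cos_add cos_diff by simp
  have D: "sin (2 * \<omega> * real (Suc (Suc k)) * y)
      = 2 * cos (2 * \<omega> * y) * sin (2 * \<omega> * real (Suc k) * y) - sin (2 * \<omega> * real k * y)" for y
    unfolding arg sin_add sin_diff by simp
  show ?case
  proof (intro exI conjI allI)
    show "degree (X * A' - A) \<le> 2 * Suc (Suc k)" "degree (X * B' - B) \<le> 2 * Suc (Suc k)"
      by (intro d AB AB')+
    fix y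
    show "cos (2 * \<omega> * real (Suc (Suc k)) * y) = poly (X * A' - A) (u y)"
      unfolding C AB AB' by (simp add: X)
    show "sin (2 * \<omega> * real (Suc (Suc k)) * y) = c y * poly (X * B' - B) (u y)"
      unfolding D AB AB' by (simp add: X algebra_simps)
  qed (simp_all add: Xe AB AB')
qed

lemma u_power_even_in_trig_space: "(\<lambda>y. of_real (u y ^ (2 * j))) \<in> trig_space T j"
proof (induction j)
  case 0
  have "(\<lambda>y. of_real (u y ^ (2 * 0))) = trig_fun T 0" by (simp add: trig_fun_def fun_eq_iff)
  then show ?case using trig_fun_in_trig_space[of 0 0 T] by simp
next
  case (Suc j)
  have "(\<lambda>y. of_real (1 / (2 * S\<^sup>2)) * trig_fun T 0 y + of_real (- 1 / (4 * S\<^sup>2)) * (trig_fun T 1 y + 1 * trig_fun T (-1) y))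
      \<in> trig_space T 1"
    by (intro trig_space_add trig_space_scale trig_fun_in_trig_space) auto
  moreover have "(\<lambda>y. of_real (1 / (2 * S\<^sup>2)) * trig_fun T 0 y + of_real (- 1 / (4 * S\<^sup>2)) * (trig_fun T 1 y + 1 * trig_fun T (-1) y))
      = (\<lambda>y. of_real ((u y)\<^sup>2))"
  proof
    fix y
    have "trig_fun T 1 y + 1 * trig_fun T (-1) y = of_real (2 * cos (2 * \<omega> * y))"
      by (simp add: trig_fun_eq)
    moreover have "trig_fun T 0 y = 1" by (simp add: trig_fun_eq)
    ultimately have "of_real (1 / (2 * S\<^sup>2)) * trig_fun T 0 y + of_real (- 1 / (4 * S\<^sup>2)) * (trig_fun T 1 y + 1 * trig_fun T (-1) y)
      = complex_of_real (1 / (2 * S\<^sup>2) + (- 1 / (4 * S\<^sup>2)) * (2 * cos (2 * \<omega> * y)))" by simp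
    also have "1 / (2 * S\<^sup>2) + (- 1 / (4 * S\<^sup>2)) * (2 * cos (2 * \<omega> * y)) = (u y)\<^sup>2"
      unfolding cos_double_u using S_pos by (simp add: field_simps)
    finally show "of_real (1 / (2 * S\<^sup>2)) * trig_fun T 0 y + of_real (- 1 / (4 * S\<^sup>2)) * (trig_fun T 1 y + 1 * trig_fun T (-1) y)
      = complex_of_real ((u y)\<^sup>2)" .
  qed
  ultimately have "(\<lambda>y. of_real ((u y)\<^sup>2)) \<in> trig_space T 1" by simp
  from trig_space_mult[OF Suc.IH this]
  have "(\<lambda>y. of_real (u y ^ (2 * j)) * of_real ((u y)\<^sup>2)) \<in> trig_space T (Suc j)" by simp
  moreover have "(\<lambda>y. of_real (u y ^ (2 * j)) * of_real ((u y)\<^sup>2)) = (\<lambda>y. complex_of_real (u y ^ (2 * Suc j)))"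
    by (simp add: fun_eq_iff power2_eq_square mult_ac)
  ultimately show ?case by simp
qed

lemma c_u_power_odd_in_trig_space: "(\<lambda>y. of_real (c y * u y ^ (2 * j + 1))) \<in> trig_space T (Suc j)"
proof -
  have "(\<lambda>y. (- \<i> / of_real (4 * S)) * (trig_fun T 1 y + (-1) * trig_fun T (-1) y)) \<in> trig_space T 1"
    by (intro trig_space_add trig_space_scale trig_fun_in_trig_space) auto
  moreover have "(\<lambda>y. (- \<i> / of_real (4 * S)) * (trig_fun T 1 y + (-1) * trig_fun T (-1) y))
      = (\<lambda>y. of_real (c y * u y))"
  proof
    fix y
    have "trig_fun T 1 y + (-1) * trig_fun T (-1) y = 2 * \<i> * of_real (sin (2 * \<omega> * y))"
      by (simp add: trig_fun_eq)
    then show "(- \<i> / of_real (4 * S)) * (trig_fun T 1 y + (-1) * trig_fun T (-1) y) = of_real (c y * u y)"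
      using S_pos unfolding sin_double_u by (simp add: field_simps)
  qed
  ultimately have "(\<lambda>y. of_real (c y * u y)) \<in> trig_space T 1" by simp
  from trig_space_mult[OF this u_power_even_in_trig_space[of j]]
  have "(\<lambda>y. of_real (c y * u y) * of_real (u y ^ (2 * j))) \<in> trig_space T (Suc j)" by simp
  moreover have "(\<lambda>y. of_real (c y * u y) * of_real (u y ^ (2 * j))) = (\<lambda>y. complex_of_real (c y * u y ^ (2 * j + 1)))"
    by (simp add: fun_eq_iff mult_ac)
  ultimately show ?thesis by simp
qed

text \<open>Conversely, even polynomials in \<open>u\<close>, and \<open>c\<close> times odd polynomials in \<open>u\<close>, are trigonometric
polynomials. Both are obtained from an arbitrary polynomial by taking its even or odd part.\<close>
lemma even_part_in_trig_space:
  assumes "degree r \<le> 2 * n"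
  shows "(\<lambda>y. of_real (poly r (u y) + poly r (- u y))) \<in> trig_space T n"
proof -
  let ?J = "{i \<in> {..degree r}. even i}"
  have "(\<lambda>y. \<Sum>i\<in>?J. of_real (2 * coeff r i) * of_real (u y ^ i)) \<in> trig_space T n"
  proof (rule trig_space_sum)
    fix i assume "i \<in> ?J"
    then obtain j where "i = 2 * j" "j \<le> n" using assms by auto
    then show "(\<lambda>y. of_real (u y ^ i)) \<in> trig_space T n"
      using u_power_even_in_trig_space[of j] trig_space_mono[of j n T] by auto
  qed
  moreover have "poly r v + poly r (- v) = (\<Sum>i\<in>?J. 2 * coeff r i * v ^ i)" for v
  proof -
    have "poly r v + poly r (- v) = (\<Sum>i\<le>degree r. coeff r i * (v ^ i + (- v) ^ i))"
      by (simp add: poly_altdef sum.distrib distrib_left)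
    also have "\<dots> = (\<Sum>i\<le>degree r. if even i then 2 * coeff r i * v ^ i else 0)"
      by (intro sum.cong) (auto simp: power_minus_odd)
    finally show ?thesis by (simp only: sum.inter_filter finite_atMost)
  qed
  ultimately show ?thesis by simp
qed

lemma odd_part_in_trig_space:
  assumes "degree r \<le> 2 * n"
  shows "(\<lambda>y. of_real (c y * (poly r (u y) - poly r (- u y)))) \<in> trig_space T n"
proof -
  let ?J = "{i \<in> {..degree r}. odd i}"
  have "(\<lambda>y. \<Sum>i\<in>?J. of_real (2 * coeff r i) * of_real (c y * u y ^ i)) \<in> trig_space T n"
  proof (rule trig_space_sum)
    fix i assume i: "i \<in> ?J"
    then obtain j where j: "i = 2 * j + 1" by (auto elim: oddE)
    then have "Suc j \<le> n" using i assms by auto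
    then show "(\<lambda>y. of_real (c y * u y ^ i)) \<in> trig_space T n"
      using c_u_power_odd_in_trig_space[of j] trig_space_mono[of "Suc j" n T] j by auto
  qed
  moreover have "c y * (poly r v - poly r (- v)) = (\<Sum>i\<in>?J. 2 * coeff r i * (c y * v ^ i))" for v y
  proof -
    have "c y * (poly r v - poly r (- v)) = (\<Sum>i\<le>degree r. coeff r i * (c y * (v ^ i - (- v) ^ i)))"
      by (simp add: poly_altdef sum_distrib_left flip: sum_subtractf) (simp add: algebra_simps)
    also have "\<dots> = (\<Sum>i\<le>degree r. if odd i then 2 * coeff r i * (c y * v ^ i) else 0)"
      by (intro sum.cong) (auto simp: power_minus_odd)
    finally show ?thesis by (simp only: sum.inter_filter finite_atMost)
  qed
  ultimately show ?thesis by simp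
qed

end

section \<open>The kernel of the projection\<close>

text \<open>Orthonormal polynomials for the weights \<open>1 / g\<close> and \<open>g\<close>, which represent the even and the odd
trigonometric polynomials.\<close>
locale arc_kernel = arc +
  E: orthonormal_polys "\<lambda>v. 1 / g v" pe + O: orthonormal_polys g po for pe po
begin

text \<open>The even part of the kernel for \<open>1 / g\<close> and the odd part of the kernel for \<open>g\<close>. They reproduce
even and odd polynomials, respectively, of degree at most \<open>2 * n\<close>.\<close>
definition even_kernel :: "nat \<Rightarrow> real \<Rightarrow> real \<Rightarrow> real" where
  "even_kernel n v w = (poly_kernel pe (2 * n) v w + poly_kernel pe (2 * n) v (- w)) / 2"

definition odd_kernel :: "nat \<Rightarrow> real \<Rightarrow> real \<Rightarrow> real" where
  "odd_kernel n v w = (poly_kernel po (2 * n) v w - poly_kernel po (2 * n) v (- w)) / 2"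

text \<open>The kernel of the projection in terms of algebraic kernels. The factor \<open>\<omega> / S\<close> comes from
\<open>du = \<omega> / S * c dy\<close>.\<close>
definition arc_kern :: "nat \<Rightarrow> real \<Rightarrow> real \<Rightarrow> real" where
  "arc_kern n x y = \<omega> / S * (even_kernel n (u x) (u y) + c x * c y * odd_kernel n (u x) (u y))"

lemma continuous_even_kernel: "continuous_on A f \<Longrightarrow> continuous_on A (\<lambda>w. even_kernel n v (f w))"
  and continuous_odd_kernel: "continuous_on A f \<Longrightarrow> continuous_on A (\<lambda>w. odd_kernel n v (f w))"
  unfolding even_kernel_def odd_kernel_def by (auto intro!: continuous_intros)

lemma continuous_arc_kern: "continuous_on A (\<lambda>y. arc_kern n x y)"
  unfolding arc_kern_def
  by (intro continuous_intros continuous_even_kernel continuous_odd_kernel continuous_u continuous_c)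

lemma even_kernel_minus: "even_kernel n v (- w) = even_kernel n v w"
  and odd_kernel_minus: "odd_kernel n v (- w) = - odd_kernel n v w"
  unfolding even_kernel_def odd_kernel_def minus_divide_left minus_diff_eq by (simp_all add: add.commute)

lemma even_kernel_reproducing:
  assumes "degree A \<le> 2 * n" "\<And>v. poly A (- v) = poly A v"
  shows "integral {-1..1} (\<lambda>w. poly A w * even_kernel n v w / g w) = poly A v"
proof -
  let ?f = "\<lambda>w. poly_kernel pe (2 * n) v w * poly A w * (1 / g w)"
  have c: "continuous_on {-1..1} ?f"
    by (intro continuous_intros E.w_cont)
  have cm: "continuous_on {-1..1} (\<lambda>w. ?f (- w))"
    by (rule continuous_on_compose2[OF c]) (auto intro!: continuous_intros)
  have "integral {-1..1} (\<lambda>w. poly A w * even_kernel n v w / g w) = integral {-1..1} (\<lambda>w. (?f w + ?f (- w)) / 2)"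
    by (simp add: even_kernel_def assms(2) g_minus algebra_simps add_divide_distrib)
  also have "\<dots> = (integral {-1..1} ?f + integral {-1..1} (\<lambda>w. ?f (- w))) / 2"
    by (subst integral_add_cont[OF c cm, symmetric]) simp
  also have "\<dots> = poly A v"
    unfolding integral_reflect_unit[of ?f] E.reproducing[OF assms(1)] by simp
  finally show ?thesis .
qed

lemma odd_kernel_reproducing:
  assumes "degree B \<le> 2 * n" "\<And>v. poly B (- v) = - poly B v"
  shows "integral {-1..1} (\<lambda>w. g w * poly B w * odd_kernel n v w) = poly B v"
proof -
  let ?f = "\<lambda>w. poly_kernel po (2 * n) v w * poly B w * g w"
  have c: "continuous_on {-1..1} ?f"
    by (intro continuous_intros O.w_cont)
  have cm: "continuous_on {-1..1} (\<lambda>w. ?f (- w))"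
    by (rule continuous_on_compose2[OF c]) (auto intro!: continuous_intros)
  have "integral {-1..1} (\<lambda>w. g w * poly B w * odd_kernel n v w) = integral {-1..1} (\<lambda>w. (?f w + ?f (- w)) / 2)"
    by (simp add: odd_kernel_def assms(2) g_minus algebra_simps add_divide_distrib diff_divide_distrib)
  also have "\<dots> = (integral {-1..1} ?f + integral {-1..1} (\<lambda>w. ?f (- w))) / 2"
    by (subst integral_add_cont[OF c cm, symmetric]) simp
  also have "\<dots> = poly B v"
    unfolding integral_reflect_unit[of ?f] O.reproducing[OF assms(1)] by simp
  finally show ?thesis .
qed

lemma arc_kern_even:
  assumes "degree A \<le> 2 * n" "\<And>v. poly A (- v) = poly A v"
  shows "integral {-1..1} (\<lambda>y. poly A (u y) * arc_kern n x y) = poly A (u x)"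
proof -
  let ?f = "\<lambda>w. poly A w * even_kernel n (u x) w / g w"
  let ?h = "\<lambda>w. c x * (poly A w * odd_kernel n (u x) w)"
  have cf: "continuous_on {-1..1} ?f" and ch: "continuous_on {-1..1} ?h"
    using g_pos
    by (auto intro!: continuous_intros continuous_g continuous_even_kernel continuous_odd_kernel simp: less_imp_neq[THEN not_sym])
  have cu: "continuous_on {-1..1} (\<lambda>y. \<omega> / S * c y * f (u y))" if "continuous_on {-1..1} f" for f
    by (intro continuous_intros continuous_c continuous_on_compose2[OF that continuous_u])
      (use u_range S_pos in auto)
  have "integral {-1..1} (\<lambda>y. poly A (u y) * arc_kern n x y)
      = integral {-1..1} (\<lambda>y. \<omega> / S * c y * ?f (u y) + \<omega> / S * c y * ?h (u y))"
  proof (rule integral_cong)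
    fix y :: real assume y: "y \<in> {-1..1}"
    show "poly A (u y) * arc_kern n x y = \<omega> / S * c y * ?f (u y) + \<omega> / S * c y * ?h (u y)"
      using c_pos[OF y] by (simp add: arc_kern_def g_u[OF y] algebra_simps)
  qed
  also have "\<dots> = integral {-1..1} ?f + integral {-1..1} ?h"
    unfolding integral_add_cont[OF cu[OF cf] cu[OF ch]] integral_substitution_u[OF cf] integral_substitution_u[OF ch] ..
  also have "integral {-1..1} ?h = 0" by (rule integral_odd) (simp add: odd_kernel_minus assms(2))
  finally show ?thesis by (simp add: even_kernel_reproducing[OF assms])
qed

lemma arc_kern_odd:
  assumes "degree B \<le> 2 * n" "\<And>v. poly B (- v) = - poly B v"
  shows "integral {-1..1} (\<lambda>y. c y * poly B (u y) * arc_kern n x y) = c x * poly B (u x)"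
proof -
  let ?f = "\<lambda>w. poly B w * even_kernel n (u x) w"
  let ?h = "\<lambda>w. c x * (g w * poly B w * odd_kernel n (u x) w)"
  have cf: "continuous_on {-1..1} ?f" and ch: "continuous_on {-1..1} ?h"
    by (intro continuous_intros continuous_g continuous_even_kernel continuous_odd_kernel)+
  have cu: "continuous_on {-1..1} (\<lambda>y. \<omega> / S * c y * f (u y))" if "continuous_on {-1..1} f" for f
    by (intro continuous_intros continuous_c continuous_on_compose2[OF that continuous_u])
      (use u_range S_pos in auto)
  have "integral {-1..1} (\<lambda>y. c y * poly B (u y) * arc_kern n x y)
      = integral {-1..1} (\<lambda>y. \<omega> / S * c y * ?f (u y) + \<omega> / S * c y * ?h (u y))"
  proof (rule integral_cong)
    fix y :: real assume y: "y \<in> {-1..1}"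
    show "c y * poly B (u y) * arc_kern n x y = \<omega> / S * c y * ?f (u y) + \<omega> / S * c y * ?h (u y)"
      by (simp add: arc_kern_def g_u[OF y] algebra_simps)
  qed
  also have "\<dots> = integral {-1..1} ?f + integral {-1..1} ?h"
    unfolding integral_add_cont[OF cu[OF cf] cu[OF ch]] integral_substitution_u[OF cf] integral_substitution_u[OF ch] ..
  also have "integral {-1..1} ?f = 0" by (rule integral_odd) (simp add: even_kernel_minus assms(2))
  finally show ?thesis by (simp add: odd_kernel_reproducing[OF assms])
qed

lemma arc_kern_cos_sin:
  assumes "\<bar>j\<bar> \<le> int n"
  shows "integral {-1..1} (\<lambda>y. cos (2 * \<omega> * of_int j * y) * arc_kern n x y) = cos (2 * \<omega> * of_int j * x)"
    and "integral {-1..1} (\<lambda>y. sin (2 * \<omega> * of_int j * y) * arc_kern n x y) = sin (2 * \<omega> * of_int j * x)"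
proof -
  define k where "k = nat \<bar>j\<bar>"
  have k: "k \<le> n" using assms by (simp add: k_def)
  obtain A B where AB: "degree A \<le> 2 * k" "degree B \<le> 2 * k" "\<And>v. poly A (- v) = poly A v" "\<And>v. poly B (- v) = - poly B v"
    "\<And>y. cos (2 * \<omega> * real k * y) = poly A (u y)" "\<And>y. sin (2 * \<omega> * real k * y) = c y * poly B (u y)"
    using cos_sin_as_poly[of k] by blast
  have d: "degree A \<le> 2 * n" "degree B \<le> 2 * n" using AB(1,2) k by linarith+
  have C: "integral {-1..1} (\<lambda>y. cos (2 * \<omega> * real k * y) * arc_kern n x y) = cos (2 * \<omega> * real k * x)"
    unfolding AB(5) by (rule arc_kern_even[OF d(1) AB(3)])
  have D: "integral {-1..1} (\<lambda>y. sin (2 * \<omega> * real k * y) * arc_kern n x y) = sin (2 * \<omega> * real k * x)"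
    unfolding AB(6) by (rule arc_kern_odd[OF d(2) AB(4)])
  have "j = int k \<or> j = - int k" by (auto simp: k_def)
  then show "integral {-1..1} (\<lambda>y. cos (2 * \<omega> * of_int j * y) * arc_kern n x y) = cos (2 * \<omega> * of_int j * x)"
    and "integral {-1..1} (\<lambda>y. sin (2 * \<omega> * of_int j * y) * arc_kern n x y) = sin (2 * \<omega> * of_int j * x)"
    using C D by auto
qed

lemma arc_kern_trig_fun:
  assumes "\<bar>j\<bar> \<le> int n"
  shows "L2_inner (trig_fun T j) (\<lambda>y. of_real (arc_kern n x y)) = trig_fun T j x"
proof -
  let ?a = "\<lambda>y. cos (2 * \<omega> * of_int j * y) * arc_kern n x y"
  let ?b = "\<lambda>y. sin (2 * \<omega> * of_int j * y) * arc_kern n x y"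
  have ca: "continuous_on UNIV ?a" and cb: "continuous_on UNIV ?b"
    by (intro continuous_intros continuous_arc_kern)+
  have "L2_inner (trig_fun T j) (\<lambda>y. of_real (arc_kern n x y))
      = (LINT y:{-1..1}|lborel. complex_of_real (?a y) + \<i> * complex_of_real (?b y))"
    unfolding L2_inner_def trig_fun_eq by (simp add: algebra_simps)
  also have "\<dots> = (LINT y:{-1..1}|lborel. complex_of_real (?a y)) + (LINT y:{-1..1}|lborel. \<i> * complex_of_real (?b y))"
    by (intro set_integral_add set_integrable_continuous continuous_intros ca cb)
  also have "\<dots> = of_real (integral {-1..1} ?a) + \<i> * of_real (integral {-1..1} ?b)"
    unfolding set_integral_mult_right set_integral_complex_of_real LINT_eq_integral[OF ca] LINT_eq_integral[OF cb] ..
  also have "\<dots> = trig_fun T j x"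
    unfolding arc_kern_cos_sin[OF assms] trig_fun_eq ..
  finally show ?thesis .
qed

lemma arc_kern_reproducing:
  assumes "f \<in> trig_space T n"
  shows "L2_inner f (\<lambda>y. of_real (arc_kern n x y)) = f x"
proof -
  obtain a where f: "f = (\<lambda>x. \<Sum>j\<in>{- int n..int n}. a j * trig_fun T j x)"
    using assms unfolding trig_space_def lincomb_span_def by blast
  have "L2_inner f (\<lambda>y. of_real (arc_kern n x y))
      = (\<Sum>j\<in>{- int n..int n}. a j * L2_inner (trig_fun T j) (\<lambda>y. of_real (arc_kern n x y)))"
    unfolding f by (intro L2_inner_sum_left square_integrable_continuous continuous_trig_fun
        continuous_on_of_real continuous_arc_kern)
  also have "\<dots> = f x" unfolding f by (intro sum.cong) (auto simp: arc_kern_trig_fun abs_le_iff)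
  finally show ?thesis .
qed

lemma arc_kern_in_trig_space: "(\<lambda>y. of_real (arc_kern n x y)) \<in> trig_space T n"
proof -
  let ?r = "kernel_poly pe (2 * n) (u x)" and ?s = "kernel_poly po (2 * n) (u x)"
  have "(\<lambda>y. of_real (\<omega> / S / 2) * of_real (poly ?r (u y) + poly ?r (- u y))
      + of_real (\<omega> / S / 2 * c x) * of_real (c y * (poly ?s (u y) - poly ?s (- u y)))) \<in> trig_space T n"
    by (intro trig_space_add trig_space_scale even_part_in_trig_space odd_part_in_trig_space
        E.degree_kernel_poly O.degree_kernel_poly)
  moreover have "(\<lambda>y. of_real (\<omega> / S / 2) * of_real (poly ?r (u y) + poly ?r (- u y))
      + of_real (\<omega> / S / 2 * c x) * of_real (c y * (poly ?s (u y) - poly ?s (- u y))))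
      = (\<lambda>y. complex_of_real (arc_kern n x y))"
    unfolding arc_kern_def even_kernel_def odd_kernel_def poly_of_kernel_poly of_real_mult[symmetric] of_real_add[symmetric]
    by (simp add: fun_eq_iff algebra_simps add_divide_distrib diff_divide_distrib)
  ultimately show ?thesis by simp
qed

text \<open>The function \<open>arc_kern\<close> reproduces trigonometric polynomials of degree \<open>n\<close> and is one in its second
argument, so it is the kernel of the projection. As it is real, it also equals the complex
conjugate of the kernel, which is what the expansion in an orthonormal basis yields.\<close>
theorem proj_kernel_eq_arc_kern: "cmod (proj_kernel T n x y) = \<bar>arc_kern n x y\<bar>"
proof -
  obtain e where e: "orthonormal_basis T n e" using orthonormal_basis_exists[OF T] by blast
  let ?k = "\<lambda>y. complex_of_real (arc_kern n x y)"
  have "?k y = (\<Sum>j=1..2*n+1. L2_inner ?k (e j) * e j y)"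
    by (rule orthonormal_basis_expand[OF e arc_kern_in_trig_space])
  also have "\<dots> = (\<Sum>j=1..2*n+1. cnj (e j x) * e j y)"
  proof (rule sum.cong)
    fix j assume j: "j \<in> {1..2*n+1}"
    have "L2_inner ?k (e j) = cnj (L2_inner (e j) ?k)" by (rule L2_inner_cnj)
    also have "\<dots> = cnj (e j x)"
      by (simp only: arc_kern_reproducing[OF orthonormal_basis_member[OF e j]])
    finally show "L2_inner ?k (e j) * e j y = cnj (e j x) * e j y" by simp
  qed simp
  also have "\<dots> = cnj (proj_kernel T n x y)"
    unfolding proj_kernel_eq[OF e] by (simp add: cnj_sum)
  finally have "cmod (?k y) = cmod (proj_kernel T n x y)" by (simp only: complex_mod_cnj)
  then show ?thesis by simp
qed

theorem lebesgue_function_le: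
  assumes x: "x \<in> {-1..1}"
  shows "lebesgue_function T n x \<le> (poly_lebesgue pe (2 * n) (u x) + poly_lebesgue po (2 * n) (u x)) / c 1"
proof -
  let ?E = "\<lambda>w. \<bar>even_kernel n (u x) w\<bar>" and ?O = "\<lambda>w. \<bar>odd_kernel n (u x) w\<bar>"
  have c1: "0 < c 1" using c_pos[of 1] by simp
  have k: "0 < \<omega> / S" using omega S_pos by simp
  have cE: "continuous_on {-1..1} ?E" and cO: "continuous_on {-1..1} ?O"
    by (intro continuous_intros continuous_even_kernel continuous_odd_kernel)+
  have cu: "continuous_on {-1..1} (\<lambda>y. \<omega> / S * c y * (?E (u y) + ?O (u y)))"
    by (intro continuous_intros continuous_c continuous_even_kernel continuous_odd_kernel continuous_u)
  have "lebesgue_function T n x = integral {-1..1} (\<lambda>y. \<bar>arc_kern n x y\<bar>)"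
    unfolding lebesgue_function_def proj_kernel_eq_arc_kern
    by (intro LINT_eq_integral continuous_intros continuous_arc_kern)
  also have "\<dots> \<le> integral {-1..1} (\<lambda>y. \<omega> / S * c y * (?E (u y) + ?O (u y)) * (1 / c 1))"
  proof (rule integral_le_cont)
    fix y :: real assume y: "y \<in> {-1..1}"
    have cx: "0 < c x" "c x \<le> 1" "0 < c y" "c y \<le> 1" using c_pos[OF x] c_pos[OF y] c_le by auto
    have "\<bar>arc_kern n x y\<bar> = \<omega> / S * \<bar>even_kernel n (u x) (u y) + c x * c y * odd_kernel n (u x) (u y)\<bar>"
      unfolding arc_kern_def abs_mult[of "\<omega> / S"] abs_of_pos[OF k] ..
    also have "\<dots> \<le> \<omega> / S * (?E (u y) + (c x * c y) * ?O (u y))"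
      using k cx by (intro mult_left_mono order_trans[OF abs_triangle_ineq]) (auto simp: abs_mult)
    also have "\<dots> \<le> \<omega> / S * (?E (u y) + 1 * ?O (u y))"
      using k cx by (intro mult_left_mono add_left_mono mult_right_mono mult_le_one) auto
    also have "\<dots> = \<omega> / S * c 1 * (?E (u y) + ?O (u y)) * (1 / c 1)" using c1 by simp
    also have "\<dots> \<le> \<omega> / S * c y * (?E (u y) + ?O (u y)) * (1 / c 1)"
      using k c1 c_ge[OF y] by (intro mult_right_mono mult_left_mono) auto
    finally show "\<bar>arc_kern n x y\<bar> \<le> \<omega> / S * c y * (?E (u y) + ?O (u y)) * (1 / c 1)" .
  qed (intro continuous_intros continuous_arc_kern cu)+
  also have "\<dots> = integral {-1..1} (\<lambda>w. ?E w + ?O w) * (1 / c 1)"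
    unfolding integral_mult_left integral_substitution_u[OF continuous_on_add[OF cE cO]] ..
  also have "\<dots> \<le> (poly_lebesgue pe (2 * n) (u x) + poly_lebesgue po (2 * n) (u x)) * (1 / c 1)"
  proof (rule mult_right_mono)
    have sym: "integral {-1..1} (\<lambda>w. (\<bar>f w\<bar> + \<bar>f (- w)\<bar>) / 2) = integral {-1..1} (\<lambda>w. \<bar>f w\<bar>)"
      if f: "continuous_on {-1..1} f" for f :: "real \<Rightarrow> real"
    proof -
      have a: "continuous_on {-1..1} (\<lambda>w. \<bar>f w\<bar>)" using f by (intro continuous_intros)
      have b: "continuous_on {-1..1} (\<lambda>w. \<bar>f (- w)\<bar>)"
        by (rule continuous_on_compose2[OF a]) (auto intro!: continuous_intros)
      have "integral {-1..1} (\<lambda>w. (\<bar>f w\<bar> + \<bar>f (- w)\<bar>) / 2)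
          = (integral {-1..1} (\<lambda>w. \<bar>f w\<bar>) + integral {-1..1} (\<lambda>w. \<bar>f (- w)\<bar>)) / 2"
        unfolding integral_add_cont[OF a b, symmetric] by simp
      then show ?thesis using integral_reflect_unit[of "\<lambda>w. \<bar>f w\<bar>"] by simp
    qed
    have "integral {-1..1} ?E \<le> integral {-1..1} (\<lambda>w. (\<bar>poly_kernel pe (2 * n) (u x) w\<bar> + \<bar>poly_kernel pe (2 * n) (u x) (- w)\<bar>) / 2)"
      unfolding even_kernel_def by (rule integral_le_cont) (auto intro!: continuous_intros)
    also have "\<dots> = poly_lebesgue pe (2 * n) (u x)"
      unfolding poly_lebesgue_def by (rule sym) (intro continuous_intros)
    finally have e: "integral {-1..1} ?E \<le> poly_lebesgue pe (2 * n) (u x)" .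
    have "integral {-1..1} ?O \<le> integral {-1..1} (\<lambda>w. (\<bar>poly_kernel po (2 * n) (u x) w\<bar> + \<bar>poly_kernel po (2 * n) (u x) (- w)\<bar>) / 2)"
      unfolding odd_kernel_def by (rule integral_le_cont) (auto intro!: continuous_intros)
    also have "\<dots> = poly_lebesgue po (2 * n) (u x)"
      unfolding poly_lebesgue_def by (rule sym) (intro continuous_intros)
    finally have o: "integral {-1..1} ?O \<le> poly_lebesgue po (2 * n) (u x)" .
    show "integral {-1..1} (\<lambda>w. ?E w + ?O w) \<le> poly_lebesgue pe (2 * n) (u x) + poly_lebesgue po (2 * n) (u x)"
      unfolding integral_add_cont[OF cE cO] using e o by (rule add_mono)
  qed (use c1 in simp)
  finally show ?thesis by simp
qed

end

section \<open>Growth of the Lebesgue function\<close>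
context arc
begin

lemma arc_comparisons_exist:
  obtains q pe po F1 M1 F2 M2 where "arc_kernel T pe po"
    "legendre_comparison q pe (\<lambda>v. 1 / g v) F1 1 (1 / c 1) M1"
    "legendre_comparison q po g F2 (c 1) 1 M2"
proof -
  obtain q where "orthonormal_polys (\<lambda>_. 1) q"
    using orthonormal_polys_exist[of "\<lambda>_. 1"] by (auto intro: continuous_on_const)
  then have q: "legendre_polys q" by (rule legendre_polys.intro)
  have cg: "continuous_on {-1..1} (\<lambda>v. 1 / g v)"
    using g_pos by (intro continuous_intros continuous_g) (auto simp: less_imp_neq[THEN not_sym])
  obtain pe where pe: "orthonormal_polys (\<lambda>v. 1 / g v) pe"
    using orthonormal_polys_exist[OF cg] g_pos by auto
  obtain po where po: "orthonormal_polys g po"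
    using orthonormal_polys_exist[OF continuous_g] g_pos by auto
  have "arc_kernel T pe po" using pe po by (intro arc_kernel.intro arc_axioms)
  then show ?thesis using that comparison_inverse_g[OF q pe] comparison_g[OF q po] by blast
qed

theorem lebesgue_function_le_sqrt:
  "\<exists>C. \<forall>n. \<forall>x\<in>{-1..1}. lebesgue_function T n x \<le> C * sqrt (real (2 * n + 1))"
proof -
  obtain q pe po F1 M1 F2 M2 where k: "arc_kernel T pe po"
    and 1: "legendre_comparison q pe (\<lambda>v. 1 / g v) F1 1 (1 / c 1) M1"
    and 2: "legendre_comparison q po g F2 (c 1) 1 M2" by (rule arc_comparisons_exist)
  obtain C where C: "\<And>m x. x \<in> {-1..1} \<Longrightarrow> poly_lebesgue pe m x \<le> C * sqrt (real m + 1)"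
    using legendre_comparison.lebesgue_le_sqrt[OF 1] by blast
  obtain D where D: "\<And>m x. x \<in> {-1..1} \<Longrightarrow> poly_lebesgue po m x \<le> D * sqrt (real m + 1)"
    using legendre_comparison.lebesgue_le_sqrt[OF 2] by blast
  have "lebesgue_function T n x \<le> (C + D) / c 1 * sqrt (real (2 * n + 1))" if x: "x \<in> {-1..1}" for n x
  proof -
    have "poly_lebesgue pe (2 * n) (u x) + poly_lebesgue po (2 * n) (u x) \<le> (C + D) * sqrt (real (2 * n + 1))"
      using C[OF u_range[OF x], of "2 * n"] D[OF u_range[OF x], of "2 * n"] by (simp add: algebra_simps)
    from divide_right_mono[OF this, of "c 1"]
    show ?thesis using arc_kernel.lebesgue_function_le[OF k x, of n] c_pos[of 1] by simp
  qed
  then show ?thesis by blast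
qed

theorem lebesgue_function_le_ln_inside:
  assumes b: "b < 1"
  shows "\<exists>C. \<forall>n x. \<bar>x\<bar> \<le> b \<longrightarrow> lebesgue_function T n x \<le> C * (1 + ln (2 * real (2 * n) + 3))"
proof (cases "0 \<le> b")
  case False
  then show ?thesis by auto
next
  case True
  obtain q pe po F1 M1 F2 M2 where k: "arc_kernel T pe po"
    and 1: "legendre_comparison q pe (\<lambda>v. 1 / g v) F1 1 (1 / c 1) M1"
    and 2: "legendre_comparison q po g F2 (c 1) 1 M2" by (rule arc_comparisons_exist)
  have ub: "u b < 1" by (rule u_less_1[OF True b])
  obtain C where C: "\<And>m x. \<bar>x\<bar> \<le> u b \<Longrightarrow> poly_lebesgue pe m x \<le> C * (1 + ln (2 * real m + 3))"
    using legendre_comparison.lebesgue_le_ln_inside[OF 1 ub] by blast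
  obtain D where D: "\<And>m x. \<bar>x\<bar> \<le> u b \<Longrightarrow> poly_lebesgue po m x \<le> D * (1 + ln (2 * real m + 3))"
    using legendre_comparison.lebesgue_le_ln_inside[OF 2 ub] by blast
  have "lebesgue_function T n x \<le> (C + D) / c 1 * (1 + ln (2 * real (2 * n) + 3))" if x: "\<bar>x\<bar> \<le> b" for n x
  proof -
    have ux: "\<bar>u x\<bar> \<le> u b" using x b by (intro u_mono) auto
    have x1: "x \<in> {-1..1}" using x b by auto
    have "poly_lebesgue pe (2 * n) (u x) + poly_lebesgue po (2 * n) (u x)
        \<le> (C + D) * (1 + ln (2 * real (2 * n) + 3))"
      using add_mono[OF C[OF ux, of "2 * n"] D[OF ux, of "2 * n"]] by (simp only: distrib_right)
    from divide_right_mono[OF this, of "c 1"]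
    show ?thesis using arc_kernel.lebesgue_function_le[OF k x1, of n] c_pos[of 1] by simp
  qed
  then show ?thesis by blast
qed

end

lemma lebesgue_function_nonneg: "0 \<le> lebesgue_function T n x"
  unfolding lebesgue_function_def set_lebesgue_integral_def by (intro Bochner_Integration.integral_nonneg) simp

theorem theorem4p1:
  fixes T :: real
  assumes "T > 1"
  shows "(\<forall>a b. -1 < a \<and> a \<le> b \<and> b < 1 \<longrightarrow>
           (\<lambda>n. SUP x\<in>{a..b}. lebesgue_function T n x) \<in> O(\<lambda>n. ln (real (2 * n + 1)))) \<and>
         (\<lambda>n. SUP x\<in>{-1..1}. lebesgue_function T n x) \<in> O(\<lambda>n. real (2 * n + 1) powr (1 / 2))"
proof (intro conjI allI impI)
  interpret arc T by standard (rule assms)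
  fix a b :: real assume ab: "-1 < a \<and> a \<le> b \<and> b < 1"
  define \<beta> where "\<beta> = max \<bar>a\<bar> \<bar>b\<bar>"
  have \<beta>: "\<beta> < 1" using ab by (auto simp: \<beta>_def)
  obtain C where C: "\<And>n x. \<bar>x\<bar> \<le> \<beta> \<Longrightarrow> lebesgue_function T n x \<le> C * (1 + ln (2 * real (2 * n) + 3))"
    using lebesgue_function_le_ln_inside[OF \<beta>] by blast
  show "(\<lambda>n. SUP x\<in>{a..b}. lebesgue_function T n x) \<in> O(\<lambda>n. ln (real (2 * n + 1)))"
    \<comment> \<open>The comparison function vanishes at \<open>n = 0\<close>, so the estimate starts at \<open>n = 1\<close>.\<close>
  proof (rule bigoI[of _ "3 * \<bar>C\<bar>"], rule eventually_mono[OF eventually_ge_at_top[of 1]])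
    fix n :: nat assume n: "1 \<le> n"
    let ?l = "ln (real (2 * n + 1))"
    have "exp 1 \<le> real (2 * n + 1)" using exp_le n by simp
    then have l1: "1 \<le> ?l" by (simp add: ln_ge_iff)
    have "2 * real (2 * n) + 3 \<le> (real (2 * n + 1))\<^sup>2"
    proof -
      have "1 \<le> real n" using n by simp
      then have "1 * 1 \<le> real n * real n" by (intro mult_mono) auto
      then show ?thesis by (simp add: power2_eq_square algebra_simps)
    qed
    then have "ln (2 * real (2 * n) + 3) \<le> ln ((real (2 * n + 1))\<^sup>2)" by simp
    also have "\<dots> = 2 * ?l" by (simp add: ln_realpow)
    finally have l2: "1 + ln (2 * real (2 * n) + 3) \<le> 3 * ?l" using l1 by simp
    have l0: "0 \<le> 1 + ln (2 * real (2 * n) + 3)" by (simp add: ln_ge_zero add_nonneg_nonneg)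
    have "\<bar>lebesgue_function T n x\<bar> \<le> 3 * \<bar>C\<bar> * ?l" if "x \<in> {a..b}" for x
    proof -
      have "lebesgue_function T n x \<le> C * (1 + ln (2 * real (2 * n) + 3))"
        using that by (intro C) (auto simp: \<beta>_def)
      also have "\<dots> \<le> \<bar>C\<bar> * (3 * ?l)" using l0 l2 by (intro mult_mono) auto
      finally show ?thesis using lebesgue_function_nonneg[of T n x] by simp
    qed
    then have "\<bar>SUP x\<in>{a..b}. lebesgue_function T n x\<bar> \<le> 3 * \<bar>C\<bar> * ?l"
      using ab by (intro cSup_abs_le) auto
    then show "norm (SUP x\<in>{a..b}. lebesgue_function T n x) \<le> 3 * \<bar>C\<bar> * norm ?l"
      using l1 by simp
  qed
next
  interpret arc T by standard (rule assms)
  obtain C where C: "\<And>n x. x \<in> {-1..1} \<Longrightarrow> lebesgue_function T n x \<le> C * sqrt (real (2 * n + 1))"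
    using lebesgue_function_le_sqrt by blast
  show "(\<lambda>n. SUP x\<in>{-1..1}. lebesgue_function T n x) \<in> O(\<lambda>n. real (2 * n + 1) powr (1 / 2))"
  proof (rule bigoI[of _ C], rule always_eventually, rule allI)
    fix n :: nat
    have "\<bar>SUP x\<in>{-1..1}. lebesgue_function T n x\<bar> \<le> C * sqrt (real (2 * n + 1))"
      using C lebesgue_function_nonneg by (intro cSup_abs_le) auto
    then show "norm (SUP x\<in>{-1..1}. lebesgue_function T n x) \<le> C * norm (real (2 * n + 1) powr (1 / 2))"
      by (simp add: powr_half_sqrt)
  qed
qed

end
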